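(* Let $0<\rho<1$, and let $J(t)$ be the integrated current across the bond $(0,1)$ up to time $t$ in the one dimensional nearest-neighbor symmetric simple exclusion process. Under initial distribution $\nu_\rho$, the stochastic process $\lambda^{-1/4}J(\lambda t)$, $t\in[0,1]$ (indexed by the scaling parameter $\lambda$, with $\lambda\uparrow\infty$), is tight in $D([0,1])$ endowed with the uniform topology.
   Context: The one dimensional nearest-neighbor symmetric simple exclusion process is the Markov process $\eta_t=\{\eta_t(x):x\in\mathbb Z\}$ on $\Sigma=\{0,1\}^{\mathbb Z}$ with generator $(L\phi)(\eta)=\frac12\sum_{x\in\mathbb Z}[\phi(\eta^{x,x+1})-\phi(\eta)]$, where $\eta^{x,x+1}$ is obtained from $\eta$ by exchanging the values at $x$ and $x+1$. Here $\eta(x)=1$ means that site $x$ is occupied by a particle. For $\rho\in[0,1]$, $\nu_\rho$ is the product Bernoulli measure on $\Sigma$ with $\nu_\rho(\eta(x)=1)=\rho$ for all $x$; it is invariant for the process. Current: $J(t)=N_+(t)-N_-(t)$, where $N_+(t)$ (resp. $N_-(t)$) is the number of particles that jump from $0$ to $1$ (resp. from $1$ to $0$) up to time $t$; these are counting processes with rates $\frac12\eta_s(0)(1-\eta_s(1))$ and $\frac12\eta_s(1)(1-\eta_s(0))$ respectively. $D([0,1])$ is the space of right-continuous real functions with left limits on $[0,1]$. *)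

theory Defs
  imports "HOL-Probability.Probability"
begin

section \<open>Configurations\<close>

text \<open>\<open>True\<close> plays the role of 1 (occupied). The type carries the product topology of the discrete
  topology on the state space of a site, and its Borel sigma-algebra is the product one.\<close>

type_synonym config = "int \<Rightarrow> bool"

instance bool :: second_countable_topology
proof
  show "\<exists>B::bool set set. countable B \<and> open = generate_topology B"
  proof (intro exI conjI)
    show "countable (range (\<lambda>a::bool. {..< a}) \<union> range (\<lambda>a. {a <..}))"
      by (simp add: countable_finite)
    show "open = generate_topology (range (\<lambda>a::bool. {..< a}) \<union> range (\<lambda>a. {a <..}))"
      by (rule open_bool_def)
  qed
qed

definition exchange :: "int \<Rightarrow> config \<Rightarrow> config" where
  "exchange x \<eta> = \<eta>(x := \<eta> (x + 1), x + 1 := \<eta> x)"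

definition bernoulli_product :: "real \<Rightarrow> config measure" where
  "bernoulli_product \<rho> = PiM UNIV (\<lambda>_. measure_pmf (bernoulli_pmf \<rho>))"

lemma sets_bernoulli_product [measurable_cong]: "sets (bernoulli_product \<rho>) = sets borel"
proof -
  have "sets (bernoulli_product \<rho>) = sets (PiM UNIV (\<lambda>_::int. borel :: bool measure))"
    unfolding bernoulli_product_def
    by (rule sets_PiM_cong) (simp_all add: sets_borel_eq_count_space)
  then show ?thesis
    by (simp add: sets_PiM_equal_borel)
qed

section \<open>The generator and its semigroup\<close>

text \<open>The configuration space is compact, so the type of bounded continuous functions on it is the
  Banach space \<open>C(\<Sigma>)\<close> of continuous functions with the supremum norm.\<close>

definition local_function :: "(config \<Rightarrow>\<^sub>C real) \<Rightarrow> bool" where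
  "local_function \<phi> \<longleftrightarrow>
     (\<exists>A. finite A \<and> (\<forall>\<eta> \<xi>. (\<forall>x\<in>A. \<eta> x = \<xi> x) \<longrightarrow> apply_bcontfun \<phi> \<eta> = apply_bcontfun \<phi> \<xi>))"

text \<open>For a local function only finitely many terms of this sum are nonzero.\<close>

definition ssep_operator :: "(config \<Rightarrow> real) \<Rightarrow> config \<Rightarrow> real" where
  "ssep_operator \<phi> \<eta> = (1/2) * (\<Sum>\<^sub>\<infinity>x\<in>UNIV. \<phi> (exchange x \<eta>) - \<phi> \<eta>)"

definition ssep_graph :: "((config \<Rightarrow>\<^sub>C real) \<times> (config \<Rightarrow>\<^sub>C real)) set" where
  "ssep_graph = {(\<phi>, \<psi>). local_function \<phi> \<and>
     (\<forall>\<eta>. apply_bcontfun \<psi> \<eta> = ssep_operator (apply_bcontfun \<phi>) \<eta>)}"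

text \<open>Markov semigroups on \<open>C(X)\<close> in the sense of Liggett; only times \<open>t \<ge> 0\<close> matter.\<close>

definition markov_semigroup ::
    "(real \<Rightarrow> ('s::topological_space \<Rightarrow>\<^sub>C real) \<Rightarrow> ('s \<Rightarrow>\<^sub>C real)) \<Rightarrow> bool" where
  "markov_semigroup S \<longleftrightarrow>
     (\<forall>t\<ge>0. linear (S t)) \<and>
     (\<forall>f. S 0 f = f) \<and>
     (\<forall>f. \<forall>t\<ge>0. ((\<lambda>s. S s f) \<longlongrightarrow> S t f) (at_right t)) \<and>
     (\<forall>f. \<forall>s\<ge>0. \<forall>t\<ge>0. S (s + t) f = S s (S t f)) \<and>
     (\<forall>t\<ge>0. S t (const_bcontfun 1) = const_bcontfun 1) \<and>
     (\<forall>t\<ge>0. \<forall>f. (\<forall>x. 0 \<le> apply_bcontfun f x) \<longrightarrow> (\<forall>x. 0 \<le> apply_bcontfun (S t f) x))"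

definition generator_graph ::
    "(real \<Rightarrow> ('s::topological_space \<Rightarrow>\<^sub>C real) \<Rightarrow> ('s \<Rightarrow>\<^sub>C real))
      \<Rightarrow> (('s \<Rightarrow>\<^sub>C real) \<times> ('s \<Rightarrow>\<^sub>C real)) set" where
  "generator_graph S = {(f, g). ((\<lambda>t. (1 / t) *\<^sub>R (S t f - f)) \<longlongrightarrow> g) (at_right 0)}"

text \<open>As usual, the semigroup with generator \<open>L\<close> is the one whose generator is the closure of \<open>L\<close>
  on local functions.\<close>

definition ssep_semigroup :: "(real \<Rightarrow> (config \<Rightarrow>\<^sub>C real) \<Rightarrow> (config \<Rightarrow>\<^sub>C real)) \<Rightarrow> bool" where
  "ssep_semigroup S \<longleftrightarrow> markov_semigroup S \<and> generator_graph S = closure ssep_graph"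

section \<open>The process\<close>

definition history ::
    "'a measure \<Rightarrow> (real \<Rightarrow> 'a \<Rightarrow> 's::topological_space) \<Rightarrow> real \<Rightarrow> 'a measure" where
  "history M X s = sigma (space M) {X u -` A \<inter> space M |u A. 0 \<le> u \<and> u \<le> s \<and> A \<in> sets borel}"

definition cadlag_path :: "(real \<Rightarrow> 's::topological_space) \<Rightarrow> bool" where
  "cadlag_path \<xi> \<longleftrightarrow>
     (\<forall>t\<ge>0. (\<xi> \<longlongrightarrow> \<xi> t) (at_right t)) \<and> (\<forall>t>0. \<exists>l. (\<xi> \<longlongrightarrow> l) (at_left t))"

definition markov_process ::
    "'a measure \<Rightarrow> (real \<Rightarrow> ('s::topological_space \<Rightarrow>\<^sub>C real) \<Rightarrow> ('s \<Rightarrow>\<^sub>C real))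
      \<Rightarrow> (real \<Rightarrow> 'a \<Rightarrow> 's) \<Rightarrow> bool" where
  "markov_process M S X \<longleftrightarrow>
     prob_space M \<and>
     (\<forall>t\<ge>0. X t \<in> borel_measurable M) \<and>
     (\<forall>\<omega>\<in>space M. cadlag_path (\<lambda>t. X t \<omega>)) \<and>
     (\<forall>s\<ge>0. \<forall>t\<ge>0. \<forall>f. AE \<omega> in M.
        real_cond_exp M (history M X s) (\<lambda>\<omega>'. apply_bcontfun f (X (s + t) \<omega>')) \<omega> =
        apply_bcontfun (S t f) (X s \<omega>))"

definition ssep :: "'a measure \<Rightarrow> (real \<Rightarrow> 'a \<Rightarrow> config) \<Rightarrow> bool" where
  "ssep M \<eta> \<longleftrightarrow> (\<exists>S. ssep_semigroup S \<and> markov_process M S \<eta>)"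

section \<open>The current\<close>

text \<open>A particle jumps from \<open>x\<close> to \<open>y\<close> at time \<open>s\<close> if just before \<open>s\<close> the site \<open>x\<close> is occupied and
  \<open>y\<close> is empty, while at time \<open>s\<close> it is the other way round. Exchanges of two particles are not
  jumps; they leave the configuration unchanged and would not contribute to the current anyway.
  Along a path with left limits in the product topology the sets of jump times below are finite.\<close>

definition jump_time :: "(real \<Rightarrow> config) \<Rightarrow> int \<Rightarrow> int \<Rightarrow> real \<Rightarrow> bool" where
  "jump_time \<xi> x y s \<longleftrightarrow>
     (\<forall>\<^sub>F u in at_left s. \<xi> u x \<and> \<not> \<xi> u y) \<and> \<not> \<xi> s x \<and> \<xi> s y"

definition jump_count :: "(real \<Rightarrow> config) \<Rightarrow> int \<Rightarrow> int \<Rightarrow> real \<Rightarrow> nat" where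
  "jump_count \<xi> x y t = card {s. 0 < s \<and> s \<le> t \<and> jump_time \<xi> x y s}"

definition current :: "(real \<Rightarrow> config) \<Rightarrow> real \<Rightarrow> real" where
  "current \<xi> t = real (jump_count \<xi> 0 1 t) - real (jump_count \<xi> 1 0 t)"

section \<open>The space D([0,1]) with the uniform metric\<close>

definition cadlag01 :: "(real \<Rightarrow> real) set" where
  "cadlag01 = {f \<in> extensional {0..1}.
     (\<forall>t\<in>{0..<1}. (f \<longlongrightarrow> f t) (at_right t)) \<and> (\<forall>t\<in>{0<..1}. \<exists>l. (f \<longlongrightarrow> l) (at_left t))}"

text \<open>\<^term>\<open>funspace\<close> is the metric space of bounded functions with the supremum distance; that
  boundedness removes nothing from \<^term>\<open>cadlag01\<close> is shown below.\<close>

definition D01_uniform :: "(real \<Rightarrow> real) metric" where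
  "D01_uniform = submetric (funspace {0..1} euclidean_metric) cadlag01"

lemma cadlag01_bounded:
  assumes "f \<in> cadlag01"
  shows "bounded (f ` {0..1})"
proof -
  have loc: "\<exists>U. open U \<and> t \<in> U \<and> bounded (f ` (U \<inter> {0..1}))" if t: "t \<in> {0..1}" for t
  proof -
    have R: "\<exists>b>t. bounded (f ` ({t<..<b} \<inter> {0..1}))"
    proof (cases "t < 1")
      case True
      then have "(f \<longlongrightarrow> f t) (at_right t)"
        using assms t by (auto simp: cadlag01_def)
      then have "\<forall>\<^sub>F x in at_right t. dist (f x) (f t) < 1"
        by (rule tendstoD) simp
      then obtain b where "b > t" "\<forall>x>t. x < b \<longrightarrow> dist (f x) (f t) < 1"
        by (auto simp: eventually_at_right_field)
      moreover from this have "f ` ({t<..<b} \<inter> {0..1}) \<subseteq> ball (f t) 1"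
        by (auto simp: dist_commute)
      ultimately show ?thesis
        using bounded_ball bounded_subset by blast
    next
      case False
      then have "{t<..<t+1} \<inter> {0..1} = {}" using t by auto
      then show ?thesis by (intro exI[of _ "t + 1"]) simp
    qed
    have L: "\<exists>b<t. bounded (f ` ({b<..<t} \<inter> {0..1}))"
    proof (cases "t > 0")
      case True
      then have "t \<in> {0<..1}" using t by simp
      then obtain l where "(f \<longlongrightarrow> l) (at_left t)"
        using assms unfolding cadlag01_def by blast
      then have "\<forall>\<^sub>F x in at_left t. dist (f x) l < 1"
        by (rule tendstoD) simp
      then obtain b where "b < t" "\<forall>x>b. x < t \<longrightarrow> dist (f x) l < 1"
        by (auto simp: eventually_at_left_field)
      moreover from this have "f ` ({b<..<t} \<inter> {0..1}) \<subseteq> ball l 1"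
        by (auto simp: dist_commute)
      ultimately show ?thesis
        using bounded_ball bounded_subset by blast
    next
      case False
      then have "{t-1<..<t} \<inter> {0..1} = {}" using t by auto
      then show ?thesis by (intro exI[of _ "t - 1"]) simp
    qed
    obtain a where a: "a < t" "bounded (f ` ({a<..<t} \<inter> {0..1}))" using L by blast
    obtain b where b: "b > t" "bounded (f ` ({t<..<b} \<inter> {0..1}))" using R by blast
    have "{a<..<b} \<inter> {0..1} \<subseteq> ({a<..<t} \<inter> {0..1}) \<union> ({t<..<b} \<inter> {0..1}) \<union> {t}"
      by auto
    then have "f ` ({a<..<b} \<inter> {0..1})
        \<subseteq> f ` ({a<..<t} \<inter> {0..1}) \<union> f ` ({t<..<b} \<inter> {0..1}) \<union> {f t}"
      by blast
    then have "bounded (f ` ({a<..<b} \<inter> {0..1}))"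
      using a b by (meson bounded_Un bounded_subset finite.emptyI finite_imp_bounded finite_insert)
    then show ?thesis
      using a b by (intro exI[of _ "{a<..<b}"]) auto
  qed
  then obtain U where U: "\<And>t. t \<in> {0..1} \<Longrightarrow> open (U t) \<and> t \<in> U t \<and> bounded (f ` (U t \<inter> {0..1}))"
    by metis
  have "compact {0..1::real}" by simp
  then obtain T where T: "T \<subseteq> {0..1}" "finite T" "{0..1} \<subseteq> (\<Union>t\<in>T. U t)"
    by (rule compactE_image[where C = "{0..1}" and f = U]) (use U in auto)
  have "f ` {0..1} \<subseteq> (\<Union>t\<in>T. f ` (U t \<inter> {0..1}))"
    using T(3) by blast
  moreover have "bounded (\<Union>t\<in>T. f ` (U t \<inter> {0..1}))"
    using T U by (intro bounded_UN) auto
  ultimately show ?thesis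
    using bounded_subset by blast
qed

lemma mspace_D01_uniform: "mspace D01_uniform = cadlag01"
proof -
  have "cadlag01 \<subseteq> Met_TC.fspace {0..1}"
  proof
    fix f assume f: "f \<in> cadlag01"
    then have "f \<in> extensional {0..1}" by (simp add: cadlag01_def)
    then show "f \<in> Met_TC.fspace {0..1}"
      using cadlag01_bounded[OF f] by (simp add: Met_TC.fspace_def)
  qed
  then show ?thesis
    by (auto simp: D01_uniform_def)
qed

section \<open>Tightness\<close>

text \<open>\<open>D([0,1])\<close> with the uniform topology is nonseparable: the paths in a compact set have all their
  jumps in one countable set of times, so a nonconstant pure jump process whose jump times have
  continuous laws stays outside every compact set. Tightness of a net is therefore understood as in
  the weak convergence theory for nonseparable spaces (van der Vaart and Wellner, Definition 1.3.7):
  in the limit, with arbitrarily small open enlargements of a compact set, and with inner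
  probabilities because of measurability.\<close>

definition inner_prob :: "'a measure \<Rightarrow> 'a set \<Rightarrow> real" where
  "inner_prob M B = (SUP A\<in>{A \<in> sets M. A \<subseteq> B}. measure M A)"

definition enlargement :: "'b metric \<Rightarrow> 'b set \<Rightarrow> real \<Rightarrow> 'b set" where
  "enlargement m K \<delta> = (\<Union>x\<in>K. mball_of m x \<delta>)"

definition asymptotically_tight ::
    "'a measure \<Rightarrow> 'b metric \<Rightarrow> (real \<Rightarrow> 'a \<Rightarrow> 'b) \<Rightarrow> bool" where
  "asymptotically_tight M m X \<longleftrightarrow>
     (\<forall>\<epsilon>>0. \<exists>K. compactin (mtopology_of m) K \<and>
        (\<forall>\<delta>>0. Liminf at_top (\<lambda>r. ereal (inner_prob M {\<omega> \<in> space M. X r \<omega> \<in> enlargement m K \<delta>}))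
                \<ge> ereal (1 - \<epsilon>)))"

end

theory Submission
  imports Defs "HOL-Complex_Analysis.Great_Picard" "HOL-Real_Asymp.Real_Asymp"
begin

text \<open>The heart of the matter is the bound \<open>P (\<bar>J (s + T) - J s\<bar> \<ge> u) \<le> 16 * exp (- u / (4 * T powr (1/4)))\<close> for
  \<open>T \<ge> 1\<close>. Conservation of particles lets one replace the current through a single bond by a
  smooth average of currents over \<open>n \<approx> sqrt T\<close> bonds plus the difference of a linear statistic of the
  configurations at times \<open>s\<close> and \<open>s + T\<close>. The linear statistics have Gaussian exponential moments
  under the product measure (Hoeffding's lemma). The averaged current is a martingale with small jumps plus
  the time integral of a linear statistic, whose exponential moment is bounded by Jensen's inequality
  and stationarity. All of this is done on a time grid of mesh \<open>T / N\<close>, \<open>N \<rightarrow> \<infinity>\<close>, where the expansion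
  \<open>S h f = f + h *\<^sub>R L f + o(h)\<close> of the semigroup on local functions is all that is needed about the
  dynamics. Chaining over dyadic times down to mesh of order 1 shows that with high probability
  the rescaled current is, up to small jumps, a Hoelder function, and Hoelder balls are
  compact in the uniform topology.\<close>

section \<open>Step paths and their discretization\<close>

text \<open>The definition of the process through its semigroup does not say that a path changes by
  one exchange at a time, so conservation of particles cannot be applied along a path. It is
  recovered on the grid: a cell of the grid in which conservation fails has rate zero, because every
  single exchange conserves particles, and the exponential estimate used for the martingale part
  then bounds the probability of such a cell by \<open>exp (T * \<epsilon>) - 1\<close> with
  \<open>\<epsilon>\<close> arbitrarily small.

  The average over bonds has triangular weights. Jensen and stationarity gain nothing from
  decorrelation in time, so the squared gradients of the weights must sum to order
  \<open>n powr (-3)\<close>, that is \<open>T powr (-3/2)\<close>. A flat weight concentrates its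
  gradient at two places and reaches only \<open>n powr (-2)\<close>.

  The four parts of the current are dependent; convexity of \<open>exp\<close> separates them at the
  price of the factor 4 in the exponent. The Hoelder exponent 1/8 lies below the scaling exponent
  1/4 of the current, which leaves room for a union bound over the cells of each dyadic
  level.\<close>

definition step_path :: "(real \<Rightarrow> 'b) \<Rightarrow> bool" where
  "step_path q \<longleftrightarrow> (\<forall>t\<ge>0. \<forall>\<^sub>F u in at_right t. q u = q t) \<and>
     (\<forall>t>0. \<exists>l. \<forall>\<^sub>F u in at_left t. q u = l)"

definition jumps :: "(real \<Rightarrow> 'b) \<Rightarrow> real set" where
  "jumps q = {t. 0 < t \<and> \<not> (\<forall>\<^sub>F u in at_left t. q u = q t)}"

lemma step_path_right:
  assumes "step_path q" "0 \<le> t"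
  obtains d where "d > 0" "\<And>u. t \<le> u \<Longrightarrow> u < t + d \<Longrightarrow> q u = q t"
proof -
  from assms have "\<forall>\<^sub>F u in at_right t. q u = q t" by (auto simp: step_path_def)
  then obtain b where b: "b > t" "\<forall>y>t. y < b \<longrightarrow> q y = q t"
    by (auto simp: eventually_at_right_field)
  show thesis
  proof (rule that[of "b - t"])
    fix u assume "t \<le> u" "u < t + (b - t)"
    then show "q u = q t" using b by (cases "u = t") auto
  qed (use b in auto)
qed

lemma step_path_left:
  assumes "step_path q" "0 < t"
  obtains d l where "d > 0" "\<And>u. t - d < u \<Longrightarrow> u < t \<Longrightarrow> q u = l"
proof -
  from assms obtain l where "\<forall>\<^sub>F u in at_left t. q u = l" unfolding step_path_def by blast
  then obtain b where b: "b < t" "\<forall>y>b. y < t \<longrightarrow> q y = l"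
    by (auto simp: eventually_at_left_field)
  show thesis
    by (rule that[of "t - b" l]) (use b in auto)
qed

lemma not_jump_left:
  assumes "0 < t" "t \<notin> jumps q"
  obtains d where "d > 0" "\<And>u. t - d < u \<Longrightarrow> u \<le> t \<Longrightarrow> q u = q t"
proof -
  from assms have "\<forall>\<^sub>F u in at_left t. q u = q t" by (auto simp: jumps_def)
  then obtain b where b: "b < t" "\<forall>y>b. y < t \<longrightarrow> q y = q t"
    by (auto simp: eventually_at_left_field)
  show thesis
  proof (rule that[of "t - b"])
    fix u assume "t - (t - b) < u" "u \<le> t"
    then show "q u = q t" using b by (cases "u = t") auto
  qed (use b in auto)
qed

lemma constant_imp_not_jump:
  assumes "\<And>u. a < u \<Longrightarrow> u < b \<Longrightarrow> q u = l" "a < t" "t < b"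
  shows "t \<notin> jumps q"
proof -
  have "\<forall>\<^sub>F u in at_left t. a < u"
    using assms(2) by (auto simp: eventually_at_left_field)
  moreover have "\<forall>\<^sub>F u in at_left t. u < t" 
    by (auto simp: eventually_at_filter)
  ultimately have "\<forall>\<^sub>F u in at_left t. q u = q t"
    by eventually_elim (use assms in auto)
  then show ?thesis by (auto simp: jumps_def)
qed

text \<open>Bisection (\<open>Bolzano\<close>) takes the place of a compactness argument: equality
  of the end values is transitive over adjacent intervals and holds on short intervals around every
  point. The guards \<open>a \<le> u\<close> and \<open>v \<le> b\<close> are there because such
  short intervals may stick out of \<open>{a..b}\<close>.\<close>

lemma step_path_constant:
  assumes q: "step_path q" and ab: "0 \<le> a" "a \<le> b" and nj: "{a<..b} \<inter> jumps q = {}"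
  shows "q a = q b"
proof -
  have "a \<le> a \<and> b \<le> b \<longrightarrow> q a = q b"
    using ab(2)
  proof (rule Bolzano[where P = "\<lambda>u v. a \<le> u \<and> v \<le> b \<longrightarrow> q u = q v"])
    fix x assume x: "a \<le> x" "x \<le> b"
    obtain d1 where d1: "d1 > 0" "\<And>u. x \<le> u \<Longrightarrow> u < x + d1 \<Longrightarrow> q u = q x"
      using step_path_right[OF q] ab x by (metis order_trans)
    have "\<exists>d2>0. \<forall>u. a \<le> u \<and> x - d2 < u \<and> u \<le> x \<longrightarrow> q u = q x"
    proof (cases "x = a")
      case True
      then show ?thesis by (intro exI[of _ 1]) auto
    next
      case False
      then have "x \<in> {a<..b}" using x by auto
      then have "x > 0" "x \<notin> jumps q" using x nj ab by (auto simp: disjoint_iff)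
      then show ?thesis using not_jump_left by metis
    qed
    then obtain d2 where d2: "d2 > 0" "\<And>u. a \<le> u \<Longrightarrow> x - d2 < u \<Longrightarrow> u \<le> x \<Longrightarrow> q u = q x"
      by blast
    show "\<exists>d>0. \<forall>u v. u \<le> x \<and> x \<le> v \<and> v - u < d \<longrightarrow> a \<le> u \<and> v \<le> b \<longrightarrow> q u = q v"
    proof (intro exI[of _ "min d1 d2"] conjI allI impI)
      fix u v assume "u \<le> x \<and> x \<le> v \<and> v - u < min d1 d2" "a \<le> u \<and> v \<le> b"
      then have "q u = q x" "q v = q x" using d1(2)[of v] d2(2)[of u] by auto
      then show "q u = q v" by simp
    qed (use d1(1) d2(1) in simp)
  qed auto
  then show ?thesis by simp
qed

text \<open>The same bisection with finiteness in place of equality: on either side of a point the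
  path is constant for a while, so near the point only the point itself can be a jump.\<close>

lemma finite_jumps:
  assumes q: "step_path q"
  shows "finite (jumps q \<inter> {a<..b})"
\<comment> \<open>Nothing is known about the path at negative times, and \<open>jumps\<close>
  contains only positive ones; the interval is cut at 0.\<close>
proof (cases "max 0 a \<le> b")
  case True
  have "max 0 a \<le> max 0 a \<longrightarrow> finite (jumps q \<inter> {max 0 a<..b})"
    using True
  proof (rule Bolzano[where P = "\<lambda>u v. max 0 a \<le> u \<longrightarrow> finite (jumps q \<inter> {u<..v})"])
    fix u v w :: real
    assume "max 0 a \<le> u \<longrightarrow> finite (jumps q \<inter> {u<..v})" 
      "max 0 a \<le> v \<longrightarrow> finite (jumps q \<inter> {v<..w})" "u \<le> v" "v \<le> w"
    moreover have "jumps q \<inter> {u<..w} \<subseteq> jumps q \<inter> {u<..v} \<union> jumps q \<inter> {v<..w}" by auto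
    ultimately show "max 0 a \<le> u \<longrightarrow> finite (jumps q \<inter> {u<..w})"
      by (auto intro: finite_subset)
  next
    fix x assume x: "max 0 a \<le> x" "x \<le> b"
    obtain d1 where d1: "d1 > 0" "\<And>u. x \<le> u \<Longrightarrow> u < x + d1 \<Longrightarrow> q u = q x"
      using step_path_right[OF q] x by (metis max.boundedE)
    have "\<exists>d2>0. \<forall>t. max 0 a \<le> t \<and> x - d2 < t \<and> t < x \<longrightarrow> t \<notin> jumps q"
    proof (cases "x > 0")
      case False
      then show ?thesis using x by (intro exI[of _ 1]) auto
    next
      case True
      then obtain d l where "d > 0" "\<And>u. x - d < u \<Longrightarrow> u < x \<Longrightarrow> q u = l"
        using step_path_left[OF q] by metis
      then show ?thesis using constant_imp_not_jump[of "x - d" x q l] by auto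
    qed
    then obtain d2 where d2: "d2 > 0" "\<And>t. max 0 a \<le> t \<Longrightarrow> x - d2 < t \<Longrightarrow> t < x \<Longrightarrow> t \<notin> jumps q"
      by blast
    show "\<exists>d>0. \<forall>u v. u \<le> x \<and> x \<le> v \<and> v - u < d \<longrightarrow> max 0 a \<le> u \<longrightarrow> finite (jumps q \<inter> {u<..v})"
    proof (intro exI[of _ "min d1 d2"] conjI allI impI)
      fix u v assume uv: "u \<le> x \<and> x \<le> v \<and> v - u < min d1 d2" "max 0 a \<le> u"
      have "t = x" if "t \<in> jumps q \<inter> {u<..v}" for t
      proof (rule ccontr)
        assume "t \<noteq> x"
        then consider "t < x" | "x < t" by linarith
        then show False
        proof cases
          case 1
          then show False using d2(2)[of t] that uv by auto
        next
          case 2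
          moreover have "q u = q x" if "x < u" "u < x + d1" for u
            using d1(2)[of u] that by simp
          ultimately show False
            using constant_imp_not_jump[of x "x + d1" q "q x" t] that uv by auto
        qed
      qed
      then have "jumps q \<inter> {u<..v} \<subseteq> {x}" by blast
      then show "finite (jumps q \<inter> {u<..v})" by (rule finite_subset) simp
    qed (use d1(1) d2(1) in simp)
  qed
  moreover have "jumps q \<inter> {a<..b} = jumps q \<inter> {max 0 a<..b}" by (auto simp: jumps_def)
  ultimately show ?thesis by simp
next
  case False
  then have "jumps q \<inter> {a<..b} = {}" by (auto simp: jumps_def)
  then show ?thesis by simp
qed

lemma step_path_separated:
  assumes q: "step_path q"
  obtains d where "d > 0"
    "\<And>u v t t'. a \<le> u \<Longrightarrow> v \<le> b \<Longrightarrow> v - u < d \<Longrightarrow> t \<in> jumps q \<inter> {u<..v} \<Longrightarrow> t' \<in> jumps q \<inter> {u<..v} \<Longrightarrow> t = t'"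
proof -
  let ?J = "jumps q \<inter> {a<..b}"
  \<comment> \<open>The element 1 keeps the set nonempty when there are fewer than two
    jumps.\<close>
  let ?D = "insert 1 ((\<lambda>(t, t'). \<bar>t - t'\<bar>) ` (?J \<times> ?J - {(t, t'). t = t'}))"
  have fin: "finite ?D" using finite_jumps[OF q, of a b] by auto
  show thesis
  proof (rule that[of "Min ?D"])
    show "Min ?D > 0" using fin by (subst Min_gr_iff) auto
    fix u v t t'
    assume *: "a \<le> u" "v \<le> b" "v - u < Min ?D" "t \<in> jumps q \<inter> {u<..v}" "t' \<in> jumps q \<inter> {u<..v}"
    show "t = t'"
    proof (rule ccontr)
      assume "t \<noteq> t'"
      then have "(t, t') \<in> ?J \<times> ?J - {(t, t'). t = t'}" using * by auto
      then have "\<bar>t - t'\<bar> \<in> ?D" by force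
      then have "Min ?D \<le> \<bar>t - t'\<bar>" using fin by (rule Min_le[rotated])
      then show False using * by auto
    qed
  qed
qed

section \<open>Jumps across one bond as discontinuities of a pair of coordinates\<close>

abbreviation pair_path :: "(real \<Rightarrow> config) \<Rightarrow> int \<Rightarrow> int \<Rightarrow> real \<Rightarrow> bool \<times> bool" where
  "pair_path \<xi> x y \<equiv> (\<lambda>t. (\<xi> t x, \<xi> t y))"

text \<open>Sites have a discrete state space, so convergence of configurations makes each
  coordinate eventually constant. This is how a cadlag path yields step paths.\<close>

lemma tendsto_config_component:
  fixes \<xi> :: "real \<Rightarrow> config"
  assumes "(\<xi> \<longlongrightarrow> l) F"
  shows "\<forall>\<^sub>F u in F. \<xi> u x = l x"
proof -
  have "((\<lambda>u. \<xi> u x) \<longlongrightarrow> l x) F"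
    by (rule continuous_on_tendsto_compose[OF continuous_on_product_coordinates assms]) auto
  then show ?thesis by (simp add: tendsto_discrete)
qed

lemma step_path_pair_path:
  assumes "cadlag_path \<xi>"
  shows "step_path (pair_path \<xi> x y)"
proof -
  have "\<forall>\<^sub>F u in F. (\<xi> u x, \<xi> u y) = (l x, l y)" if "(\<xi> \<longlongrightarrow> l) F" for l F
    using tendsto_config_component[OF that, of x] tendsto_config_component[OF that, of y]
    by eventually_elim simp
  then show ?thesis
    using assms unfolding step_path_def cadlag_path_def by blast
qed

text \<open>What a jump from \<open>x\<close> to \<open>y\<close> looks like from two observation
  times. It can miss jumps and can mistake two unrelated changes for a jump; on a fine enough grid
  it does neither.\<close>

definition jstep :: "int \<Rightarrow> int \<Rightarrow> config \<Rightarrow> config \<Rightarrow> real" where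
  "jstep x y \<zeta> \<xi> = of_bool (\<zeta> x \<and> \<not> \<zeta> y \<and> \<not> \<xi> x \<and> \<xi> y)"

lemma jump_time_iff:
  assumes "\<forall>\<^sub>F u in at_left t. pair_path \<xi> x y u = l"
  shows "jump_time \<xi> x y t \<longleftrightarrow> l = (True, False) \<and> pair_path \<xi> x y t = (False, True)"
proof -
  have "(\<forall>\<^sub>F u in at_left t. \<xi> u x \<and> \<not> \<xi> u y) \<longleftrightarrow> (\<forall>\<^sub>F u in at_left t. l = (True, False))"
    by (rule eventually_subst) (use assms in eventually_elim, auto)
  also have "\<dots> \<longleftrightarrow> l = (True, False)"
    by simp
  finally show ?thesis by (auto simp: jump_time_def)
qed

lemma jump_time_imp_jump:
  assumes "jump_time \<xi> x y t" "0 < t"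
  shows "t \<in> jumps (pair_path \<xi> x y)"
proof -
  { assume "\<forall>\<^sub>F u in at_left t. pair_path \<xi> x y u = pair_path \<xi> x y t"
    from jump_time_iff[OF this] assms(1) have False by auto }
  then show ?thesis using assms(2) by (auto simp: jumps_def)
qed

lemma card_jump_times_cell:
  assumes \<xi>: "cadlag_path \<xi>" and uv: "0 \<le> u" "u \<le> v"
    and single: "\<And>t t'. t \<in> jumps (pair_path \<xi> x y) \<inter> {u<..v} \<Longrightarrow>
      t' \<in> jumps (pair_path \<xi> x y) \<inter> {u<..v} \<Longrightarrow> t = t'"
  shows "real (card {s. u < s \<and> s \<le> v \<and> jump_time \<xi> x y s}) = jstep x y (\<xi> u) (\<xi> v)"
proof (cases "\<exists>t. t \<in> jumps (pair_path \<xi> x y) \<inter> {u<..v}")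
  case False
  let ?q = "pair_path \<xi> x y"
  have q: "step_path ?q" by (rule step_path_pair_path[OF \<xi>])
  have "?q u = ?q v" 
    using False by (intro step_path_constant[OF q]) (use uv in auto)
  then have "jstep x y (\<xi> u) (\<xi> v) = 0" by (auto simp: jstep_def)
  moreover have "{s. u < s \<and> s \<le> v \<and> jump_time \<xi> x y s} = {}"
    using False jump_time_imp_jump[of \<xi> x y] uv by fastforce
  ultimately show ?thesis by (simp only: card.empty of_nat_0)
next
  case True
  let ?q = "pair_path \<xi> x y"
  have q: "step_path ?q" by (rule step_path_pair_path[OF \<xi>])
  from True obtain t where t: "t \<in> jumps ?q" "u < t" "t \<le> v" by auto
  have un: "s = t" if "s \<in> jumps ?q" "u < s" "s \<le> v" for s
    using single[of s t] t that by auto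
  have left: "?q w = ?q u" if "u \<le> w" "w < t" for w
  proof -
    have "s \<notin> jumps ?q" if "s \<in> {u<..w}" for s
      using un[of s] that \<open>w < t\<close> t(3) by auto
    then have "{u<..w} \<inter> jumps ?q = {}" by blast
    then show ?thesis
      using step_path_constant[OF q uv(1) that(1)] by simp
  qed
  have right: "?q v = ?q t"
  proof -
    have "s \<notin> jumps ?q" if "s \<in> {t<..v}" for s
      using un[of s] that t(2) by auto
    then have "{t<..v} \<inter> jumps ?q = {}" by blast
    then show ?thesis
      using step_path_constant[OF q _ t(3)] t(2) uv by simp
  qed
  have "\<forall>\<^sub>F w in at_left t. u < w" using t by (auto simp: eventually_at_left_field)
  moreover have "\<forall>\<^sub>F w in at_left t. w < t" by (auto simp: eventually_at_filter)
  ultimately have "\<forall>\<^sub>F w in at_left t. ?q w = ?q u"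
    by eventually_elim (rule left, simp_all)
  then have "jump_time \<xi> x y t \<longleftrightarrow> ?q u = (True, False) \<and> ?q t = (False, True)"
    by (rule jump_time_iff)
  then have jt: "jump_time \<xi> x y t \<longleftrightarrow> ?q u = (True, False) \<and> ?q v = (False, True)"
    unfolding right .
  have only: "s = t" if "u < s" "s \<le> v" "jump_time \<xi> x y s" for s
    using un[OF jump_time_imp_jump[OF that(3)]] that uv by auto
  have "{s. u < s \<and> s \<le> v \<and> jump_time \<xi> x y s} = (if jump_time \<xi> x y t then {t} else {})"
  proof (intro set_eqI iffI)
    fix s assume "s \<in> {s. u < s \<and> s \<le> v \<and> jump_time \<xi> x y s}"
    then show "s \<in> (if jump_time \<xi> x y t then {t} else {})"
      using only[of s] by (auto dest: sym)
  next
    fix s assume "s \<in> (if jump_time \<xi> x y t then {t} else {})"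
    then have "s = t" "jump_time \<xi> x y t" by (simp_all split: if_splits)
    then show "s \<in> {s. u < s \<and> s \<le> v \<and> jump_time \<xi> x y s}" using t(2,3) by simp
  qed
  then show ?thesis using jt by (simp add: jstep_def)
qed

lemma finite_jump_times:
  assumes "cadlag_path \<xi>" "0 \<le> u"
  shows "finite {s. u < s \<and> s \<le> v \<and> jump_time \<xi> x y s}"
proof (rule finite_subset)
  show "{s. u < s \<and> s \<le> v \<and> jump_time \<xi> x y s} \<subseteq> jumps (pair_path \<xi> x y) \<inter> {u<..v}"
    using jump_time_imp_jump[of \<xi> x y] assms(2) by (simp add: subset_eq)
qed (rule finite_jumps[OF step_path_pair_path[OF assms(1)]])

lemma jump_count_add:
  assumes "cadlag_path \<xi>" "0 \<le> u" "u \<le> v"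
  shows "jump_count \<xi> x y v = jump_count \<xi> x y u + card {s. u < s \<and> s \<le> v \<and> jump_time \<xi> x y s}"
proof -
  have "{s. 0 < s \<and> s \<le> v \<and> jump_time \<xi> x y s} =
      {s. 0 < s \<and> s \<le> u \<and> jump_time \<xi> x y s} \<union> {s. u < s \<and> s \<le> v \<and> jump_time \<xi> x y s}"
    using assms by auto
  then show ?thesis
    unfolding jump_count_def
    using finite_jump_times[OF assms(1)] assms(2)
    by (auto intro!: card_Un_disjoint)
qed

lemma jump_count_mono:
  assumes "cadlag_path \<xi>" "0 \<le> u" "u \<le> v"
  shows "jump_count \<xi> x y u \<le> jump_count \<xi> x y v"
  using jump_count_add[OF assms, of x y] by simp

text \<open>Once the mesh is smaller than the distance between any two jumps of the two coordinates, every
  jump is seen by exactly one cell of the grid.\<close>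

lemma jump_count_discretization:
  assumes \<xi>: "cadlag_path \<xi>" and s: "0 \<le> s" and T: "0 \<le> T"
  shows "\<forall>\<^sub>F N in sequentially.
    real (jump_count \<xi> x y (s + T)) - real (jump_count \<xi> x y s) =
    (\<Sum>k<N. jstep x y (\<xi> (s + real k * (T / real N))) (\<xi> (s + real (Suc k) * (T / real N))))"
proof -
  obtain d where d: "d > 0"
    "\<And>u v t t'. s \<le> u \<Longrightarrow> v \<le> s + T \<Longrightarrow> v - u < d \<Longrightarrow> t \<in> jumps (pair_path \<xi> x y) \<inter> {u<..v} \<Longrightarrow>
      t' \<in> jumps (pair_path \<xi> x y) \<inter> {u<..v} \<Longrightarrow> t = t'"
    by (rule step_path_separated[OF step_path_pair_path[OF \<xi>, of x y], of s "s + T"]) blast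
  have "(\<lambda>N. T / real N) \<longlonglongrightarrow> 0"
    by (rule lim_const_over_n)
  then have "\<forall>\<^sub>F N in sequentially. T / real N < d"
    using d(1) by (rule order_tendstoD)
  moreover have "\<forall>\<^sub>F N in sequentially. N > (0::nat)"
    by (rule eventually_gt_at_top)
  ultimately show ?thesis
  proof eventually_elim
    case (elim N)
    define g where "g k = s + real k * (T / real N)" for k
    have g: "g k \<le> g (Suc k)" "s \<le> g k" "g (Suc k) - g k = T / real N" for k
      using T by (auto simp: g_def algebra_simps add_divide_distrib)
    have gN: "g 0 = s" "g N = s + T" using elim by (auto simp: g_def)
    have le: "g (Suc k) \<le> s + T" if "k < N" for k
    proof -
      have "real (Suc k) * (T / real N) \<le> real N * (T / real N)"
        using that T by (intro mult_right_mono) auto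
      then show ?thesis using elim by (simp add: g_def)
    qed
    have "jstep x y (\<xi> (g k)) (\<xi> (g (Suc k))) =
       real (jump_count \<xi> x y (g (Suc k))) - real (jump_count \<xi> x y (g k))" if "k < N" for k
    proof -
      have "0 \<le> g k" using s g(2)[of k] by simp
      moreover have "real (card {t. g k < t \<and> t \<le> g (Suc k) \<and> jump_time \<xi> x y t}) =
          jstep x y (\<xi> (g k)) (\<xi> (g (Suc k)))"
        by (rule card_jump_times_cell[OF \<xi> \<open>0 \<le> g k\<close> g(1)], rule d(2)[of "g k" "g (Suc k)"])
           (use g[of k] le[OF that] elim in \<open>simp_all\<close>)
      ultimately show ?thesis
        using jump_count_add[OF \<xi> _ g(1)[of k], of x y] by simp
    qed
    then have "(\<Sum>k<N. jstep x y (\<xi> (g k)) (\<xi> (g (Suc k)))) =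
      (\<Sum>k<N. real (jump_count \<xi> x y (g (Suc k))) - real (jump_count \<xi> x y (g k)))"
      by (intro sum.cong) auto
    also have "\<dots> = real (jump_count \<xi> x y (s + T)) - real (jump_count \<xi> x y s)"
      using sum_lessThan_telescope[of "\<lambda>k. real (jump_count \<xi> x y (g k))" N] by (simp only: gN)
    finally show ?case by (simp add: g_def)
  qed
qed

section \<open>Local functions and the generator\<close>

text \<open>Polymorphic in the codomain, so that a kernel \<open>F \<zeta> \<xi>\<close> can be a
  local function of \<open>\<zeta>\<close> with values in functions; such a kernel takes only
  finitely many functions as values.\<close>

definition depends_on :: "int set \<Rightarrow> (config \<Rightarrow> 'b) \<Rightarrow> bool" where
  "depends_on W \<phi> \<longleftrightarrow> (\<forall>\<eta> \<xi>. (\<forall>x\<in>W. \<eta> x = \<xi> x) \<longrightarrow> \<phi> \<eta> = \<phi> \<xi>)"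

lemma depends_onD: "depends_on W \<phi> \<Longrightarrow> (\<And>x. x \<in> W \<Longrightarrow> \<eta> x = \<xi> x) \<Longrightarrow> \<phi> \<eta> = \<phi> \<xi>"
  unfolding depends_on_def by blast

lemma depends_onI: "(\<And>\<eta> \<xi>. (\<And>x. x \<in> W \<Longrightarrow> \<eta> x = \<xi> x) \<Longrightarrow> \<phi> \<eta> = \<phi> \<xi>) \<Longrightarrow> depends_on W \<phi>"
  unfolding depends_on_def by blast

lemma depends_on_compose: "depends_on W \<phi> \<Longrightarrow> depends_on W (\<lambda>\<eta>. g (\<phi> \<eta>))"
  by (simp add: depends_on_def) metis

text \<open>Emptying all sites outside \<open>W\<close> does not change the value, so the subsets of
  \<open>W\<close> index all values.\<close>

lemma finite_range_depends_on:
  assumes "finite W" "depends_on W \<phi>"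
  shows "finite (range \<phi>)"
proof -
  have "\<phi> \<eta> = \<phi> (\<lambda>x. x \<in> {x \<in> W. \<eta> x})" for \<eta>
    by (rule depends_onD[OF assms(2)]) auto
  then have "range \<phi> \<subseteq> (\<lambda>P. \<phi> (\<lambda>x. x \<in> P)) ` Pow W" by blast
  then show ?thesis by (rule finite_subset) (use assms(1) in simp)
qed

lemma open_cylinder:
  assumes "finite W"
  shows "open {\<xi> :: config. \<forall>x\<in>W. \<xi> x = \<eta> x}"
proof -
  have "open ((\<lambda>\<xi> :: config. \<xi> x) -` {\<eta> x})" for x
    by (rule open_vimage) (simp_all add: Topological_Spaces.open_discrete)
  then have "open (\<Inter>x\<in>W. (\<lambda>\<xi> :: config. \<xi> x) -` {\<eta> x})"
    using assms by (intro open_INT) auto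
  also have "(\<Inter>x\<in>W. (\<lambda>\<xi> :: config. \<xi> x) -` {\<eta> x}) = {\<xi>. \<forall>x\<in>W. \<xi> x = \<eta> x}" by auto
  finally show ?thesis .
qed

text \<open>A local function is locally constant: the preimage of any set whatsoever is a union of
  open cylinders.\<close>

lemma continuous_on_depends_on:
  fixes \<phi> :: "config \<Rightarrow> 'b :: topological_space"
  assumes "finite W" "depends_on W \<phi>"
  shows "continuous_on UNIV \<phi>"
  unfolding continuous_on_open_vimage[OF open_UNIV]
proof (intro allI impI)
  fix B :: "'b set"
  have "\<phi> -` B = (\<Union>\<eta>\<in>\<phi> -` B. {\<xi>. \<forall>x\<in>W. \<xi> x = \<eta> x})"
  proof (intro equalityI subsetI)
    fix \<xi> assume "\<xi> \<in> (\<Union>\<eta>\<in>\<phi> -` B. {\<xi>. \<forall>x\<in>W. \<xi> x = \<eta> x})"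
    then obtain \<eta> where "\<phi> \<eta> \<in> B" "\<forall>x\<in>W. \<xi> x = \<eta> x" by blast
    moreover from this have "\<phi> \<xi> = \<phi> \<eta>" using depends_onD[OF assms(2), of \<xi> \<eta>] by blast
    ultimately show "\<xi> \<in> \<phi> -` B" by simp
  qed blast
  moreover have "open (\<Union>\<eta>\<in>\<phi> -` B. {\<xi>. \<forall>x\<in>W. \<xi> x = \<eta> x})"
    by (intro open_UN ballI open_cylinder assms)
  ultimately show "open (\<phi> -` B \<inter> UNIV)" by simp
qed

lemma bcontfun_depends_on:
  fixes \<phi> :: "config \<Rightarrow> 'b :: metric_space"
  assumes "finite W" "depends_on W \<phi>"
  shows "\<phi> \<in> bcontfun"
  using continuous_on_depends_on[OF assms] finite_range_depends_on[OF assms]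
  by (auto simp: bcontfun_def intro: finite_imp_bounded)

lemma borel_measurable_depends_on:
  fixes \<phi> :: "config \<Rightarrow> 'b :: topological_space"
  assumes "finite W" "depends_on W \<phi>"
  shows "\<phi> \<in> borel_measurable borel"
  by (rule borel_measurable_continuous_onI[OF continuous_on_depends_on[OF assms]])

text \<open>A bond is named by its left end. These are the bonds with an end in \<open>W\<close>;
  exchanges across all others are invisible to a function of the sites in \<open>W\<close>.\<close>

definition bonds :: "int set \<Rightarrow> int set" where
  "bonds W = W \<union> (\<lambda>x. x - 1) ` W"

lemma finite_bonds [simp]: "finite W \<Longrightarrow> finite (bonds W)"
  by (simp add: bonds_def)

lemma depends_on_exchange:
  assumes "depends_on W \<phi>" "x \<notin> bonds W"
  shows "\<phi> (exchange x \<eta>) = \<phi> \<eta>"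
proof (rule depends_onD[OF assms(1)])
  fix y assume "y \<in> W"
  then have "y \<noteq> x" "y - 1 \<noteq> x" using assms(2) by (auto simp: bonds_def)
  then show "exchange x \<eta> y = \<eta> y" by (simp add: exchange_def)
qed

lemma ssep_operator_depends_on:
  assumes "finite B" "bonds W \<subseteq> B" "depends_on W \<phi>"
  shows "ssep_operator \<phi> \<eta> = (1/2) * (\<Sum>x\<in>B. \<phi> (exchange x \<eta>) - \<phi> \<eta>)"
proof -
  have "(\<Sum>\<^sub>\<infinity>x\<in>UNIV. \<phi> (exchange x \<eta>) - \<phi> \<eta>) = (\<Sum>\<^sub>\<infinity>x\<in>B. \<phi> (exchange x \<eta>) - \<phi> \<eta>)"
    by (rule infsum_cong_neutral) (use assms depends_on_exchange[OF assms(3)] in auto)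
  then show ?thesis using assms(1) by (simp add: ssep_operator_def)
qed

definition nbhd :: "int set \<Rightarrow> int set" where
  "nbhd W = bonds W \<union> (\<lambda>x. x + 1) ` bonds W"

lemma finite_nbhd [simp]: "finite W \<Longrightarrow> finite (nbhd W)"
  by (simp add: nbhd_def)

lemma subset_nbhd: "W \<subseteq> nbhd W"
  by (auto simp: nbhd_def bonds_def)

lemma exchange_cong_nbhd:
  assumes "\<And>x. x \<in> nbhd W \<Longrightarrow> \<eta> x = \<xi> x" "x \<in> bonds W" "y \<in> W"
  shows "exchange x \<eta> y = exchange x \<xi> y"
  using assms subset_nbhd[of W] by (auto simp: exchange_def nbhd_def)

text \<open>The generator acts on the second variable while the first is frozen, and only then are
  both set equal. Jump rates have this form.\<close>

lemma depends_on_kernel_operator: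
  fixes F :: "config \<Rightarrow> config \<Rightarrow> real"
  assumes "finite W" "depends_on W F" "\<And>\<zeta>. depends_on W (F \<zeta>)"
  shows "depends_on (nbhd W) (\<lambda>\<zeta>. ssep_operator (F \<zeta>) \<zeta>)"
proof (rule depends_onI)
  fix \<eta> \<xi> :: config
  assume *: "\<And>x. x \<in> nbhd W \<Longrightarrow> \<eta> x = \<xi> x"
  have "F \<eta> = F \<xi>"
    by (rule depends_onD[OF assms(2)]) (use * subset_nbhd in auto)
  moreover have "F \<xi> \<eta> = F \<xi> \<xi>"
    by (rule depends_onD[OF assms(3)]) (use * subset_nbhd in auto)
  moreover have "F \<xi> (exchange x \<eta>) = F \<xi> (exchange x \<xi>)" if "x \<in> bonds W" for x
    by (rule depends_onD[OF assms(3)]) (use exchange_cong_nbhd[OF *] that in auto)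
  ultimately show "ssep_operator (F \<eta>) \<eta> = ssep_operator (F \<xi>) \<xi>"
    by (simp add: ssep_operator_depends_on[OF _ order_refl assms(3)] assms(1))
qed

lemma depends_on_ssep_operator:
  assumes "finite W" "depends_on W \<phi>"
  shows "depends_on (nbhd W) (ssep_operator \<phi>)"
  using depends_on_kernel_operator[of W "\<lambda>_. \<phi>"] assms by (simp add: depends_on_def)

lemma local_in_ssep_graph:
  assumes "finite W" "depends_on W \<phi>"
  shows "(Bcontfun \<phi>, Bcontfun (ssep_operator \<phi>)) \<in> ssep_graph"
proof -
  have [simp]: "apply_bcontfun (Bcontfun \<phi>) = \<phi>"
    by (rule Bcontfun_inverse[OF bcontfun_depends_on[OF assms]])
  have [simp]: "apply_bcontfun (Bcontfun (ssep_operator \<phi>)) = ssep_operator \<phi>"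
    using assms by (intro Bcontfun_inverse bcontfun_depends_on[OF finite_nbhd depends_on_ssep_operator])
  show ?thesis
    using assms by (auto simp: ssep_graph_def local_function_def depends_on_def)
qed

text \<open>Local functions belong to the graph of the generator because that graph is the closure
  of \<open>ssep_graph\<close>. Convergence in the supremum norm makes the error uniform in the
  configuration.\<close>

lemma semigroup_expansion:
  assumes S: "ssep_semigroup S" and "finite W" "depends_on W \<phi>" and e: "e > 0"
  shows "\<forall>\<^sub>F h in at_right 0. \<forall>\<eta>.
    \<bar>apply_bcontfun (S h (Bcontfun \<phi>)) \<eta> - \<phi> \<eta> - h * ssep_operator \<phi> \<eta>\<bar> \<le> h * e"
proof -
  let ?f = "Bcontfun \<phi>" and ?g = "Bcontfun (ssep_operator \<phi>)"
  have f: "apply_bcontfun ?f = \<phi>"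
    by (rule Bcontfun_inverse[OF bcontfun_depends_on[OF assms(2,3)]])
  have g: "apply_bcontfun ?g = ssep_operator \<phi>"
    using assms by (intro Bcontfun_inverse bcontfun_depends_on[OF finite_nbhd depends_on_ssep_operator])
  have "(?f, ?g) \<in> generator_graph S"
    using local_in_ssep_graph[OF assms(2,3)] S closure_subset[of ssep_graph]
    unfolding ssep_semigroup_def by blast
  then have "((\<lambda>t. (1 / t) *\<^sub>R (S t ?f - ?f)) \<longlongrightarrow> ?g) (at_right 0)"
    by (simp add: generator_graph_def)
  then have "\<forall>\<^sub>F h in at_right 0. dist ((1 / h) *\<^sub>R (S h ?f - ?f)) ?g < e"
    using e by (rule tendstoD)
  moreover have "\<forall>\<^sub>F h::real in at_right 0. h > 0"
    by (simp add: eventually_at_filter)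
  ultimately show ?thesis
  proof eventually_elim
    case (elim h)
    show ?case
    proof
      fix \<eta>
      have "dist (((1 / h) *\<^sub>R (S h ?f - ?f)) \<eta>) (?g \<eta>) < e"
        using elim(1) by (rule dist_fun_lt_imp_dist_val_lt)
      then have "\<bar>(apply_bcontfun (S h ?f) \<eta> - \<phi> \<eta>) / h - ssep_operator \<phi> \<eta>\<bar> < e"
        by (simp add: dist_real_def f g)
      then have "h * \<bar>(apply_bcontfun (S h ?f) \<eta> - \<phi> \<eta>) / h - ssep_operator \<phi> \<eta>\<bar> \<le> h * e"
        using elim(2) by (intro mult_left_mono) auto
      also have "h * \<bar>(apply_bcontfun (S h ?f) \<eta> - \<phi> \<eta>) / h - ssep_operator \<phi> \<eta>\<bar> =
          \<bar>h * ((apply_bcontfun (S h ?f) \<eta> - \<phi> \<eta>) / h - ssep_operator \<phi> \<eta>)\<bar>"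
        using elim(2) by (simp add: abs_mult)
      also have "h * ((apply_bcontfun (S h ?f) \<eta> - \<phi> \<eta>) / h - ssep_operator \<phi> \<eta>) =
          apply_bcontfun (S h ?f) \<eta> - \<phi> \<eta> - h * ssep_operator \<phi> \<eta>"
        using elim(2) by (simp only: right_diff_distrib) (simp add: diff_divide_distrib right_diff_distrib)
      finally show "\<bar>apply_bcontfun (S h ?f) \<eta> - \<phi> \<eta> - h * ssep_operator \<phi> \<eta>\<bar> \<le> h * e" .
    qed
  qed
qed

text \<open>A local kernel takes finitely many functions as values, so their expansions hold
  simultaneously for small \<open>h\<close>.\<close>

lemma kernel_expansion:
  fixes F :: "config \<Rightarrow> config \<Rightarrow> real"
  assumes S: "ssep_semigroup S" and W: "finite W" "depends_on W F" "\<And>\<zeta>. depends_on W (F \<zeta>)"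
    and e: "e > 0"
  shows "\<forall>\<^sub>F h in at_right 0. \<forall>\<zeta> \<eta>.
    \<bar>apply_bcontfun (S h (Bcontfun (F \<zeta>))) \<eta> - F \<zeta> \<eta> - h * ssep_operator (F \<zeta>) \<eta>\<bar> \<le> h * e"
proof -
  have "\<forall>\<^sub>F h in at_right 0. \<forall>\<phi>\<in>range F. \<forall>\<eta>.
    \<bar>apply_bcontfun (S h (Bcontfun \<phi>)) \<eta> - \<phi> \<eta> - h * ssep_operator \<phi> \<eta>\<bar> \<le> h * e"
  proof (rule eventually_ball_finite[OF finite_range_depends_on[OF W(1,2)]], rule ballI)
    fix \<phi> assume "\<phi> \<in> range F"
    then have "depends_on W \<phi>" using W(3) by blast
    then show "\<forall>\<^sub>F h in at_right 0. \<forall>\<eta>.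
        \<bar>apply_bcontfun (S h (Bcontfun \<phi>)) \<eta> - \<phi> \<eta> - h * ssep_operator \<phi> \<eta>\<bar> \<le> h * e"
      by (rule semigroup_expansion[OF S W(1) _ e])
  qed
  then show ?thesis by simp
qed

text \<open>Positivity is applied to \<open>c - f\<close> and \<open>c + f\<close>, and constants
  are preserved.\<close>

lemma markov_semigroup_contraction:
  assumes "markov_semigroup S" "t \<ge> 0" "\<And>x. \<bar>apply_bcontfun f x\<bar> \<le> c"
  shows "\<bar>apply_bcontfun (S t f) x\<bar> \<le> c"
proof -
  have "\<forall>t\<ge>0. linear (S t)"
    using assms(1) unfolding markov_semigroup_def by (elim conjE)
  then have lin: "linear (S t)" using assms(2) by simp
  have one: "S t (const_bcontfun c) = const_bcontfun c"
  proof -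
    have "const_bcontfun c = c *\<^sub>R (const_bcontfun 1 :: 'a \<Rightarrow>\<^sub>C real)"
      by (rule bcontfun_eqI) (simp add: const_bcontfun.rep_eq)
    moreover have "S t (c *\<^sub>R const_bcontfun 1) = c *\<^sub>R S t (const_bcontfun 1)" by (rule linear_scale[OF lin])
    moreover have "S t (const_bcontfun 1) = const_bcontfun 1"
      using assms(1,2) unfolding markov_semigroup_def by blast
    ultimately show ?thesis by (simp only:)
  qed
  have "\<forall>t\<ge>0. \<forall>f. (\<forall>x. 0 \<le> apply_bcontfun f x) \<longrightarrow> (\<forall>x. 0 \<le> apply_bcontfun (S t f) x)"
    using assms(1) unfolding markov_semigroup_def by (elim conjE)
  then have pos: "0 \<le> apply_bcontfun (S t g) x" if "\<And>x. 0 \<le> apply_bcontfun g x" for g x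
    using assms(2) that by simp
  have bnd: "f x \<le> c" "0 \<le> c + f x" for x using assms(3)[of x] by auto
  have "0 \<le> apply_bcontfun (S t (const_bcontfun c - f)) x"
    by (rule pos) (simp add: const_bcontfun.rep_eq bnd)
  moreover have "0 \<le> apply_bcontfun (S t (const_bcontfun c + f)) x"
    by (rule pos) (simp add: const_bcontfun.rep_eq bnd)
  ultimately show ?thesis by (simp add: linear_diff[OF lin] linear_add[OF lin] one const_bcontfun.rep_eq abs_le_iff)
qed

section \<open>Histories, and measurability and bounds of local kernels\<close>

lemma sets_history: "sets (history M X s) =
   sigma_sets (space M) {X u -` A \<inter> space M |u A. 0 \<le> u \<and> u \<le> s \<and> A \<in> sets borel}"
  unfolding history_def by (rule sets_measure_of) auto

lemma space_history [simp]: "space (history M X s) = space M"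
  unfolding history_def by (rule space_measure_of) auto

lemma measurable_history:
  assumes "0 \<le> u" "u \<le> s"
  shows "X u \<in> borel_measurable (history M X s)"
proof (rule measurableI)
  fix A :: "'b set" assume "A \<in> sets borel"
  then show "X u -` A \<inter> space (history M X s) \<in> sets (history M X s)"
    using assms unfolding sets_history space_history by (intro sigma_sets.Basic) blast
qed simp

text \<open>Splitting according to the finitely many values of \<open>F\<close> in its first
  variable gives a finite sum of products of functions of one configuration each.\<close>

lemma borel_measurable_kernel:
  fixes F :: "config \<Rightarrow> config \<Rightarrow> real"
  assumes W: "finite W" "depends_on W F" "\<And>\<zeta>. depends_on W (F \<zeta>)"
    and X: "X \<in> borel_measurable A" and Y: "Y \<in> borel_measurable A"
  shows "(\<lambda>\<omega>. F (X \<omega>) (Y \<omega>)) \<in> borel_measurable A"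
proof -
  have eq: "F (X \<omega>) (Y \<omega>) = (\<Sum>\<phi>\<in>range F. of_bool (F (X \<omega>) = \<phi>) * \<phi> (Y \<omega>))" for \<omega>
    using finite_range_depends_on[OF W(1,2)] by (simp add: sum.delta')
  have 1: "(\<lambda>\<omega>. of_bool (F (X \<omega>) = \<phi>) :: real) \<in> borel_measurable A" for \<phi>
    by (rule measurable_compose[OF X borel_measurable_depends_on[OF W(1) depends_on_compose[OF W(2)]]])
  have 2: "(\<lambda>\<omega>. \<phi> (Y \<omega>)) \<in> borel_measurable A" if "\<phi> \<in> range F" for \<phi>
    using that measurable_compose[OF Y borel_measurable_depends_on[OF W(1) W(3)]] by auto
  show ?thesis
    unfolding eq by (intro borel_measurable_sum borel_measurable_times 1 2)
qed

lemma finite_kernel_values: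
  fixes F :: "config \<Rightarrow> config \<Rightarrow> real"
  assumes W: "finite W" "depends_on W F" "\<And>\<zeta>. depends_on W (F \<zeta>)"
  obtains C where "\<And>\<zeta> \<xi>. \<bar>F \<zeta> \<xi>\<bar> \<le> C" "C \<ge> 0"
proof -
  have "finite (\<Union>\<phi>\<in>range F. range \<phi>)"
    by (rule finite_UN_I[OF finite_range_depends_on[OF W(1,2)]])
       (use finite_range_depends_on[OF W(1) W(3)] in blast)
  then have "bounded (\<Union>\<phi>\<in>range F. range \<phi>)" by (rule finite_imp_bounded)
  then obtain C where "\<forall>x\<in>(\<Union>\<phi>\<in>range F. range \<phi>). norm x \<le> C"
    unfolding bounded_iff by blast
  then have C: "\<bar>F \<zeta> \<xi>\<bar> \<le> C" for \<zeta> \<xi> by auto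
  moreover have "C \<ge> 0" using C[of undefined undefined] by simp
  ultimately show thesis by (rule that)
qed

lemma depends_on_bounded:
  fixes \<phi> :: "config \<Rightarrow> real"
  assumes "finite W" "depends_on W \<phi>"
  obtains C where "\<And>\<zeta>. \<bar>\<phi> \<zeta>\<bar> \<le> C"
proof -
  have "bounded (range \<phi>)" by (rule finite_imp_bounded[OF finite_range_depends_on[OF assms]])
  then obtain C where "\<forall>x\<in>range \<phi>. norm x \<le> C"
    unfolding bounded_iff by blast
  then show thesis by (intro that) auto
qed

section \<open>The Bernoulli product measure\<close>

text \<open>Hoeffding's lemma for one centred site. The underlying inequality is for nonnegative
  parameters; a negative \<open>c\<close> is treated by interchanging particles and holes, that is,
  with \<open>- c\<close> and \<open>1 - \<rho>\<close>.\<close>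

lemma bernoulli_exp_moment:
  fixes c \<rho> :: real
  assumes "0 < \<rho>" "\<rho> < 1"
  shows "\<rho> * exp (c * (1 - \<rho>)) + (1 - \<rho>) * exp (c * (0 - \<rho>)) \<le> exp (c\<^sup>2 / 8)"
proof -
  have *: "exp (- h * p) * (1 + p * (exp h - 1)) \<le> exp (h\<^sup>2 / 8)" if "h \<ge> 0" "0 < p" for h p :: real
  proof -
    have pos: "1 + p * (exp h - 1) > 0"
      using that by (intro add_pos_nonneg mult_nonneg_nonneg) auto
    have "exp (- h * p + ln (1 + p * (exp h - 1))) \<le> exp (h\<^sup>2 / 8)"
      using Hoeffdings_lemma_aux[of h p] that by simp
    then show ?thesis by (simp only: exp_add exp_ln[OF pos])
  qed
  show ?thesis
  proof (cases "c \<ge> 0")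
    case True
    have "\<rho> * exp (c * (1 - \<rho>)) + (1 - \<rho>) * exp (c * (0 - \<rho>)) =
        exp (- c * \<rho>) * (1 + \<rho> * (exp c - 1))"
      by (simp add: algebra_simps flip: exp_add)
    then show ?thesis using *[OF True assms(1)] by simp
  next
    case False
    have "\<rho> * exp (c * (1 - \<rho>)) + (1 - \<rho>) * exp (c * (0 - \<rho>)) =
        exp (- (- c) * (1 - \<rho>)) * (1 + (1 - \<rho>) * (exp (- c) - 1))"
      by (simp add: algebra_simps flip: exp_add)
    then show ?thesis using *[of "- c" "1 - \<rho>"] assms False by simp
  qed
qed

text \<open>Written as a relabelling of coordinates, an exchange visibly preserves a product of
  identical laws.\<close>

lemma exchange_eq_transpose: "exchange x \<eta> = (\<lambda>y\<in>UNIV. \<eta> (Transposition.transpose x (x + 1) y))"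
  by (auto simp: exchange_def Transposition.transpose_def fun_eq_iff)

lemma prob_space_bernoulli_product: "prob_space (bernoulli_product \<rho>)"
  unfolding bernoulli_product_def by (intro prob_space_PiM prob_space_measure_pmf)

lemma distr_exchange_bernoulli_product:
  "distr (bernoulli_product \<rho>) (bernoulli_product \<rho>) (exchange x) = bernoulli_product \<rho>"
proof -
  have "distr (PiM UNIV (\<lambda>_::int. measure_pmf (bernoulli_pmf \<rho>)))
      (PiM UNIV (\<lambda>_. measure_pmf (bernoulli_pmf \<rho>)))
      (\<lambda>\<omega>. \<lambda>n\<in>UNIV. \<omega> (Transposition.transpose x (x + 1) n)) = PiM UNIV (\<lambda>_. measure_pmf (bernoulli_pmf \<rho>))"
    by (rule distr_PiM_reindex) (auto intro: prob_space_measure_pmf)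
  moreover have "exchange x = (\<lambda>\<omega>. \<lambda>n\<in>UNIV. \<omega> (Transposition.transpose x (x + 1) n))"
    by (rule ext) (rule exchange_eq_transpose)
  ultimately show ?thesis
    unfolding bernoulli_product_def by simp
qed

lemma measurable_exchange: "exchange x \<in> measurable (bernoulli_product \<rho>) (bernoulli_product \<rho>)"
  unfolding bernoulli_product_def
proof (rule measurable_PiM_single')
  fix y :: int
  have "(\<lambda>\<eta>. exchange x \<eta> y) = (\<lambda>\<eta>. \<eta> (Transposition.transpose x (x + 1) y))"
    by (simp add: exchange_eq_transpose)
  then show "(\<lambda>\<eta>. exchange x \<eta> y) \<in>
      measurable (PiM UNIV (\<lambda>_::int. measure_pmf (bernoulli_pmf \<rho>))) (measure_pmf (bernoulli_pmf \<rho>))"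
    by (simp only:) (rule measurable_component_singleton, simp)
qed (simp_all add: space_PiM)

lemma borel_measurable_bernoulli_product:
  assumes "f \<in> borel_measurable borel"
  shows "f \<in> borel_measurable (bernoulli_product \<rho>)"
  using assms measurable_cong_sets[OF sets_bernoulli_product refl, of \<rho> borel] by simp

lemma integrable_bernoulli_product:
  fixes f :: "config \<Rightarrow> real"
  assumes "f \<in> borel_measurable borel" "\<And>\<eta>. \<bar>f \<eta>\<bar> \<le> C"
  shows "integrable (bernoulli_product \<rho>) f"
proof -
  interpret prob_space "bernoulli_product \<rho>" by (rule prob_space_bernoulli_product)
  show ?thesis
    by (rule integrable_const_bound[of _ C])
       (use assms borel_measurable_bernoulli_product in auto)
qed

lemma integrable_bernoulli_product_depends_on:
  fixes \<phi> :: "config \<Rightarrow> real"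
  assumes "finite W" "depends_on W \<phi>"
  shows "integrable (bernoulli_product \<rho>) \<phi>"
proof -
  obtain C where "\<And>\<zeta>. \<bar>\<phi> \<zeta>\<bar> \<le> C" using depends_on_bounded[OF assms] by blast
  then show ?thesis
    by (rule integrable_bernoulli_product[OF borel_measurable_depends_on[OF assms]])
qed

lemma integral_exchange_bernoulli_product:
  fixes \<phi> :: "config \<Rightarrow> real"
  assumes "\<phi> \<in> borel_measurable borel"
  shows "(\<integral>\<eta>. \<phi> (exchange x \<eta>) \<partial>bernoulli_product \<rho>) = (\<integral>\<eta>. \<phi> \<eta> \<partial>bernoulli_product \<rho>)"
  using integral_distr[OF measurable_exchange borel_measurable_bernoulli_product[OF assms], of \<rho> x]
  by (simp add: distr_exchange_bernoulli_product)

text \<open>The integrand sees only a finite marginal, where Fubini's theorem applies.\<close>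

lemma integral_bernoulli_product_prod:
  fixes g :: "int \<Rightarrow> bool \<Rightarrow> real"
  assumes "finite A" and \<rho>: "0 \<le> \<rho>" "\<rho> \<le> 1"
  shows "(\<integral>\<eta>. (\<Prod>x\<in>A. g x (\<eta> x)) \<partial>bernoulli_product \<rho>) = (\<Prod>x\<in>A. \<rho> * g x True + (1 - \<rho>) * g x False)"
proof -
  let ?B = "\<lambda>_::int. measure_pmf (bernoulli_pmf \<rho>)"
  interpret P: product_prob_space ?B UNIV
    by unfold_locales
  have meas: "(\<lambda>\<eta>. \<Prod>x\<in>A. g x (\<eta> x)) \<in> borel_measurable (PiM A ?B)"
    by (intro borel_measurable_prod measurable_compose[OF measurable_component_singleton]) auto
  have "(\<integral>\<eta>. (\<Prod>x\<in>A. g x (\<eta> x)) \<partial>PiM A ?B) =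
      (\<integral>\<eta>. (\<Prod>x\<in>A. g x (\<eta> x)) \<partial>distr (PiM UNIV ?B) (PiM A ?B) (\<lambda>\<eta>. restrict \<eta> A))"
    using P.distr_PiM_restrict_finite[of A] assms(1) by simp
  also have "\<dots> = (\<integral>\<eta>. (\<Prod>x\<in>A. g x (restrict \<eta> A x)) \<partial>PiM UNIV ?B)"
    by (rule integral_distr[OF measurable_restrict_subset meas]) simp
  also have "\<dots> = (\<integral>\<eta>. (\<Prod>x\<in>A. g x (\<eta> x)) \<partial>bernoulli_product \<rho>)"
    unfolding bernoulli_product_def by (intro Bochner_Integration.integral_cong prod.cong) auto
  finally have "(\<integral>\<eta>. (\<Prod>x\<in>A. g x (\<eta> x)) \<partial>bernoulli_product \<rho>) = (\<integral>\<eta>. (\<Prod>x\<in>A. g x (\<eta> x)) \<partial>PiM A ?B)"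
    by (rule sym)
  also have "\<dots> = (\<Prod>x\<in>A. \<integral>b. g x b \<partial>measure_pmf (bernoulli_pmf \<rho>))"
    by (rule P.product_integral_prod[OF assms(1)]) (auto intro: integrable_measure_pmf_finite)
  finally show ?thesis
    using \<rho> by (simp add: integral_measure_pmf[of UNIV] UNIV_bool add.commute)
qed

lemma bernoulli_product_exp_moment:
  assumes "0 < \<rho>" "\<rho> < 1" "finite A"
  shows "(\<integral>\<eta>. exp (\<Sum>x\<in>A. c x * (of_bool (\<eta> x) - \<rho>)) \<partial>bernoulli_product \<rho>) \<le> exp ((\<Sum>x\<in>A. (c x)\<^sup>2) / 8)"
proof -
  have "(\<integral>\<eta>. exp (\<Sum>x\<in>A. c x * (of_bool (\<eta> x) - \<rho>)) \<partial>bernoulli_product \<rho>) =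
     (\<integral>\<eta>. (\<Prod>x\<in>A. exp (c x * (of_bool (\<eta> x) - \<rho>))) \<partial>bernoulli_product \<rho>)"
    by (simp add: exp_sum assms)
  also have "\<dots> = (\<Prod>x\<in>A. \<rho> * exp (c x * (1 - \<rho>)) + (1 - \<rho>) * exp (c x * (0 - \<rho>)))"
    using integral_bernoulli_product_prod[OF assms(3), of \<rho> "\<lambda>x b. exp (c x * (of_bool b - \<rho>))"] assms
    by simp
  also have "\<dots> \<le> (\<Prod>x\<in>A. exp ((c x)\<^sup>2 / 8))"
    by (rule prod_mono) (use bernoulli_exp_moment assms in \<open>auto intro!: add_nonneg_nonneg\<close>)
  also have "\<dots> = exp ((\<Sum>x\<in>A. (c x)\<^sup>2) / 8)"
    by (simp add: exp_sum assms sum_divide_distrib)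
  finally show ?thesis .
qed

text \<open>Every exchange preserves the product measure, so every term of the generator has mean
  zero. This is invariance in infinitesimal form.\<close>

lemma integral_ssep_operator:
  assumes "finite W" "depends_on W \<phi>"
  shows "(\<integral>\<eta>. ssep_operator \<phi> \<eta> \<partial>bernoulli_product \<rho>) = 0"
proof -
  note \<phi> = borel_measurable_depends_on[OF assms]
  have i: "integrable (bernoulli_product \<rho>) \<phi>"
    by (rule integrable_bernoulli_product_depends_on[OF assms])
  have e: "integrable (bernoulli_product \<rho>) (\<lambda>\<eta>. \<phi> (exchange x \<eta>))" for x
    using integrable_distr[OF measurable_exchange, of \<rho> x \<phi>] i
    by (simp add: distr_exchange_bernoulli_product)
  have "(\<integral>\<eta>. ssep_operator \<phi> \<eta> \<partial>bernoulli_product \<rho>) =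
      (1/2) * (\<Sum>x\<in>bonds W. (\<integral>\<eta>. \<phi> (exchange x \<eta>) \<partial>bernoulli_product \<rho>) - (\<integral>\<eta>. \<phi> \<eta> \<partial>bernoulli_product \<rho>))"
    using i e assms by (simp add: ssep_operator_depends_on[OF _ order_refl assms(2)])
  then show ?thesis by (simp add: integral_exchange_bernoulli_product[OF \<phi>])
qed

lemma borel_measurable_bcontfun: "apply_bcontfun f \<in> borel_measurable borel"
  by (rule borel_measurable_continuous_onI) simp

lemma bcontfun_bound:
  fixes f :: "'s::topological_space \<Rightarrow>\<^sub>C real"
  obtains C where "\<And>x. \<bar>f x\<bar> \<le> C"
proof -
  have "bounded (range (apply_bcontfun f))" by simp
  then obtain C where "\<forall>y\<in>range (apply_bcontfun f). norm y \<le> C"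
    unfolding bounded_iff by blast
  then have "\<bar>f x\<bar> \<le> C" for x by simp
  then show thesis by (rule that)
qed

lemma integrable_bernoulli_product_bcontfun:
  fixes f :: "config \<Rightarrow>\<^sub>C real"
  shows "integrable (bernoulli_product \<rho>) (apply_bcontfun f)"
proof -
  obtain C where "\<And>x. \<bar>f x\<bar> \<le> C" using bcontfun_bound[of f] by blast
  then show ?thesis
    by (rule integrable_bernoulli_product[OF borel_measurable_bcontfun])
qed

lemma integral_bernoulli_product_le_dist:
  fixes f g :: "config \<Rightarrow>\<^sub>C real"
  shows "\<bar>(\<integral>\<eta>. f \<eta> \<partial>bernoulli_product \<rho>) - (\<integral>\<eta>. g \<eta> \<partial>bernoulli_product \<rho>)\<bar> \<le> dist f g"
proof -
  interpret prob_space "bernoulli_product \<rho>" by (rule prob_space_bernoulli_product)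
  note [simp] = integrable_bernoulli_product_bcontfun
  have "\<bar>(\<integral>\<eta>. f \<eta> \<partial>bernoulli_product \<rho>) - (\<integral>\<eta>. g \<eta> \<partial>bernoulli_product \<rho>)\<bar> =
      \<bar>\<integral>\<eta>. f \<eta> - g \<eta> \<partial>bernoulli_product \<rho>\<bar>" by simp
  also have "\<dots> \<le> (\<integral>\<eta>. \<bar>f \<eta> - g \<eta>\<bar> \<partial>bernoulli_product \<rho>)"
    by (rule integral_abs_bound)
  also have "\<dots> \<le> (\<integral>\<eta>. dist f g \<partial>bernoulli_product \<rho>)"
    by (rule integral_mono) (use dist_bounded[of f _ g] in \<open>auto simp: dist_real_def\<close>)
  also have "\<dots> = dist f g" using prob_space by simp
  finally show ?thesis .
qed

text \<open>Integration is continuous in the supremum norm, so infinitesimal invariance extends to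
  the whole domain of the generator. The extension matters because \<open>S t f\<close> need not be
  local when \<open>f\<close> is.\<close>

lemma integral_closure_ssep_graph:
  assumes "(f, g) \<in> closure ssep_graph"
  shows "(\<integral>\<eta>. g \<eta> \<partial>bernoulli_product \<rho>) = 0"
proof -
  obtain p where p: "\<And>n. p n \<in> ssep_graph" "p \<longlonglongrightarrow> (f, g)"
    using assms closure_sequential by blast
  have zero: "(\<integral>\<eta>. snd (p n) \<eta> \<partial>bernoulli_product \<rho>) = 0" for n
  proof -
    obtain a b where ab: "p n = (a, b)" by fastforce
    then have *: "local_function a" "\<And>\<eta>. b \<eta> = ssep_operator a \<eta>"
      using p(1)[of n] by (auto simp: ssep_graph_def)
    then obtain W where W: "finite W" "depends_on W (apply_bcontfun a)"
      unfolding local_function_def depends_on_def by blast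
    show ?thesis using integral_ssep_operator[OF W] by (simp add: ab *)
  qed
  have "(\<lambda>n. snd (p n)) \<longlonglongrightarrow> snd (f, g)" by (intro tendsto_intros p)
  then have d: "(\<lambda>n. dist (snd (p n)) g) \<longlonglongrightarrow> 0" by (simp add: tendsto_dist_iff[symmetric])
  have "\<bar>\<integral>\<eta>. g \<eta> \<partial>bernoulli_product \<rho>\<bar> \<le> dist (snd (p n)) g" for n
    using integral_bernoulli_product_le_dist[where f = "snd (p n)" and g = g and \<rho> = \<rho>] zero[of n] by simp
  then have "\<bar>\<integral>\<eta>. g \<eta> \<partial>bernoulli_product \<rho>\<bar> \<le> 0"
    by (intro LIMSEQ_le_const[OF d]) auto
  then show ?thesis by simp
qed

section \<open>The exponential supermartingale and stationarity\<close>

text \<open>The exponential compensator of the increments \<open>G\<close>: if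
  \<open>G \<zeta> \<zeta> = 0\<close> it is half the sum over the bonds of
  \<open>exp (G \<zeta> (exchange x \<zeta>)) - 1\<close>.\<close>

definition rate :: "(config \<Rightarrow> config \<Rightarrow> real) \<Rightarrow> config \<Rightarrow> real" where
  "rate G \<zeta> = ssep_operator (\<lambda>\<xi>. exp (G \<zeta> \<xi>)) \<zeta>"

lemma prob_space_markov_process: "markov_process M S X \<Longrightarrow> prob_space M"
  unfolding markov_process_def by (rule conjunct1)

locale ssep_process =
  fixes M :: "'a measure" and \<eta> :: "real \<Rightarrow> 'a \<Rightarrow> config"
    and S :: "real \<Rightarrow> (config \<Rightarrow>\<^sub>C real) \<Rightarrow> (config \<Rightarrow>\<^sub>C real)"
  assumes S: "ssep_semigroup S" and markov: "markov_process M S \<eta>"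
begin

sublocale prob_space M
  by (rule prob_space_markov_process[OF markov])

lemma markov_semigroup: "markov_semigroup S"
  using S unfolding ssep_semigroup_def by (elim conjE)

lemma generator_graph_eq: "generator_graph S = closure ssep_graph"
  using S unfolding ssep_semigroup_def by (elim conjE)

lemma borel_measurable_process: "0 \<le> t \<Longrightarrow> \<eta> t \<in> borel_measurable M"
proof -
  have "\<forall>t\<ge>0. \<eta> t \<in> borel_measurable M"
    using markov unfolding markov_process_def by (elim conjE)
  then show "0 \<le> t \<Longrightarrow> \<eta> t \<in> borel_measurable M" by simp
qed

lemma cadlag_process: "\<omega> \<in> space M \<Longrightarrow> cadlag_path (\<lambda>t. \<eta> t \<omega>)"
proof -
  have "\<forall>\<omega>\<in>space M. cadlag_path (\<lambda>t. \<eta> t \<omega>)"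
    using markov unfolding markov_process_def by (elim conjE)
  then show "\<omega> \<in> space M \<Longrightarrow> cadlag_path (\<lambda>t. \<eta> t \<omega>)" by simp
qed

lemma real_cond_exp_process:
  assumes "0 \<le> s" "0 \<le> t"
  shows "AE \<omega> in M. real_cond_exp M (history M \<eta> s) (\<lambda>\<omega>'. apply_bcontfun f (\<eta> (s + t) \<omega>')) \<omega> =
    apply_bcontfun (S t f) (\<eta> s \<omega>)"
proof -
  have "\<forall>s\<ge>0. \<forall>t\<ge>0. \<forall>f. AE \<omega> in M.
      real_cond_exp M (history M \<eta> s) (\<lambda>\<omega>'. apply_bcontfun f (\<eta> (s + t) \<omega>')) \<omega> =
      apply_bcontfun (S t f) (\<eta> s \<omega>)"
    using markov unfolding markov_process_def by (elim conjE)
  then show ?thesis using assms by simp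
qed

lemma subalgebra_history: "subalgebra M (history M \<eta> s)"
proof -
  have "{\<eta> u -` A \<inter> space M |u A. 0 \<le> u \<and> u \<le> s \<and> A \<in> sets borel} \<subseteq> sets M"
    using measurable_sets[OF borel_measurable_process] by blast
  then have "sets (history M \<eta> s) \<subseteq> sets M"
    unfolding sets_history by (rule sets.sigma_sets_subset)
  then show ?thesis by (simp add: subalgebra_def)
qed

lemma borel_measurable_from_history:
  "f \<in> borel_measurable (history M \<eta> s) \<Longrightarrow> f \<in> borel_measurable M"
  by (rule measurable_from_subalg[OF subalgebra_history])

lemma borel_measurable_bcontfun_process:
  "0 \<le> t \<Longrightarrow> (\<lambda>\<omega>. apply_bcontfun f (\<eta> t \<omega>)) \<in> borel_measurable M"
  by (rule measurable_compose[OF borel_measurable_process borel_measurable_bcontfun])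

lemma borel_measurable_depends_on_process:
  fixes \<phi> :: "config \<Rightarrow> real"
  assumes "finite W" "depends_on W \<phi>" "0 \<le> t"
  shows "(\<lambda>\<omega>. \<phi> (\<eta> t \<omega>)) \<in> borel_measurable M"
  by (rule measurable_compose[OF borel_measurable_process[OF assms(3)] borel_measurable_depends_on[OF assms(1,2)]])

lemma integrable_bounded:
  fixes f :: "'a \<Rightarrow> real"
  assumes "f \<in> borel_measurable M" "\<And>\<omega>. \<omega> \<in> space M \<Longrightarrow> \<bar>f \<omega>\<bar> \<le> C"
  shows "integrable M f"
  by (rule integrable_const_bound[of _ C]) (use assms in auto)

text \<open>The Markov property tested against a bounded weight known at time \<open>s\<close>, the
  form that suits an induction along the grid.\<close>

lemma integral_markov:
  assumes st: "0 \<le> s" "0 \<le> t"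
    and Y: "Y \<in> borel_measurable (history M \<eta> s)" "\<And>\<omega>. \<omega> \<in> space M \<Longrightarrow> \<bar>Y \<omega>\<bar> \<le> B"
  shows "(\<integral>\<omega>. Y \<omega> * apply_bcontfun f (\<eta> (s + t) \<omega>) \<partial>M) = (\<integral>\<omega>. Y \<omega> * apply_bcontfun (S t f) (\<eta> s \<omega>) \<partial>M)"
proof -
  interpret H: finite_measure_subalgebra M "history M \<eta> s"
    by unfold_locales (rule subalgebra_history)
  obtain C where C: "\<And>x. \<bar>apply_bcontfun f x\<bar> \<le> C" using bcontfun_bound[of f] by blast
  have f: "(\<lambda>\<omega>. apply_bcontfun f (\<eta> (s + t) \<omega>)) \<in> borel_measurable M"
    using st by (intro borel_measurable_bcontfun_process) simp
  have YM: "Y \<in> borel_measurable M" by (rule borel_measurable_from_history[OF Y(1)])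
  have int: "integrable M (\<lambda>\<omega>. Y \<omega> * apply_bcontfun f (\<eta> (s + t) \<omega>))"
  proof (rule integrable_bounded)
    show "\<bar>Y \<omega> * apply_bcontfun f (\<eta> (s + t) \<omega>)\<bar> \<le> B * C" if "\<omega> \<in> space M" for \<omega>
      unfolding abs_mult by (rule mult_mono[OF Y(2)[OF that] C])
        (use Y(2)[OF that] in auto)
  qed (intro borel_measurable_times YM f)
  have "(\<integral>\<omega>. Y \<omega> * apply_bcontfun f (\<eta> (s + t) \<omega>) \<partial>M) =
      (\<integral>\<omega>. Y \<omega> * real_cond_exp M (history M \<eta> s) (\<lambda>\<omega>'. apply_bcontfun f (\<eta> (s + t) \<omega>')) \<omega> \<partial>M)"
    by (rule H.real_cond_exp_intg(2)[OF int Y(1) f, symmetric])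
  also have "\<dots> = (\<integral>\<omega>. Y \<omega> * apply_bcontfun (S t f) (\<eta> s \<omega>) \<partial>M)"
  proof (rule integral_cong_AE)
    show "AE \<omega> in M. Y \<omega> * real_cond_exp M (history M \<eta> s) (\<lambda>\<omega>'. apply_bcontfun f (\<eta> (s + t) \<omega>')) \<omega> =
        Y \<omega> * apply_bcontfun (S t f) (\<eta> s \<omega>)"
      using real_cond_exp_process[OF st, of f] by eventually_elim simp
  qed (intro borel_measurable_times YM borel_measurable_cond_exp2 borel_measurable_bcontfun_process st)+
  finally show ?thesis .
qed

text \<open>The function to be propagated depends on the present configuration. Since it ranges over
  a finite set, splitting on the value of \<open>F (\<eta> s \<omega>)\<close> makes it
  deterministic on each piece, and the indicator of the piece joins the weight.\<close>

lemma integral_markov_kernel: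
  fixes F :: "config \<Rightarrow> config \<Rightarrow> real"
  assumes st: "0 \<le> s" "0 \<le> t"
    and W: "finite W" "depends_on W F" "\<And>\<zeta>. depends_on W (F \<zeta>)"
    and Y: "Y \<in> borel_measurable (history M \<eta> s)" "\<And>\<omega>. \<omega> \<in> space M \<Longrightarrow> \<bar>Y \<omega>\<bar> \<le> B"
  shows "(\<integral>\<omega>. Y \<omega> * F (\<eta> s \<omega>) (\<eta> (s + t) \<omega>) \<partial>M) =
    (\<integral>\<omega>. Y \<omega> * apply_bcontfun (S t (Bcontfun (F (\<eta> s \<omega>)))) (\<eta> s \<omega>) \<partial>M)"
proof -
  define Z where "Z \<phi> \<omega> = Y \<omega> * of_bool (F (\<eta> s \<omega>) = \<phi>)" for \<phi> \<omega>
  have fin: "finite (range F)" by (rule finite_range_depends_on[OF W(1,2)])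
  have bc: "apply_bcontfun (Bcontfun \<phi>) = \<phi>" if "\<phi> \<in> range F" for \<phi>
    using that bcontfun_depends_on[OF W(1) W(3)] by (auto intro: Bcontfun_inverse)
  have "\<eta> s \<in> borel_measurable (history M \<eta> s)"
    using st by (intro measurable_history) auto
  from measurable_compose[OF this borel_measurable_depends_on[OF W(1) depends_on_compose[OF W(2)]]]
  have Zm: "Z \<phi> \<in> borel_measurable (history M \<eta> s)" for \<phi>
    unfolding Z_def by (intro borel_measurable_times Y(1))
  have Zb: "\<bar>Z \<phi> \<omega>\<bar> \<le> B" if "\<omega> \<in> space M" for \<phi> \<omega>
    using Y(2)[OF that] by (auto simp: Z_def)
  have int: "integrable M (\<lambda>\<omega>. Z \<phi> \<omega> * apply_bcontfun f (\<eta> u \<omega>))" if "0 \<le> u" for \<phi> f u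
  proof -
    obtain C where C: "\<And>x. \<bar>apply_bcontfun f x\<bar> \<le> C" using bcontfun_bound[of f] by blast
    show ?thesis
    proof (rule integrable_bounded)
      show "\<bar>Z \<phi> \<omega> * apply_bcontfun f (\<eta> u \<omega>)\<bar> \<le> B * C" if "\<omega> \<in> space M" for \<omega>
        unfolding abs_mult by (rule mult_mono[OF Zb[OF that] C]) (use Zb[OF that, of \<phi>] in auto)
    qed (intro borel_measurable_times borel_measurable_bcontfun_process borel_measurable_from_history[OF Zm] that)
  qed
  have "(\<integral>\<omega>. Y \<omega> * F (\<eta> s \<omega>) (\<eta> (s + t) \<omega>) \<partial>M) =
      (\<integral>\<omega>. (\<Sum>\<phi>\<in>range F. Z \<phi> \<omega> * apply_bcontfun (Bcontfun \<phi>) (\<eta> (s + t) \<omega>)) \<partial>M)"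
  proof (rule Bochner_Integration.integral_cong[OF refl])
    fix \<omega>
    have "(\<Sum>\<phi>\<in>range F. Z \<phi> \<omega> * apply_bcontfun (Bcontfun \<phi>) (\<eta> (s + t) \<omega>)) =
        (\<Sum>\<phi>\<in>range F. if \<phi> = F (\<eta> s \<omega>) then Y \<omega> * \<phi> (\<eta> (s + t) \<omega>) else 0)"
      by (intro sum.cong) (auto simp: Z_def bc)
    then show "Y \<omega> * F (\<eta> s \<omega>) (\<eta> (s + t) \<omega>) =
        (\<Sum>\<phi>\<in>range F. Z \<phi> \<omega> * apply_bcontfun (Bcontfun \<phi>) (\<eta> (s + t) \<omega>))"
      using fin by simp
  qed
  also have "\<dots> = (\<Sum>\<phi>\<in>range F. \<integral>\<omega>. Z \<phi> \<omega> * apply_bcontfun (Bcontfun \<phi>) (\<eta> (s + t) \<omega>) \<partial>M)"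
    using st by (intro Bochner_Integration.integral_sum int) simp
  also have "\<dots> = (\<Sum>\<phi>\<in>range F. \<integral>\<omega>. Z \<phi> \<omega> * apply_bcontfun (S t (Bcontfun \<phi>)) (\<eta> s \<omega>) \<partial>M)"
    by (intro sum.cong refl integral_markov[OF st Zm Zb])
  also have "\<dots> = (\<integral>\<omega>. (\<Sum>\<phi>\<in>range F. Z \<phi> \<omega> * apply_bcontfun (S t (Bcontfun \<phi>)) (\<eta> s \<omega>)) \<partial>M)"
    using st by (intro Bochner_Integration.integral_sum[symmetric] int)
  also have "\<dots> = (\<integral>\<omega>. Y \<omega> * apply_bcontfun (S t (Bcontfun (F (\<eta> s \<omega>)))) (\<eta> s \<omega>) \<partial>M)"
  proof (rule Bochner_Integration.integral_cong[OF refl])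
    fix \<omega>
    have "(\<Sum>\<phi>\<in>range F. Z \<phi> \<omega> * apply_bcontfun (S t (Bcontfun \<phi>)) (\<eta> s \<omega>)) =
        (\<Sum>\<phi>\<in>range F. if \<phi> = F (\<eta> s \<omega>) then Y \<omega> * apply_bcontfun (S t (Bcontfun \<phi>)) (\<eta> s \<omega>) else 0)"
      by (intro sum.cong) (auto simp: Z_def)
    then show "(\<Sum>\<phi>\<in>range F. Z \<phi> \<omega> * apply_bcontfun (S t (Bcontfun \<phi>)) (\<eta> s \<omega>)) =
        Y \<omega> * apply_bcontfun (S t (Bcontfun (F (\<eta> s \<omega>)))) (\<eta> s \<omega>)"
      using fin by simp
  qed
  finally show ?thesis .
qed

lemma borel_measurable_kernel_process:
  fixes F :: "config \<Rightarrow> config \<Rightarrow> real"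
  assumes "finite W" "depends_on W F" "\<And>\<zeta>. depends_on W (F \<zeta>)" "0 \<le> s" "0 \<le> t"
  shows "(\<lambda>\<omega>. F (\<eta> s \<omega>) (\<eta> t \<omega>)) \<in> borel_measurable M"
  by (intro borel_measurable_kernel[OF assms(1-3)] borel_measurable_process assms)

text \<open>Subtracting \<open>rate\<close>, and not the linear drift, makes the exponential of the
  sum an approximate supermartingale.\<close>

definition compensated :: "(config \<Rightarrow> config \<Rightarrow> real) \<Rightarrow> real \<Rightarrow> real \<Rightarrow> nat \<Rightarrow> 'a \<Rightarrow> real" where
  "compensated G s h N \<omega> = (\<Sum>k<N. G (\<eta> (s + real k * h) \<omega>) (\<eta> (s + real (Suc k) * h) \<omega>)
     - h * rate G (\<eta> (s + real k * h) \<omega>))"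

context
  fixes W :: "int set" and G :: "config \<Rightarrow> config \<Rightarrow> real"
  assumes W: "finite W" "depends_on W G" "\<And>\<zeta>. depends_on W (G \<zeta>)"
begin

lemma depends_on_exp_kernel:
  "depends_on W (\<lambda>\<zeta> \<xi>. exp (G \<zeta> \<xi>))" "\<And>\<zeta>. depends_on W (\<lambda>\<xi>. exp (G \<zeta> \<xi>))"
  using depends_on_compose[OF W(2), of "\<lambda>g \<xi>. exp (g \<xi>)"] depends_on_compose[OF W(3), of exp] by auto

lemma depends_on_rate: "depends_on (nbhd W) (rate G)"
  using depends_on_kernel_operator[OF W(1) depends_on_exp_kernel] unfolding rate_def .

lemma measurable_compensated:
  assumes "0 \<le> s" "0 \<le> h"
  shows "compensated G s h N \<in> borel_measurable (history M \<eta> (s + real N * h))"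
proof -
  have m: "\<eta> (s + real k * h) \<in> borel_measurable (history M \<eta> (s + real N * h))" if "k \<le> N" for k
    using assms that by (intro measurable_history) (auto intro: mult_right_mono)
  show ?thesis
    unfolding compensated_def
    by (intro borel_measurable_sum borel_measurable_diff borel_measurable_times borel_measurable_const
        borel_measurable_kernel[OF W] m
        measurable_compose[OF m borel_measurable_depends_on[OF finite_nbhd[OF W(1)] depends_on_rate]])
      auto
qed

text \<open>Local kernels are bounded, so the sum has a deterministic bound for each
  \<open>N\<close>; this settles the integrability of its exponential.\<close>

lemma compensated_bounded:
  assumes "0 \<le> h"
  obtains C where "\<And>\<omega>. \<bar>compensated G s h N \<omega>\<bar> \<le> C"
proof -
  obtain a where a: "\<And>\<zeta> \<xi>. \<bar>G \<zeta> \<xi>\<bar> \<le> a"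
    by (rule finite_kernel_values[OF W]) blast
  obtain b where b: "\<And>\<zeta>. \<bar>rate G \<zeta>\<bar> \<le> b"
    using depends_on_bounded[OF finite_nbhd[OF W(1)] depends_on_rate] by blast
  have "\<bar>compensated G s h N \<omega>\<bar> \<le> (\<Sum>k<N. a + h * b)" for \<omega>
    unfolding compensated_def
  proof (rule order_trans[OF sum_abs sum_mono])
    fix k
    have "\<bar>h * rate G (\<eta> (s + real k * h) \<omega>)\<bar> \<le> h * b"
      using mult_left_mono[OF b assms] assms by (simp add: abs_mult)
    then show "\<bar>G (\<eta> (s + real k * h) \<omega>) (\<eta> (s + real (Suc k) * h) \<omega>)
        - h * rate G (\<eta> (s + real k * h) \<omega>)\<bar> \<le> a + h * b"
      using a[of "\<eta> (s + real k * h) \<omega>" "\<eta> (s + real (Suc k) * h) \<omega>"] by linarith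
  qed
  then show thesis by (rule that)
qed

lemma integrable_exp_compensated:
  assumes "0 \<le> s" "0 \<le> h"
  shows "integrable M (\<lambda>\<omega>. exp (compensated G s h N \<omega>))"
proof -
  obtain C where C: "\<And>\<omega>. \<bar>compensated G s h N \<omega>\<bar> \<le> C" using compensated_bounded[OF assms(2)] by blast
  show ?thesis
  proof (rule integrable_bounded)
    show "(\<lambda>\<omega>. exp (compensated G s h N \<omega>)) \<in> borel_measurable M"
      by (rule measurable_compose[OF borel_measurable_from_history[OF measurable_compensated[OF assms]] borel_measurable_exp])
    show "\<bar>exp (compensated G s h N \<omega>)\<bar> \<le> exp C" for \<omega>
      using C[of \<omega>] by auto
  qed
qed

text \<open>The one-step estimate \<open>1 + h \<lambda> + h \<epsilon> \<le> exp (h \<lambda> + h \<epsilon>)\<close> makes the exponential of the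
  compensated sum a supermartingale up to the factor \<open>exp (h \<epsilon>)\<close>.\<close>

lemma exp_supermartingale:
  assumes diag: "\<And>\<zeta>. G \<zeta> \<zeta> = 0" and \<epsilon>: "\<epsilon> > 0"
  shows "\<forall>\<^sub>F h in at_right 0. \<forall>s\<ge>0. \<forall>N.
    expectation (\<lambda>\<omega>. exp (compensated G s h N \<omega>)) \<le> exp (real N * h * \<epsilon>)"
proof -
  define F where "F \<zeta> \<xi> = exp (G \<zeta> \<xi>)" for \<zeta> \<xi>
  have F: "depends_on W F" "\<And>\<zeta>. depends_on W (F \<zeta>)"
    using depends_on_exp_kernel unfolding F_def by auto
  have F_eq: "F \<zeta> = (\<lambda>\<xi>. exp (G \<zeta> \<xi>))" for \<zeta>
    by (simp add: F_def fun_eq_iff)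
  have "\<forall>\<^sub>F h in at_right 0. \<forall>\<zeta> \<xi>.
    \<bar>apply_bcontfun (S h (Bcontfun (F \<zeta>))) \<xi> - F \<zeta> \<xi> - h * ssep_operator (F \<zeta>) \<xi>\<bar> \<le> h * \<epsilon>"
    by (rule kernel_expansion[OF S W(1) F \<epsilon>])
  moreover have "\<forall>\<^sub>F h::real in at_right 0. h > 0"
    by (simp add: eventually_at_filter)
  ultimately show ?thesis
  proof eventually_elim
    case (elim h)
    have step: "exp (- h * rate G \<zeta>) * apply_bcontfun (S h (Bcontfun (F \<zeta>))) \<zeta> \<le> exp (h * \<epsilon>)" for \<zeta>
    proof -
      have "apply_bcontfun (S h (Bcontfun (F \<zeta>))) \<zeta> \<le> F \<zeta> \<zeta> + h * ssep_operator (F \<zeta>) \<zeta> + h * \<epsilon>"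
        using elim(1)[rule_format, of \<zeta> \<zeta>] by linarith
      also have "\<dots> = 1 + (h * rate G \<zeta> + h * \<epsilon>)"
        by (simp add: F_eq rate_def diag)
      also have "\<dots> \<le> exp (h * rate G \<zeta> + h * \<epsilon>)"
        by (rule exp_ge_add_one_self)
      finally have "exp (- h * rate G \<zeta>) * apply_bcontfun (S h (Bcontfun (F \<zeta>))) \<zeta> \<le>
          exp (- h * rate G \<zeta>) * exp (h * rate G \<zeta> + h * \<epsilon>)"
        by (rule mult_left_mono) simp
      then show ?thesis by (simp flip: exp_add)
    qed
    show ?case
    proof (intro allI impI)
      fix s :: real and N assume s: "0 \<le> s"
      have h: "0 \<le> h" using elim(2) by simp
      show "expectation (\<lambda>\<omega>. exp (compensated G s h N \<omega>)) \<le> exp (real N * h * \<epsilon>)"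
      proof (induction N)
        case 0
        then show ?case by (simp add: compensated_def prob_space)
      next
        case (Suc N)
        define u where "u = s + real N * h"
        have u: "0 \<le> u" "s + real (Suc N) * h = u + h"
          using s h by (auto simp: u_def algebra_simps)
        \<comment> \<open>The compensator of the last cell is known at the left end of that cell, so
          it belongs to the weight; only \<open>F\<close> of the last increment is left to the
          Markov property.\<close>
        define Y where "Y \<omega> = exp (compensated G s h N \<omega>) * exp (- h * rate G (\<eta> u \<omega>))" for \<omega>
        have mr: "(\<lambda>\<omega>. rate G (\<eta> u \<omega>)) \<in> borel_measurable (history M \<eta> u)"
          by (rule measurable_compose[OF measurable_history[OF u(1) order_refl]
                borel_measurable_depends_on[OF finite_nbhd[OF W(1)] depends_on_rate]])
        have Ym: "Y \<in> borel_measurable (history M \<eta> u)"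
          unfolding Y_def
          by (intro borel_measurable_times borel_measurable_const mr
               measurable_compose[OF measurable_compensated[OF s h, of N, folded u_def] borel_measurable_exp]
               measurable_compose[OF _ borel_measurable_exp])
        obtain C where C: "\<And>\<omega>. \<bar>compensated G s h N \<omega>\<bar> \<le> C" using compensated_bounded[OF h] by blast
        obtain b where b: "\<And>\<zeta>. \<bar>rate G \<zeta>\<bar> \<le> b"
          using depends_on_bounded[OF finite_nbhd[OF W(1)] depends_on_rate] by blast
        have Yb: "\<bar>Y \<omega>\<bar> \<le> exp C * exp (h * b)" for \<omega>
        proof -
          have "- h * rate G (\<eta> u \<omega>) \<le> h * b"
            using mult_left_mono[OF order_trans[OF abs_ge_minus_self b] h, of "\<eta> u \<omega>"] by simp
          moreover have "compensated G s h N \<omega> \<le> C" using C[of \<omega>] by simp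
          ultimately have "exp (compensated G s h N \<omega>) * exp (- h * rate G (\<eta> u \<omega>)) \<le> exp C * exp (h * b)"
            by (intro mult_mono) auto
          then show ?thesis by (simp add: Y_def abs_mult)
        qed
        have split: "exp (compensated G s h (Suc N) \<omega>) = Y \<omega> * F (\<eta> u \<omega>) (\<eta> (u + h) \<omega>)" for \<omega>
        proof -
          have "compensated G s h (Suc N) \<omega> =
              compensated G s h N \<omega> + (- h * rate G (\<eta> u \<omega>)) + G (\<eta> u \<omega>) (\<eta> (u + h) \<omega>)"
            by (simp only: compensated_def sum.lessThan_Suc u(2) u_def[symmetric])
          then show ?thesis by (simp only: exp_add Y_def F_def)
        qed
        have "expectation (\<lambda>\<omega>. exp (compensated G s h (Suc N) \<omega>)) =
            expectation (\<lambda>\<omega>. Y \<omega> * apply_bcontfun (S h (Bcontfun (F (\<eta> u \<omega>)))) (\<eta> u \<omega>))"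
          unfolding split by (rule integral_markov_kernel[OF u(1) h W(1) F Ym Yb])
        also have "\<dots> \<le> expectation (\<lambda>\<omega>. exp (h * \<epsilon>) * exp (compensated G s h N \<omega>))"
        proof (rule integral_mono')
          show "integrable M (\<lambda>\<omega>. exp (h * \<epsilon>) * exp (compensated G s h N \<omega>))"
            by (intro integrable_mult_right integrable_exp_compensated s h)
          fix \<omega>
          have "Y \<omega> * apply_bcontfun (S h (Bcontfun (F (\<eta> u \<omega>)))) (\<eta> u \<omega>) =
              exp (compensated G s h N \<omega>) *
              (exp (- h * rate G (\<eta> u \<omega>)) * apply_bcontfun (S h (Bcontfun (F (\<eta> u \<omega>)))) (\<eta> u \<omega>))"
            by (simp add: Y_def)
          also have "\<dots> \<le> exp (compensated G s h N \<omega>) * exp (h * \<epsilon>)"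
            by (intro mult_left_mono step) simp
          finally show "Y \<omega> * apply_bcontfun (S h (Bcontfun (F (\<eta> u \<omega>)))) (\<eta> u \<omega>) \<le>
              exp (h * \<epsilon>) * exp (compensated G s h N \<omega>)" by (simp add: mult.commute)
        qed auto
        also have "\<dots> \<le> exp (h * \<epsilon>) * exp (real N * h * \<epsilon>)"
          using Suc by simp
        also have "\<dots> = exp (real (Suc N) * h * \<epsilon>)"
          by (simp add: algebra_simps flip: exp_add)
        finally show ?case .
      qed
    qed
  qed
qed

end

end

locale stationary_ssep = ssep_process +
  fixes \<rho> :: real
  assumes \<rho>: "0 < \<rho>" "\<rho> < 1"
    and initial: "distr M (bernoulli_product \<rho>) (\<eta> 0) = bernoulli_product \<rho>"
begin

abbreviation \<nu> :: "config measure" where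
  "\<nu> \<equiv> bernoulli_product \<rho>"

section \<open>Invariance of the product measure and stationarity of one-time laws\<close>

lemma semigroup_add: "0 \<le> s \<Longrightarrow> 0 \<le> t \<Longrightarrow> S (s + t) f = S s (S t f)"
proof -
  have "\<forall>f. \<forall>s\<ge>0. \<forall>t\<ge>0. S (s + t) f = S s (S t f)"
    using markov_semigroup unfolding markov_semigroup_def by (elim conjE)
  then show "0 \<le> s \<Longrightarrow> 0 \<le> t \<Longrightarrow> S (s + t) f = S s (S t f)" by simp
qed

lemma semigroup_linear: "0 \<le> t \<Longrightarrow> linear (S t)"
proof -
  have "\<forall>t\<ge>0. linear (S t)"
    using markov_semigroup unfolding markov_semigroup_def by (elim conjE)
  then show "0 \<le> t \<Longrightarrow> linear (S t)" by simp
qed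

lemma semigroup_norm_le:
  assumes "0 \<le> t"
  shows "norm (S t f) \<le> norm f"
proof -
  have "\<bar>f x\<bar> \<le> norm f" for x using norm_bounded[of f x] by simp
  then have "\<bar>S t f x\<bar> \<le> norm f" for x
    using markov_semigroup_contraction[OF markov_semigroup assms] by blast
  then show ?thesis by (intro norm_bound) auto
qed

text \<open>\<open>S t\<close> commutes with \<open>S h\<close> and contracts, so it maps difference
  quotients of \<open>f\<close> to those of \<open>S t f\<close> without enlarging the
  error.\<close>

lemma generator_graph_semigroup:
  assumes fg: "(f, g) \<in> generator_graph S" and t: "0 \<le> t"
  shows "(S t f, S t g) \<in> generator_graph S"
proof -
  note lin = semigroup_linear[OF t]
  have lim: "((\<lambda>h. (1 / h) *\<^sub>R (S h f - f)) \<longlongrightarrow> g) (at_right 0)"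
    using fg by (simp add: generator_graph_def)
  have "((\<lambda>h. (1 / h) *\<^sub>R (S h (S t f) - S t f)) \<longlongrightarrow> S t g) (at_right 0)"
  proof (rule tendstoI)
    fix e :: real assume "e > 0"
    with lim have "\<forall>\<^sub>F h in at_right 0. dist ((1 / h) *\<^sub>R (S h f - f)) g < e" by (rule tendstoD)
    moreover have "\<forall>\<^sub>F h::real in at_right 0. h > 0"
      by (simp add: eventually_at_filter)
    ultimately show "\<forall>\<^sub>F h in at_right 0. dist ((1 / h) *\<^sub>R (S h (S t f) - S t f)) (S t g) < e"
    proof eventually_elim
      case (elim h)
      have "S h (S t f) = S t (S h f)"
        using semigroup_add[of h t f] semigroup_add[of t h f] elim t by (simp add: add.commute)
      then have "(1 / h) *\<^sub>R (S h (S t f) - S t f) - S t g = S t ((1 / h) *\<^sub>R (S h f - f) - g)"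
        by (simp only: linear_diff[OF lin] linear_scale[OF lin])
      then show ?case
        using elim(1) semigroup_norm_le[OF t, of "(1 / h) *\<^sub>R (S h f - f) - g"]
        by (simp only: dist_norm)
    qed
  qed
  then show ?thesis by (simp add: generator_graph_def)
qed

lemma integral_generator_zero:
  assumes "(f, g) \<in> generator_graph S"
  shows "(\<integral>\<zeta>. apply_bcontfun g \<zeta> \<partial>\<nu>) = 0"
  using assms integral_closure_ssep_graph unfolding generator_graph_eq by blast

text \<open>Since \<open>S\<close> contracts, the error in \<open>S (u + h) f - S u f = h *\<^sub>R S u g + o(h)\<close> is uniform in \<open>u\<close>,
  so the errors of \<open>n\<close> steps of length \<open>t / n\<close> add up to \<open>o(1)\<close>.\<close>

lemma integral_semigroup:
  assumes fg: "(f, g) \<in> generator_graph S" and t: "0 \<le> t"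
  shows "(\<integral>\<zeta>. apply_bcontfun (S t f) \<zeta> \<partial>\<nu>) = (\<integral>\<zeta>. apply_bcontfun f \<zeta> \<partial>\<nu>)"
proof (cases "t = 0")
  case True
  have "\<forall>f. S 0 f = f"
    using markov_semigroup unfolding markov_semigroup_def by (elim conjE)
  then show ?thesis using True by simp
next
  case False
  then have t0: "t > 0" using t by simp
  define U where "U u = (\<integral>\<zeta>. apply_bcontfun (S u f) \<zeta> \<partial>\<nu>)" for u
  have lim: "((\<lambda>h. (1 / h) *\<^sub>R (S h f - f)) \<longlongrightarrow> g) (at_right 0)"
    using fg by (simp add: generator_graph_def)
  have bound: "\<bar>U t - U 0\<bar> \<le> t * e" if e: "e > 0" for e
  proof -
    have "\<forall>\<^sub>F h in at_right 0. dist ((1 / h) *\<^sub>R (S h f - f)) g < e"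
      using lim e by (rule tendstoD)
    then obtain b where b: "b > 0" "\<And>h. 0 < h \<Longrightarrow> h < b \<Longrightarrow> dist ((1 / h) *\<^sub>R (S h f - f)) g < e"
      unfolding eventually_at_right_field by blast
    obtain N :: nat where N: "real N > t / b" using reals_Archimedean2 by blast
    moreover have "t / b > 0" using b(1) t0 by simp
    ultimately have N0: "real N > 0" by linarith
    define h where "h = t / real N"
    have "t < real N * b" using N b(1) by (simp add: pos_divide_less_eq)
    then have h: "0 < h" "h < b" using N0 t0 by (simp_all add: h_def pos_divide_less_eq mult.commute)
    have step: "\<bar>U (u + h) - U u\<bar> \<le> h * e" if u: "0 \<le> u" for u
    proof -
      note lin = semigroup_linear[OF u]
      have "U (u + h) = (\<integral>\<zeta>. apply_bcontfun (S u (S h f)) \<zeta> \<partial>\<nu>)"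
        using semigroup_add[of u h f] u h by (simp add: U_def)
      \<comment> \<open>The added term is free: \<open>S u g\<close> is the generator applied to
        \<open>S u f\<close> and therefore has mean zero.\<close>
      moreover have "U u = (\<integral>\<zeta>. apply_bcontfun (S u f + h *\<^sub>R S u g) \<zeta> \<partial>\<nu>)"
        using integral_generator_zero[OF generator_graph_semigroup[OF fg u]]
        by (simp add: U_def integrable_bernoulli_product_bcontfun)
      ultimately have "\<bar>U (u + h) - U u\<bar> \<le> dist (S u (S h f)) (S u f + h *\<^sub>R S u g)"
        using integral_bernoulli_product_le_dist[where f = "S u (S h f)" and g = "S u f + h *\<^sub>R S u g" and \<rho> = \<rho>]
        by (simp only:)
      also have "\<dots> = norm (S u (h *\<^sub>R ((1 / h) *\<^sub>R (S h f - f) - g)))"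
      proof -
        have "h *\<^sub>R ((1 / h) *\<^sub>R (S h f - f) - g) = S h f - f - h *\<^sub>R g"
          using h by (simp add: scaleR_diff_right)
        then show ?thesis
          by (simp only: dist_norm linear_diff[OF lin] linear_scale[OF lin] linear_add[OF lin] diff_diff_eq)
      qed
      also have "\<dots> \<le> norm (h *\<^sub>R ((1 / h) *\<^sub>R (S h f - f) - g))"
        by (rule semigroup_norm_le[OF u])
      also have "\<dots> = h * dist ((1 / h) *\<^sub>R (S h f - f)) g"
        using h by (simp add: dist_norm)
      also have "\<dots> \<le> h * e"
        using b(2)[OF h] h by (intro mult_left_mono) auto
      finally show ?thesis .
    qed
    have "\<bar>U (real n * h) - U 0\<bar> \<le> real n * (h * e)" for n
    proof (induction n)
      case (Suc n)
      have "\<bar>U (real n * h + h) - U (real n * h)\<bar> \<le> h * e"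
        using h by (intro step) simp
      moreover have "real (Suc n) * h = real n * h + h" by (simp add: algebra_simps)
      moreover have "real (Suc n) * (h * e) = real n * (h * e) + h * e" by (simp add: algebra_simps)
      ultimately show ?case using Suc by simp
    qed simp
    from this[of N] show ?thesis using N0 by (simp add: h_def)
  qed
  have "\<bar>U t - U 0\<bar> \<le> 0"
  proof (rule field_le_epsilon)
    fix e :: real assume "e > 0"
    then have "e / t > 0" using t0 by simp
    from bound[OF this] show "\<bar>U t - U 0\<bar> \<le> 0 + e" using t0 by simp
  qed
  moreover have "\<forall>f. S 0 f = f"
    using markov_semigroup unfolding markov_semigroup_def by (elim conjE)
  ultimately show ?thesis by (simp add: U_def)
qed

text \<open>The Markov property from time 0 with weight 1 reduces the claim to invariance under the
  semigroup.\<close>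

lemma expectation_stationary:
  fixes \<phi> :: "config \<Rightarrow> real"
  assumes W: "finite W" "depends_on W \<phi>" and t: "0 \<le> t"
  shows "expectation (\<lambda>\<omega>. \<phi> (\<eta> t \<omega>)) = (\<integral>\<zeta>. \<phi> \<zeta> \<partial>\<nu>)"
proof -
  let ?f = "Bcontfun \<phi>"
  have f: "apply_bcontfun ?f = \<phi>"
    by (rule Bcontfun_inverse[OF bcontfun_depends_on[OF W]])
  have "(?f, Bcontfun (ssep_operator \<phi>)) \<in> generator_graph S"
    unfolding generator_graph_eq by (rule subsetD[OF closure_subset local_in_ssep_graph[OF W]])
  from integral_semigroup[OF this t] have inv: "(\<integral>\<zeta>. apply_bcontfun (S t ?f) \<zeta> \<partial>\<nu>) = (\<integral>\<zeta>. \<phi> \<zeta> \<partial>\<nu>)"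
    by (simp only: f)
  have "expectation (\<lambda>\<omega>. 1 * apply_bcontfun ?f (\<eta> (0 + t) \<omega>)) =
      expectation (\<lambda>\<omega>. 1 * apply_bcontfun (S t ?f) (\<eta> 0 \<omega>))"
    by (rule integral_markov[OF order_refl t, of _ 1]) auto
  then have "expectation (\<lambda>\<omega>. \<phi> (\<eta> t \<omega>)) = expectation (\<lambda>\<omega>. apply_bcontfun (S t ?f) (\<eta> 0 \<omega>))"
    by (simp add: f)
  also have "\<dots> = (\<integral>\<zeta>. apply_bcontfun (S t ?f) \<zeta> \<partial>distr M \<nu> (\<eta> 0))"
  proof (rule integral_distr[symmetric])
    show "\<eta> 0 \<in> measurable M \<nu>"
      using borel_measurable_process[of 0] measurable_cong_sets[OF refl sets_bernoulli_product, of M \<rho>] by simp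
  qed (rule borel_measurable_bernoulli_product[OF borel_measurable_bcontfun])
  also have "\<dots> = (\<integral>\<zeta>. \<phi> \<zeta> \<partial>\<nu>)"
    by (simp only: initial inv)
  finally show ?thesis .
qed

lemma exp_moment_linear:
  assumes "finite A" "0 \<le> t"
  shows "expectation (\<lambda>\<omega>. exp (\<Sum>x\<in>A. c x * (of_bool (\<eta> t \<omega> x) - \<rho>))) \<le> exp ((\<Sum>x\<in>A. (c x)\<^sup>2) / 8)"
proof -
  have "depends_on A (\<lambda>\<zeta>. exp (\<Sum>x\<in>A. c x * (of_bool (\<zeta> x) - \<rho>)))"
    by (rule depends_onI) (auto intro!: sum.cong)
  from expectation_stationary[OF assms(1) this assms(2)]
  show ?thesis
    using bernoulli_product_exp_moment[OF \<rho> assms(1), of c] by (simp only:)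
qed

end

section \<open>Discretized currents\<close>

definition bond_current :: "int \<Rightarrow> config \<Rightarrow> config \<Rightarrow> real" where
  "bond_current y \<zeta> \<xi> = jstep y (y + 1) \<zeta> \<xi> - jstep (y + 1) y \<zeta> \<xi>"

definition bond_activity :: "int \<Rightarrow> config \<Rightarrow> config \<Rightarrow> real" where
  "bond_activity y \<zeta> \<xi> = jstep y (y + 1) \<zeta> \<xi> + jstep (y + 1) y \<zeta> \<xi>"

lemma bond_current_diag [simp]: "bond_current y \<zeta> \<zeta> = 0"
  by (simp add: bond_current_def jstep_def)

lemma bond_activity_diag [simp]: "bond_activity y \<zeta> \<zeta> = 0"
  by (simp add: bond_activity_def jstep_def)

text \<open>A jump across a bond changes both of its ends, and an exchange at another bond changes
  at most one of them. Hence different bonds do not interact in the rates.\<close>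

lemma bond_current_exchange:
  "bond_current y \<zeta> (exchange x \<zeta>) = (if x = y then of_bool (\<zeta> y) - of_bool (\<zeta> (y + 1)) else 0)"
  by (auto simp: bond_current_def jstep_def exchange_def)

lemma bond_activity_exchange:
  "bond_activity y \<zeta> (exchange x \<zeta>) = (if x = y then of_bool (\<zeta> y \<noteq> \<zeta> (y + 1)) else 0)"
  by (auto simp: bond_activity_def jstep_def exchange_def)

lemma bond_kernels_cong:
  assumes "\<zeta> y = \<zeta>' y" "\<zeta> (y + 1) = \<zeta>' (y + 1)" "\<xi> y = \<xi>' y" "\<xi> (y + 1) = \<xi>' (y + 1)"
  shows "bond_current y \<zeta> \<xi> = bond_current y \<zeta>' \<xi>'" "bond_activity y \<zeta> \<xi> = bond_activity y \<zeta>' \<xi>'"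
  using assms by (simp_all add: bond_current_def bond_activity_def jstep_def)

lemma depends_on_kernelI:
  fixes F :: "config \<Rightarrow> config \<Rightarrow> 'b"
  assumes "\<And>\<zeta> \<zeta>' \<xi> \<xi>'. (\<And>x. x \<in> W \<Longrightarrow> \<zeta> x = \<zeta>' x) \<Longrightarrow> (\<And>x. x \<in> W \<Longrightarrow> \<xi> x = \<xi>' x) \<Longrightarrow> F \<zeta> \<xi> = F \<zeta>' \<xi>'"
  shows "depends_on W F" "\<And>\<zeta>. depends_on W (F \<zeta>)"
proof -
  show "depends_on W F"
    by (rule depends_onI, rule ext, rule assms) simp_all
  show "depends_on W (F \<zeta>)" for \<zeta>
    by (rule depends_onI, rule assms) simp_all
qed

section \<open>Exponential inequalities and the passage from grid to path\<close>

lemma exp_le_quadratic: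
  fixes y :: real
  assumes "\<bar>y\<bar> \<le> 1"
  shows "exp y \<le> 1 + y + y\<^sup>2"
proof (cases "0 \<le> y")
  case True
  then show ?thesis using exp_bound[of y] assms by simp
next
  case False
  define z where "z = - y"
  have z: "0 \<le> z" "z \<le> 1" using False assms by (auto simp: z_def)
  \<comment> \<open>For negative arguments the claim
    \<open>exp (- z) \<le> 1 - z + z\<^sup>2\<close> becomes a lower bound on \<open>exp z\<close>,
    for which the quadratic Taylor polynomial suffices.\<close>
  have "1 \<le> (1 + z + z\<^sup>2 / 2) * (1 - z + z\<^sup>2)"
  proof -
    have "(1 + z + z\<^sup>2 / 2) * (1 - z + z\<^sup>2) = 1 + (z ^ 2 + z ^ 3 + z ^ 4) / 2"
      by (simp add: field_simps power2_eq_square power3_eq_cube power4_eq_xxxx)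
    then show ?thesis using z by simp
  qed
  also have "\<dots> \<le> exp z * (1 - z + z\<^sup>2)"
    using z zero_le_power2[of z] by (intro mult_right_mono exp_lower_Taylor_quadratic) linarith+
  finally have "exp (- z) * 1 \<le> exp (- z) * (exp z * (1 - z + z\<^sup>2))"
    by (intro mult_left_mono) simp_all
  also have "\<dots> = 1 - z + z\<^sup>2"
    by (simp add: exp_minus)
  finally show ?thesis by (simp add: z_def)
qed

lemma eventually_at_right_0_divide_nat:
  assumes "\<forall>\<^sub>F h in at_right 0. P h" "T > (0::real)"
  shows "\<forall>\<^sub>F N in sequentially. P (T / real N)"
proof -
  obtain b where b: "b > 0" "\<And>h. 0 < h \<Longrightarrow> h < b \<Longrightarrow> P h"
    using assms(1) unfolding eventually_at_right_field by blast
  have "(\<lambda>N. T / real N) \<longlonglongrightarrow> 0" by (rule lim_const_over_n)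
  then have "\<forall>\<^sub>F N in sequentially. T / real N < b" using b(1) by (rule order_tendstoD)
  moreover have "\<forall>\<^sub>F N in sequentially. N > (0::nat)" by (rule eventually_gt_at_top)
  ultimately show ?thesis
  proof eventually_elim
    case (elim N)
    then show ?case using assms(2) by (intro b(2)) simp_all
  qed
qed

lemma exp_mean_le:
  fixes x :: "nat \<Rightarrow> real"
  assumes "N > 0"
  shows "exp ((\<Sum>k<N. x k) / real N) \<le> (\<Sum>k<N. exp (x k)) / real N"
proof -
  have "convex_on UNIV (exp :: real \<Rightarrow> real)"
    using convex_on_exp[of 1] by simp
  then have "exp (\<Sum>k<N. (1 / real N) *\<^sub>R x k) \<le> (\<Sum>k<N. (1 / real N) * exp (x k))"
    by (rule convex_on_sum[rotated 2]) (use assms in auto)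
  then show ?thesis by (simp add: sum_divide_distrib)
qed

text \<open>Plays the part of Hoelder's inequality: it separates four dependent exponents at the
  price of dividing each by 4.\<close>

lemma exp_mean4_le:
  fixes a b c d :: real
  shows "exp ((a + b + c + d) / 4) \<le> (exp a + exp b + exp c + exp d) / 4"
  using exp_mean_le[of 4 "\<lambda>k. if k = 0 then a else if k = 1 then b else if k = 2 then c else d"]
  by (simp add: eval_nat_numeral)

lemma (in prob_space) prob_le_expectation:
  fixes f :: "'a \<Rightarrow> real"
  assumes "integrable M f" "{\<omega> \<in> space M. P \<omega>} \<in> sets M"
    and "\<And>\<omega>. \<omega> \<in> space M \<Longrightarrow> of_bool (P \<omega>) \<le> f \<omega>"
  shows "prob {\<omega> \<in> space M. P \<omega>} \<le> expectation f"
proof -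
  let ?A = "{\<omega> \<in> space M. P \<omega>}"
  have "expectation (indicator ?A :: 'a \<Rightarrow> real) \<le> expectation f"
  proof (rule integral_mono'[OF assms(1)])
    fix \<omega> assume \<omega>: "\<omega> \<in> space M"
    show "indicator ?A \<omega> \<le> f \<omega>" "0 \<le> f \<omega>"
      using assms(3)[OF \<omega>] \<omega> by (cases "P \<omega>"; simp add: indicator_def)+
  qed
  then show ?thesis using assms(2) by simp
qed

text \<open>The approximations are eventually equal to the limit at each sample point, not merely
  convergent. Hence the indicators of the events converge for every threshold \<open>v\<close>, and
  the bound passes to the limit with the same \<open>v\<close>.\<close>

lemma (in prob_space) prob_ge_limit:
  fixes X :: "nat \<Rightarrow> 'a \<Rightarrow> real"
  assumes X: "\<And>N. X N \<in> borel_measurable M"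
    and lim: "\<And>\<omega>. \<omega> \<in> space M \<Longrightarrow> \<forall>\<^sub>F N in sequentially. Y \<omega> = X N \<omega>"
  shows "Y \<in> borel_measurable M"
    and "(\<forall>\<^sub>F N in sequentially. prob {\<omega> \<in> space M. v \<le> X N \<omega>} \<le> c) \<Longrightarrow> prob {\<omega> \<in> space M. v \<le> Y \<omega>} \<le> c"
proof -
  have "(\<lambda>N. X N \<omega>) \<longlonglongrightarrow> Y \<omega>" if "\<omega> \<in> space M" for \<omega>
    by (rule tendsto_eventually) (use lim[OF that] in \<open>eventually_elim, simp\<close>)
  then show Y: "Y \<in> borel_measurable M"
    by (rule borel_measurable_LIMSEQ_real[OF _ X])
  have mX: "{\<omega> \<in> space M. v \<le> X N \<omega>} \<in> sets M" for N
    using X by measurable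
  have mY: "{\<omega> \<in> space M. v \<le> Y \<omega>} \<in> sets M"
    using Y by measurable
  assume c: "\<forall>\<^sub>F N in sequentially. prob {\<omega> \<in> space M. v \<le> X N \<omega>} \<le> c"
  have "(\<lambda>N. \<integral>\<omega>. indicator {\<omega> \<in> space M. v \<le> X N \<omega>} \<omega> \<partial>M) \<longlonglongrightarrow>
      (\<integral>\<omega>. indicator {\<omega> \<in> space M. v \<le> Y \<omega>} \<omega> \<partial>M :: real)"
  proof (rule integral_dominated_convergence[where w = "\<lambda>_. 1"])
    show "AE \<omega> in M. (\<lambda>N. indicator {\<omega> \<in> space M. v \<le> X N \<omega>} \<omega> :: real) \<longlonglongrightarrow>
        indicator {\<omega> \<in> space M. v \<le> Y \<omega>} \<omega>"
    proof (rule AE_I2)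
      fix \<omega> assume "\<omega> \<in> space M"
      from lim[OF this] have "\<forall>\<^sub>F N in sequentially.
          (indicator {\<omega> \<in> space M. v \<le> X N \<omega>} \<omega> :: real) = indicator {\<omega> \<in> space M. v \<le> Y \<omega>} \<omega>"
        by eventually_elim (simp add: indicator_def)
      then show "(\<lambda>N. indicator {\<omega> \<in> space M. v \<le> X N \<omega>} \<omega> :: real) \<longlonglongrightarrow>
          indicator {\<omega> \<in> space M. v \<le> Y \<omega>} \<omega>"
        by (rule tendsto_eventually)
    qed
  qed (use mX mY in \<open>auto simp: indicator_def\<close>)
  then have "(\<lambda>N. prob {\<omega> \<in> space M. v \<le> X N \<omega>}) \<longlonglongrightarrow> prob {\<omega> \<in> space M. v \<le> Y \<omega>}"
    using mX mY by simp
  then show "prob {\<omega> \<in> space M. v \<le> Y \<omega>} \<le> c"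
    by (rule tendsto_upperbound[OF _ c]) simp
qed

text \<open>The total number of jumps over the bond. It is monotone in time, so its increment over a
  cell bounds the oscillation of the current within the cell.\<close>

definition activity :: "(real \<Rightarrow> config) \<Rightarrow> real \<Rightarrow> real" where
  "activity \<xi> t = real (jump_count \<xi> 0 1 t) + real (jump_count \<xi> 1 0 t)"

context ssep_process
begin

definition grid_sum :: "(config \<Rightarrow> config \<Rightarrow> real) \<Rightarrow> real \<Rightarrow> real \<Rightarrow> nat \<Rightarrow> 'a \<Rightarrow> real" where
  "grid_sum G s T N \<omega> = (\<Sum>k<N. G (\<eta> (s + real k * (T / real N)) \<omega>) (\<eta> (s + real (Suc k) * (T / real N)) \<omega>))"

lemma grid_sum_eq_compensated:
  "grid_sum G s T N \<omega> =
    compensated G s (T / real N) N \<omega> + T / real N * (\<Sum>k<N. rate G (\<eta> (s + real k * (T / real N)) \<omega>))"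
  by (simp add: grid_sum_def compensated_def sum_subtractf sum_distrib_left)

lemma borel_measurable_grid_sum:
  assumes "finite W" "depends_on W G" "\<And>\<zeta>. depends_on W (G \<zeta>)" "0 \<le> s" "0 \<le> T"
  shows "grid_sum G s T N \<in> borel_measurable M"
  unfolding grid_sum_def
  by (intro borel_measurable_sum borel_measurable_kernel_process[OF assms(1-3)]) (use assms in auto)

lemma current_discretization:
  assumes "\<omega> \<in> space M" "0 \<le> s" "0 \<le> T"
  shows "\<forall>\<^sub>F N in sequentially. current (\<lambda>t. \<eta> t \<omega>) (s + T) - current (\<lambda>t. \<eta> t \<omega>) s = grid_sum (bond_current 0) s T N \<omega>"
  using jump_count_discretization[OF cadlag_process[OF assms(1)] assms(2,3), of 0 1]
    jump_count_discretization[OF cadlag_process[OF assms(1)] assms(2,3), of 1 0]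
  by eventually_elim (simp add: current_def grid_sum_def bond_current_def sum_subtractf)

lemma activity_discretization:
  assumes "\<omega> \<in> space M" "0 \<le> s" "0 \<le> T"
  shows "\<forall>\<^sub>F N in sequentially. activity (\<lambda>t. \<eta> t \<omega>) (s + T) - activity (\<lambda>t. \<eta> t \<omega>) s = grid_sum (bond_activity 0) s T N \<omega>"
  using jump_count_discretization[OF cadlag_process[OF assms(1)] assms(2,3), of 0 1]
    jump_count_discretization[OF cadlag_process[OF assms(1)] assms(2,3), of 1 0]
  by eventually_elim (simp add: activity_def grid_sum_def bond_activity_def sum.distrib)

lemma depends_on_bond_current: "depends_on {y, y + 1} (bond_current y)" "\<And>\<zeta>. depends_on {y, y + 1} (bond_current y \<zeta>)"
  by (rule depends_on_kernelI, rule bond_kernels_cong; simp)+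

lemma depends_on_bond_activity: "depends_on {y, y + 1} (bond_activity y)" "\<And>\<zeta>. depends_on {y, y + 1} (bond_activity y \<zeta>)"
  by (rule depends_on_kernelI, rule bond_kernels_cong; simp)+

lemma borel_measurable_current_diff:
  assumes "0 \<le> s" "0 \<le> T"
  shows "(\<lambda>\<omega>. current (\<lambda>t. \<eta> t \<omega>) (s + T) - current (\<lambda>t. \<eta> t \<omega>) s) \<in> borel_measurable M"
  by (rule prob_ge_limit(1)[OF borel_measurable_grid_sum[OF _ depends_on_bond_current assms] current_discretization])
     (use assms in auto)

lemma borel_measurable_activity_diff:
  assumes "0 \<le> s" "0 \<le> T"
  shows "(\<lambda>\<omega>. activity (\<lambda>t. \<eta> t \<omega>) (s + T) - activity (\<lambda>t. \<eta> t \<omega>) s) \<in> borel_measurable M"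
  by (rule prob_ge_limit(1)[OF borel_measurable_grid_sum[OF _ depends_on_bond_activity assms] activity_discretization])
     (use assms in auto)

lemma exp_compensated_eventually:
  assumes "finite W" "depends_on W G" "\<And>\<zeta>. depends_on W (G \<zeta>)" "\<And>\<zeta>. G \<zeta> \<zeta> = 0"
    and "0 \<le> s" "0 < T" "0 < \<epsilon>"
  shows "\<forall>\<^sub>F N in sequentially. expectation (\<lambda>\<omega>. exp (compensated G s (T / real N) N \<omega>)) \<le> exp (T * \<epsilon>)"
proof -
  have "\<forall>\<^sub>F N in sequentially. \<forall>s\<ge>0. \<forall>n.
    expectation (\<lambda>\<omega>. exp (compensated G s (T / real N) n \<omega>)) \<le> exp (real n * (T / real N) * \<epsilon>)"
    by (rule eventually_at_right_0_divide_nat[OF exp_supermartingale[OF assms(1-3)]]) (use assms in auto)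
  moreover have "\<forall>\<^sub>F N in sequentially. N > (0::nat)" by (rule eventually_gt_at_top)
  ultimately show ?thesis
  proof eventually_elim
    case (elim N)
    from elim(1)[rule_format, OF assms(5), of N] elim(2) show ?case by simp
  qed
qed

text \<open>Exponential Chebyshev inequality with parameter 1. One \<open>T\<close> bounds the
  compensator, because the rate is at most \<open>(exp 1 - 1) / 2\<close>; the other is the slack of
  the supermartingale estimate, taken with \<open>\<epsilon> = 1\<close>.\<close>

lemma activity_tail:
  assumes s: "0 \<le> s" and T: "0 < T"
  shows "prob {\<omega> \<in> space M. v \<le> activity (\<lambda>t. \<eta> t \<omega>) (s + T) - activity (\<lambda>t. \<eta> t \<omega>) s} \<le> exp (2 * T - v)"
proof (rule prob_ge_limit(2)[of "grid_sum (bond_activity 0) s T"])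
  let ?G = "bond_activity 0"
  have W: "finite {0, 0 + 1 :: int}" by simp
  note G = W depends_on_bond_activity[of 0]
  have rate: "rate ?G \<zeta> \<le> 1" for \<zeta>
  proof -
    have "rate ?G \<zeta> = 1/2 * (\<Sum>x\<in>bonds {0, 0 + 1}. exp (?G \<zeta> (exchange x \<zeta>)) - exp (?G \<zeta> \<zeta>))"
      unfolding rate_def
      by (rule ssep_operator_depends_on[OF finite_bonds[OF W] order_refl depends_on_compose[OF G(3)]])
    also have "(\<Sum>x\<in>bonds {0, 0 + 1}. exp (?G \<zeta> (exchange x \<zeta>)) - exp (?G \<zeta> \<zeta>)) =
        (\<Sum>x\<in>bonds {0, 0 + 1}. if x = 0 then exp (of_bool (\<zeta> 0 \<noteq> \<zeta> 1)) - 1 else 0)"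
      by (intro sum.cong) (auto simp: bond_activity_exchange)
    also have "\<dots> = exp (of_bool (\<zeta> 0 \<noteq> \<zeta> 1)) - 1"
      by (subst sum.delta) (auto simp: bonds_def)
    also have "\<dots> \<le> 2" using exp_le by auto
    finally show ?thesis by simp
  qed
  show "grid_sum ?G s T N \<in> borel_measurable M" for N
    using s T by (intro borel_measurable_grid_sum[OF G]) auto
  show "\<forall>\<^sub>F N in sequentially. activity (\<lambda>t. \<eta> t \<omega>) (s + T) - activity (\<lambda>t. \<eta> t \<omega>) s = grid_sum ?G s T N \<omega>"
    if "\<omega> \<in> space M" for \<omega>
    using that s T by (intro activity_discretization) auto
  have "\<forall>\<^sub>F N in sequentially. expectation (\<lambda>\<omega>. exp (compensated ?G s (T / real N) N \<omega>)) \<le> exp (T * 1)"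
    by (rule exp_compensated_eventually[OF G]) (use s T in auto)
  moreover have "\<forall>\<^sub>F N in sequentially. N > (0::nat)" by (rule eventually_gt_at_top)
  ultimately show "\<forall>\<^sub>F N in sequentially. prob {\<omega> \<in> space M. v \<le> grid_sum ?G s T N \<omega>} \<le> exp (2 * T - v)"
  proof eventually_elim
    case (elim N)
    have int: "integrable M (\<lambda>\<omega>. exp (compensated ?G s (T / real N) N \<omega>))"
      using s T by (intro integrable_exp_compensated[OF G]) auto
    have le: "grid_sum ?G s T N \<omega> \<le> compensated ?G s (T / real N) N \<omega> + T" for \<omega>
    proof -
      have "(\<Sum>k<N. rate ?G (\<eta> (s + real k * (T / real N)) \<omega>)) \<le> real N"
        using sum_bounded_above[of "{..<N}" "\<lambda>k. rate ?G (\<eta> (s + real k * (T / real N)) \<omega>)" 1] rate by simp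
      then have "T / real N * (\<Sum>k<N. rate ?G (\<eta> (s + real k * (T / real N)) \<omega>)) \<le> T / real N * real N"
        using T by (intro mult_left_mono) auto
      then show ?thesis using elim(2) by (simp add: grid_sum_eq_compensated)
    qed
    have "grid_sum ?G s T N \<in> borel_measurable M"
      using s T by (intro borel_measurable_grid_sum[OF G]) auto
    then have meas: "{\<omega> \<in> space M. v \<le> grid_sum ?G s T N \<omega>} \<in> sets M"
      by measurable
    have "prob {\<omega> \<in> space M. v \<le> grid_sum ?G s T N \<omega>} \<le>
        expectation (\<lambda>\<omega>. exp (T - v) * exp (compensated ?G s (T / real N) N \<omega>))"
    proof (rule prob_le_expectation[OF integrable_mult_right[OF int] meas])
      fix \<omega>
      show "of_bool (v \<le> grid_sum ?G s T N \<omega>) \<le> exp (T - v) * exp (compensated ?G s (T / real N) N \<omega>)"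
        using le[of \<omega>] by (auto simp flip: exp_add)
    qed
    also have "\<dots> \<le> exp (T - v) * exp T"
      using elim(1) by simp
    also have "\<dots> = exp (2 * T - v)"
      by (simp flip: exp_add)
    finally show ?case .
  qed
qed

end

section \<open>Tail of the current\<close>

text \<open>The continuity equation for one exchange: weighted mass changes by the gradient of the
  weight times the current. As \<open>f\<close> vanishes at \<open>0\<close> and
  \<open>m + 1\<close>, exchanges across the edges of the window leave no boundary term.\<close>

lemma sum_conservation_exchange:
  fixes f :: "int \<Rightarrow> real"
  assumes f0: "\<And>z. z \<notin> {1..m} \<Longrightarrow> f z = 0"
  shows "(\<Sum>z\<in>{0..m+1}. f z * (of_bool (exchange x \<zeta> z) - of_bool (\<zeta> z))) =
    (\<Sum>y\<in>{0..m}. (f (y + 1) - f y) * bond_current y \<zeta> (exchange x \<zeta>))"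
proof -
  let ?d = "of_bool (\<zeta> x) - of_bool (\<zeta> (x + 1)) :: real"
  have "(\<Sum>z\<in>{0..m+1}. f z * (of_bool (exchange x \<zeta> z) - of_bool (\<zeta> z))) =
      (\<Sum>z\<in>{0..m+1}. (if z = x then - f x * ?d else 0) + (if z = x + 1 then f (x + 1) * ?d else 0))"
    by (intro sum.cong) (auto simp: exchange_def algebra_simps)
  also have "\<dots> = - f x * ?d + f (x + 1) * ?d"
    using f0[of x] f0[of "x + 1"] by (simp add: sum.distrib)
  finally have L: "(\<Sum>z\<in>{0..m+1}. f z * (of_bool (exchange x \<zeta> z) - of_bool (\<zeta> z))) = (f (x + 1) - f x) * ?d"
    by (simp add: algebra_simps)
  have "(\<Sum>y\<in>{0..m}. (f (y + 1) - f y) * bond_current y \<zeta> (exchange x \<zeta>)) =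
      (\<Sum>y\<in>{0..m}. if y = x then (f (x + 1) - f x) * ?d else 0)"
    by (intro sum.cong) (auto simp: bond_current_exchange)
  also have "\<dots> = (f (x + 1) - f x) * ?d"
    using f0[of x] f0[of "x + 1"] by (auto simp: sum.delta)
  finally show ?thesis using L by simp
qed

lemma sum_by_parts_int:
  fixes a x :: "int \<Rightarrow> real"
  assumes m: "0 \<le> m" and a0: "\<And>y. y \<notin> {0..m} \<Longrightarrow> a y = 0"
  shows "(\<Sum>y\<in>{0..m}. a y * (x y - x (y + 1))) = (\<Sum>z\<in>{0..m+1}. (a z - a (z - 1)) * x z)"
proof -
  have "(\<Sum>z\<in>{0..m+1}. a z * x z) = (\<Sum>z\<in>{0..m}. a z * x z)"
    by (rule sum.mono_neutral_right) (use a0 in auto)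
  moreover have "(\<Sum>z\<in>{0..m+1}. a (z - 1) * x z) = (\<Sum>z\<in>{1..m+1}. a (z - 1) * x z)"
    by (rule sum.mono_neutral_right) (use a0 m in auto)
  moreover have "(\<Sum>z\<in>{1..m+1}. a (z - 1) * x z) = (\<Sum>y\<in>{0..m}. a y * x (y + 1))"
    by (rule sum.reindex_bij_witness[of _ "\<lambda>y. y + 1" "\<lambda>z. z - 1"]) auto
  ultimately show ?thesis
    by (simp add: left_diff_distrib right_diff_distrib sum_subtractf)
qed

lemma sum_affine:
  fixes x f :: "int \<Rightarrow> real"
  shows "(\<Sum>z\<in>A. r * f z * (x z - p)) = r * (\<Sum>z\<in>A. f z * x z) - r * p * (\<Sum>z\<in>A. f z)"
  by (simp add: sum_distrib_left sum_subtractf[symmetric] algebra_simps)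

context stationary_ssep
begin

definition lin :: "int \<Rightarrow> (int \<Rightarrow> real) \<Rightarrow> config \<Rightarrow> real" where
  "lin m c \<zeta> = (\<Sum>z\<in>{0..m+1}. c z * (of_bool (\<zeta> z) - \<rho>))"

lemma depends_on_exp_lin: "depends_on {0..m+1} (\<lambda>\<zeta>. exp (lin m c \<zeta>))"
  unfolding lin_def by (rule depends_onI) (auto intro!: sum.cong)

lemma integrable_exp_lin:
  assumes "0 \<le> t"
  shows "integrable M (\<lambda>\<omega>. exp (lin m c (\<eta> t \<omega>)))"
proof -
  obtain C where C: "\<And>\<zeta>. \<bar>exp (lin m c \<zeta>)\<bar> \<le> C"
    using depends_on_bounded[OF _ depends_on_exp_lin] by blast
  show ?thesis
    by (rule integrable_bounded[OF borel_measurable_depends_on_process[OF _ depends_on_exp_lin assms] C]) simp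
qed

lemma expectation_exp_lin:
  assumes "0 \<le> t"
  shows "expectation (\<lambda>\<omega>. exp (lin m c (\<eta> t \<omega>))) \<le> exp ((\<Sum>z\<in>{0..m+1}. (c z)\<^sup>2) / 8)"
  unfolding lin_def using assms by (intro exp_moment_linear) auto

text \<open>Second-order expansion of the exponential, for which
  \<open>\<bar>\<theta> * a y\<bar> \<le> 1\<close> is required. The first-order term is a gradient
  of the configuration, and summation by parts moves the gradient onto the weight \<open>a\<close>.
  Centring by \<open>\<rho>\<close> is free because only differences of occupation numbers
  occur.\<close>

lemma rate_weighted_current_le:
  assumes m: "0 \<le> m" and a0: "\<And>y. y \<notin> {0..m} \<Longrightarrow> a y = 0" and \<theta>a: "\<And>y. \<bar>\<theta> * a y\<bar> \<le> 1"
  shows "rate (\<lambda>\<zeta> \<xi>. \<Sum>y\<in>{0..m}. \<theta> * a y * bond_current y \<zeta> \<xi>) \<zeta> \<le>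
    lin m (\<lambda>z. \<theta> / 2 * (a z - a (z - 1))) \<zeta> + \<theta>\<^sup>2 * (\<Sum>y\<in>{0..m}. (a y)\<^sup>2) / 2"
proof -
  define G where "G \<zeta> \<xi> = (\<Sum>y\<in>{0..m}. \<theta> * a y * bond_current y \<zeta> \<xi>)" for \<zeta> \<xi>
  let ?W = "{0..m+1}" and ?d = "\<lambda>x. of_bool (\<zeta> x) - of_bool (\<zeta> (x + 1)) :: real"
  have dep: "depends_on ?W (\<lambda>\<xi>. exp (G \<zeta> \<xi>))"
    unfolding G_def
    by (rule depends_onI) (auto intro!: sum.cong bond_kernels_cong)
  have sub: "{0..m} \<subseteq> bonds ?W" by (auto simp: bonds_def)
  have fin: "finite (bonds ?W)" by simp
  have "rate G \<zeta> = 1/2 * (\<Sum>x\<in>bonds ?W. exp (G \<zeta> (exchange x \<zeta>)) - exp (G \<zeta> \<zeta>))"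
    unfolding rate_def by (rule ssep_operator_depends_on[OF fin order_refl dep])
  also have "(\<Sum>x\<in>bonds ?W. exp (G \<zeta> (exchange x \<zeta>)) - exp (G \<zeta> \<zeta>)) \<le>
      (\<Sum>x\<in>bonds ?W. \<theta> * a x * ?d x + \<theta>\<^sup>2 * (a x)\<^sup>2)"
  proof (rule sum_mono)
    fix x
    have "G \<zeta> (exchange x \<zeta>) = (\<Sum>y\<in>{0..m}. if y = x then \<theta> * a x * ?d x else 0)"
      unfolding G_def by (intro sum.cong) (auto simp: bond_current_exchange)
    also have "\<dots> = \<theta> * a x * ?d x"
      using a0[of x] by (auto simp: sum.delta)
    finally have G: "G \<zeta> (exchange x \<zeta>) = \<theta> * a x * ?d x" .
    have d: "\<bar>?d x\<bar> \<le> 1" by auto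
    have "\<bar>\<theta> * a x * ?d x\<bar> \<le> 1"
      using mult_mono[OF \<theta>a[of x] d] by (simp add: abs_mult)
    then have "exp (\<theta> * a x * ?d x) \<le> 1 + \<theta> * a x * ?d x + (\<theta> * a x * ?d x)\<^sup>2"
      by (rule exp_le_quadratic)
    moreover have "(\<theta> * a x * ?d x)\<^sup>2 \<le> (\<theta> * a x)\<^sup>2"
      using d by (simp add: power_mult_distrib mult_left_le abs_square_le_1)
    ultimately have "exp (\<theta> * a x * ?d x) \<le> 1 + \<theta> * a x * ?d x + (\<theta> * a x)\<^sup>2" by linarith
    then show "exp (G \<zeta> (exchange x \<zeta>)) - exp (G \<zeta> \<zeta>) \<le> \<theta> * a x * ?d x + \<theta>\<^sup>2 * (a x)\<^sup>2"
      unfolding G by (simp add: G_def power_mult_distrib)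
  qed
  also have "(\<Sum>x\<in>bonds ?W. \<theta> * a x * ?d x + \<theta>\<^sup>2 * (a x)\<^sup>2) = (\<Sum>x\<in>{0..m}. \<theta> * a x * ?d x + \<theta>\<^sup>2 * (a x)\<^sup>2)"
    by (rule sum.mono_neutral_right[OF fin sub]) (use a0 in auto)
  also have "\<dots> = \<theta> * (\<Sum>x\<in>{0..m}. a x * ((of_bool (\<zeta> x) - \<rho>) - (of_bool (\<zeta> (x + 1)) - \<rho>))) + \<theta>\<^sup>2 * (\<Sum>x\<in>{0..m}. (a x)\<^sup>2)"
    by (simp add: sum.distrib sum_distrib_left mult.assoc)
  also have "(\<Sum>x\<in>{0..m}. a x * ((of_bool (\<zeta> x) - \<rho>) - (of_bool (\<zeta> (x + 1)) - \<rho>))) =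
      (\<Sum>z\<in>{0..m+1}. (a z - a (z - 1)) * (of_bool (\<zeta> z) - \<rho>))"
    by (rule sum_by_parts_int[OF m a0])
  also have "1/2 * (\<theta> * \<dots> + \<theta>\<^sup>2 * (\<Sum>x\<in>{0..m}. (a x)\<^sup>2)) =
      lin m (\<lambda>z. \<theta> / 2 * (a z - a (z - 1))) \<zeta> + \<theta>\<^sup>2 * (\<Sum>y\<in>{0..m}. (a y)\<^sup>2) / 2"
  proof -
    have "lin m (\<lambda>z. \<theta> / 2 * (a z - a (z - 1))) \<zeta> =
        \<theta> / 2 * (\<Sum>z\<in>{0..m+1}. (a z - a (z - 1)) * (of_bool (\<zeta> z) - \<rho>))"
      unfolding lin_def sum_distrib_left by (simp only: mult.assoc)
    then show ?thesis by (simp only:) (simp only: distrib_left mult.assoc times_divide_eq_left times_divide_eq_right mult_1)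
  qed
  finally show ?thesis by (simp add: G_def[abs_def])
qed

text \<open>Summation by parts turns \<open>f (y + 1) - f y = a y - of_bool (y = 0)\<close> into an expression of the
  current through the bond 0 by the \<open>a\<close>-average of the currents and the \<open>f\<close>-weighted mass.
  The former is a martingale plus a drift that only sees the gradient of \<open>a\<close>.\<close>

lemma current_tail_weights:
  fixes a f :: "int \<Rightarrow> real" and \<theta> v :: real
  assumes m: "0 \<le> m" and a0: "\<And>y. y \<notin> {0..m} \<Longrightarrow> a y = 0" and f0: "\<And>z. z \<notin> {1..m} \<Longrightarrow> f z = 0"
    and diff: "\<And>y. f (y + 1) - f y = a y - of_bool (y = 0)"
    and \<theta>a: "\<And>y. \<bar>\<theta> * a y\<bar> \<le> 1" and s: "0 \<le> s" and T: "0 < T"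
    and \<kappa>: "T * (\<theta>\<^sup>2 * (\<Sum>y\<in>{0..m}. (a y)\<^sup>2) / 2) \<le> \<kappa>"
    and A: "(\<Sum>z\<in>{0..m+1}. (T * (\<theta> / 2 * (a z - a (z - 1))))\<^sup>2) / 8 \<le> A"
    and B: "(\<Sum>z\<in>{0..m+1}. (\<theta> * f z)\<^sup>2) / 8 \<le> B"
  shows "prob {\<omega> \<in> space M. v \<le> \<theta> * (current (\<lambda>t. \<eta> t \<omega>) (s + T) - current (\<lambda>t. \<eta> t \<omega>) s)} \<le>
    exp ((\<kappa> - v) / 4) * ((1 + exp A + 2 * exp B) / 4)"
proof -
  define C where "C \<zeta> \<xi> = (\<Sum>z\<in>{0..m+1}. f z * (of_bool (\<xi> z) - of_bool (\<zeta> z)))" for \<zeta> \<xi> :: config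
  define K where "K \<zeta> \<xi> = (\<Sum>y\<in>{0..m}. (f (y + 1) - f y) * bond_current y \<zeta> \<xi>)" for \<zeta> \<xi> :: config
  \<comment> \<open>Conservation can fail over a cell containing several exchanges, for instance
    when one particle crosses two bonds. Such cells are counted instead of being excluded
    pathwise.\<close>
  define Bad :: "config \<Rightarrow> config \<Rightarrow> real" where "Bad \<zeta> \<xi> = of_bool (C \<zeta> \<xi> \<noteq> K \<zeta> \<xi>)" for \<zeta> \<xi>
  define G where "G \<zeta> \<xi> = (\<Sum>y\<in>{0..m}. \<theta> * a y * bond_current y \<zeta> \<xi>)" for \<zeta> \<xi> :: config
  define c where "c z = T * (\<theta> / 2 * (a z - a (z - 1)))" for z
  define J where "J = (\<lambda>\<omega>. current (\<lambda>t. \<eta> t \<omega>) (s + T) - current (\<lambda>t. \<eta> t \<omega>) s)"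
  let ?W = "{0..m+1}"
  have W: "finite ?W" by simp
  have CK: "C \<zeta> \<xi> = C \<zeta>' \<xi>'" "K \<zeta> \<xi> = K \<zeta>' \<xi>'" "G \<zeta> \<xi> = G \<zeta>' \<xi>'"
    if "\<And>x. x \<in> ?W \<Longrightarrow> \<zeta> x = \<zeta>' x" "\<And>x. x \<in> ?W \<Longrightarrow> \<xi> x = \<xi>' x" for \<zeta> \<zeta>' \<xi> \<xi>'
    unfolding C_def K_def G_def using that by (auto intro!: sum.cong bond_kernels_cong)
  have dG: "depends_on ?W G" "\<And>\<zeta>. depends_on ?W (G \<zeta>)"
    by (rule depends_on_kernelI, rule CK; simp)+
  have dB: "depends_on ?W Bad" "\<And>\<zeta>. depends_on ?W (Bad \<zeta>)"
  proof -
    have *: "Bad \<zeta> \<xi> = Bad \<zeta>' \<xi>'"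
      if "\<And>x. x \<in> ?W \<Longrightarrow> \<zeta> x = \<zeta>' x" "\<And>x. x \<in> ?W \<Longrightarrow> \<xi> x = \<xi>' x" for \<zeta> \<zeta>' \<xi> \<xi>'
      unfolding Bad_def using CK(1,2)[OF that] by simp
    show "depends_on ?W Bad" "\<And>\<zeta>. depends_on ?W (Bad \<zeta>)"
      by (rule depends_on_kernelI, rule *; simp)+
  qed
  have diag: "G \<zeta> \<zeta> = 0" "Bad \<zeta> \<zeta> = 0" for \<zeta>
    by (simp_all add: G_def Bad_def C_def K_def)
  \<comment> \<open>One exchange conserves mass, so bad cells have rate zero and the compensated sum
    of \<open>Bad\<close> is simply their number.\<close>
  have "Bad \<zeta> (exchange x \<zeta>) = 0" for x \<zeta>
    unfolding Bad_def C_def K_def using sum_conservation_exchange[where f = f and m = m and x = x and \<zeta> = \<zeta>, OF f0] by simp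
  then have rate_Bad: "rate Bad \<zeta> = 0" for \<zeta>
    by (simp add: rate_def ssep_operator_def diag)
  have rate_G: "T * rate G \<zeta> \<le> lin m c \<zeta> + \<kappa>" for \<zeta>
  proof -
    have "rate G \<zeta> \<le> lin m (\<lambda>z. \<theta> / 2 * (a z - a (z - 1))) \<zeta> + \<theta>\<^sup>2 * (\<Sum>y\<in>{0..m}. (a y)\<^sup>2) / 2"
      unfolding G_def[abs_def] by (rule rate_weighted_current_le[OF m a0 \<theta>a])
    then have "T * rate G \<zeta> \<le> T * (lin m (\<lambda>z. \<theta> / 2 * (a z - a (z - 1))) \<zeta> + \<theta>\<^sup>2 * (\<Sum>y\<in>{0..m}. (a y)\<^sup>2) / 2)"
      using T by (intro mult_left_mono) auto
    also have "\<dots> = lin m c \<zeta> + T * (\<theta>\<^sup>2 * (\<Sum>y\<in>{0..m}. (a y)\<^sup>2) / 2)"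
      by (simp add: lin_def c_def sum_distrib_left distrib_left mult.assoc)
    finally show ?thesis using \<kappa> by simp
  qed
  have bc0: "\<theta> * bond_current 0 \<zeta> \<xi> = G \<zeta> \<xi> - \<theta> * K \<zeta> \<xi>" for \<zeta> \<xi>
  proof -
    have "K \<zeta> \<xi> = (\<Sum>y\<in>{0..m}. a y * bond_current y \<zeta> \<xi>) - (\<Sum>y\<in>{0..m}. if y = 0 then bond_current 0 \<zeta> \<xi> else 0)"
      unfolding K_def sum_subtractf[symmetric] by (intro sum.cong) (auto simp: diff algebra_simps)
    also have "(\<Sum>y\<in>{0..m}. if y = 0 then bond_current 0 \<zeta> \<xi> else 0) = bond_current 0 \<zeta> \<xi>"
      using m by (simp add: sum.delta)
    finally have "\<theta> * K \<zeta> \<xi> = \<theta> * (\<Sum>y\<in>{0..m}. a y * bond_current y \<zeta> \<xi>) - \<theta> * bond_current 0 \<zeta> \<xi>"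
      by (simp add: right_diff_distrib)
    then show ?thesis by (simp add: G_def sum_distrib_left mult.assoc)
  qed
  \<comment> \<open>The weighted mass enters with opposite signs at the times \<open>s\<close> and
    \<open>s + T\<close>, so the centring constants of \<open>X3\<close> and \<open>X4\<close>
    cancel.\<close>
  define X3 where "X3 \<omega> = lin m (\<lambda>z. \<theta> * f z) (\<eta> s \<omega>)" for \<omega>
  define X4 where "X4 \<omega> = lin m (\<lambda>z. - \<theta> * f z) (\<eta> (s + T) \<omega>)" for \<omega>
  define X1 where "X1 N = compensated G s (T / real N) N" for N
  define X2 where "X2 N \<omega> = (\<Sum>k<N. lin m c (\<eta> (s + real k * (T / real N)) \<omega>)) / real N" for N \<omega>
  have decomposition: "\<theta> * grid_sum (bond_current 0) s T N \<omega> \<le> X1 N \<omega> + X2 N \<omega> + X3 \<omega> + X4 \<omega> + \<kappa>"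
    if N: "N > 0" and good: "\<And>k. k < N \<Longrightarrow> Bad (\<eta> (s + real k * (T / real N)) \<omega>) (\<eta> (s + real (Suc k) * (T / real N)) \<omega>) = 0"
    for N \<omega>
  proof -
    let ?g = "\<lambda>k. \<eta> (s + real k * (T / real N)) \<omega>"
    have "\<theta> * grid_sum (bond_current 0) s T N \<omega> = grid_sum G s T N \<omega> - \<theta> * (\<Sum>k<N. K (?g k) (?g (Suc k)))"
      unfolding grid_sum_def sum_distrib_left bc0 by (simp add: sum_subtractf)
    also have "(\<Sum>k<N. K (?g k) (?g (Suc k))) = (\<Sum>k<N. C (?g k) (?g (Suc k)))"
      using good by (intro sum.cong) (auto simp: Bad_def)
    also have "\<dots> = (\<Sum>k<N. (\<Sum>z\<in>?W. f z * of_bool (?g (Suc k) z)) - (\<Sum>z\<in>?W. f z * of_bool (?g k z)))"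
      by (simp add: C_def right_diff_distrib sum_subtractf)
    also have "\<dots> = (\<Sum>z\<in>?W. f z * of_bool (?g N z)) - (\<Sum>z\<in>?W. f z * of_bool (?g 0 z))"
      using sum_lessThan_telescope[of "\<lambda>k. \<Sum>z\<in>?W. f z * of_bool (?g k z)" N] by (simp only:)
    also have "\<theta> * \<dots> = - (X3 \<omega> + X4 \<omega>)"
    proof -
      have g: "?g N = \<eta> (s + T) \<omega>" "?g 0 = \<eta> s \<omega>" using N by simp_all
      have "\<theta> * (p - q) = - (\<theta> * q - \<theta> * \<rho> * r + (- \<theta> * p - - \<theta> * \<rho> * r))" for p q r :: real
        by (simp add: algebra_simps)
      then show ?thesis
        unfolding X3_def X4_def lin_def sum_affine g .
    qed
    also have "grid_sum G s T N \<omega> = X1 N \<omega> + (\<Sum>k<N. T * rate G (?g k)) / real N"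
      by (simp add: grid_sum_eq_compensated X1_def flip: sum_distrib_left)
    also have "(\<Sum>k<N. T * rate G (?g k)) / real N \<le> (\<Sum>k<N. lin m c (?g k) + \<kappa>) / real N"
      by (intro divide_right_mono sum_mono rate_G) simp
    also have "\<dots> = X2 N \<omega> + \<kappa>"
      using N by (simp add: X2_def sum.distrib add_divide_distrib)
    finally show ?thesis by simp
  qed
  \<comment> \<open>The slack \<open>\<epsilon>\<close> stays fixed while the grid is refined. It
    enters through the moment of the compensated \<open>G\<close> and through
    \<open>exp (T * \<epsilon>) - 1\<close>, which bounds the probability of a bad cell; both
    effects vanish when \<open>\<epsilon>\<close> tends to 0 at the end.\<close>
  have eps: "prob {\<omega> \<in> space M. v \<le> \<theta> * J \<omega>} \<le>
      (exp (T * \<epsilon>) - 1) + exp ((\<kappa> - v) / 4) * ((exp (T * \<epsilon>) + exp A + 2 * exp B) / 4)" (is "_ \<le> ?R \<epsilon>")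
    if \<epsilon>: "\<epsilon> > 0" for \<epsilon>
  proof (rule prob_ge_limit(2)[of "\<lambda>N \<omega>. \<theta> * grid_sum (bond_current 0) s T N \<omega>"])
    have gm: "grid_sum (bond_current 0) s T N \<in> borel_measurable M" for N
      using s T by (intro borel_measurable_grid_sum[OF _ depends_on_bond_current]) auto
    show ym: "(\<lambda>\<omega>. \<theta> * grid_sum (bond_current 0) s T N \<omega>) \<in> borel_measurable M" for N
      by (intro borel_measurable_times borel_measurable_const gm)
    show "\<forall>\<^sub>F N in sequentially. \<theta> * J \<omega> = \<theta> * grid_sum (bond_current 0) s T N \<omega>" if "\<omega> \<in> space M" for \<omega>
      using current_discretization[OF that s less_imp_le[OF T]] by eventually_elim (simp add: J_def)
    have "\<forall>\<^sub>F N in sequentially. expectation (\<lambda>\<omega>. exp (compensated G s (T / real N) N \<omega>)) \<le> exp (T * \<epsilon>)"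
      by (rule exp_compensated_eventually[OF W dG diag(1) s T \<epsilon>])
    moreover have "\<forall>\<^sub>F N in sequentially. expectation (\<lambda>\<omega>. exp (compensated Bad s (T / real N) N \<omega>)) \<le> exp (T * \<epsilon>)"
      by (rule exp_compensated_eventually[OF W dB diag(2) s T \<epsilon>])
    moreover have "\<forall>\<^sub>F N in sequentially. N > (0::nat)" by (rule eventually_gt_at_top)
    ultimately show "\<forall>\<^sub>F N in sequentially. prob {\<omega> \<in> space M. v \<le> \<theta> * grid_sum (bond_current 0) s T N \<omega>} \<le> ?R \<epsilon>"
    proof eventually_elim
      case (elim N)
      let ?g = "\<lambda>k \<omega>. \<eta> (s + real k * (T / real N)) \<omega>"
      \<comment> \<open>An integrable majorant of the event. If a cell is bad, \<open>exp\<close> of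
        the number of bad cells minus 1 is at least 1; otherwise \<open>decomposition\<close>
        applies and the second summand is the Chebyshev bound with the exponent divided by
        4.\<close>
      define Y where "Y \<omega> = (exp (compensated Bad s (T / real N) N \<omega>) - 1) + exp ((\<kappa> - v) / 4) *
        ((exp (X1 N \<omega>) + (\<Sum>k<N. exp (lin m c (?g k \<omega>))) / real N + exp (X3 \<omega>) + exp (X4 \<omega>)) / 4)" for \<omega>
      have iB: "integrable M (\<lambda>\<omega>. exp (compensated Bad s (T / real N) N \<omega>))"
        using s T by (intro integrable_exp_compensated[OF W dB]) auto
      have i1: "integrable M (\<lambda>\<omega>. exp (X1 N \<omega>))"
        unfolding X1_def using s T by (intro integrable_exp_compensated[OF W dG]) auto
      have i2: "integrable M (\<lambda>\<omega>. exp (lin m c (?g k \<omega>)))" for k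
        using s T by (intro integrable_exp_lin) simp
      have i34: "integrable M (\<lambda>\<omega>. exp (X3 \<omega>))" "integrable M (\<lambda>\<omega>. exp (X4 \<omega>))"
        unfolding X3_def X4_def using s T by (intro integrable_exp_lin; simp)+
      have iY: "integrable M Y"
        unfolding Y_def using iB i1 i2 i34 by simp
      have pw: "of_bool (v \<le> \<theta> * grid_sum (bond_current 0) s T N \<omega>) \<le> Y \<omega>" for \<omega>
      proof -
        have cB: "compensated Bad s (T / real N) N \<omega> = (\<Sum>k<N. Bad (?g k \<omega>) (?g (Suc k) \<omega>))"
          by (simp add: compensated_def rate_Bad)
        have Bad0: "Bad \<zeta> \<xi> \<ge> 0" for \<zeta> \<xi> by (simp add: Bad_def)
        have nn: "0 \<le> exp ((\<kappa> - v) / 4) * ((exp (X1 N \<omega>) + (\<Sum>k<N. exp (lin m c (?g k \<omega>))) / real N + exp (X3 \<omega>) + exp (X4 \<omega>)) / 4)"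
          by (intro mult_nonneg_nonneg divide_nonneg_nonneg add_nonneg_nonneg sum_nonneg) auto
        show ?thesis
        proof (cases "\<exists>k<N. Bad (?g k \<omega>) (?g (Suc k) \<omega>) \<noteq> 0")
          case True
          then obtain k where k: "k < N" "Bad (?g k \<omega>) (?g (Suc k) \<omega>) \<noteq> 0" by blast
          then have "Bad (?g k \<omega>) (?g (Suc k) \<omega>) = 1" by (simp add: Bad_def split: if_splits)
          then have "1 \<le> compensated Bad s (T / real N) N \<omega>"
            unfolding cB using member_le_sum[of k "{..<N}" "\<lambda>k. Bad (?g k \<omega>) (?g (Suc k) \<omega>)"] k(1) Bad0 by simp
          then have "1 \<le> exp (compensated Bad s (T / real N) N \<omega>) - 1"
            using exp_ge_add_one_self[of "compensated Bad s (T / real N) N \<omega>"] by linarith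
          then have "1 + 0 \<le> Y \<omega>" unfolding Y_def using nn by (rule add_mono)
          then show ?thesis by (simp add: of_bool_def)
        next
          case False
          then have good: "\<And>k. k < N \<Longrightarrow> Bad (?g k \<omega>) (?g (Suc k) \<omega>) = 0" by blast
          then have zero: "exp (compensated Bad s (T / real N) N \<omega>) - 1 = 0" unfolding cB by simp
          show ?thesis
          proof (cases "v \<le> \<theta> * grid_sum (bond_current 0) s T N \<omega>")
            case True
            then have "(v - \<kappa>) / 4 \<le> (X1 N \<omega> + X2 N \<omega> + X3 \<omega> + X4 \<omega>) / 4"
              using decomposition[OF elim(3) good] by simp
            then have "exp ((v - \<kappa>) / 4) \<le> exp ((X1 N \<omega> + X2 N \<omega> + X3 \<omega> + X4 \<omega>) / 4)" by simp
            also have "\<dots> \<le> (exp (X1 N \<omega>) + exp (X2 N \<omega>) + exp (X3 \<omega>) + exp (X4 \<omega>)) / 4"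
              by (rule exp_mean4_le)
            \<comment> \<open>Jensen for the average over the grid, after which stationarity is
              applied at each grid time separately.\<close>
            also have "exp (X2 N \<omega>) \<le> (\<Sum>k<N. exp (lin m c (?g k \<omega>))) / real N"
              unfolding X2_def by (rule exp_mean_le[OF elim(3)])
            finally have "exp ((v - \<kappa>) / 4) \<le>
              (exp (X1 N \<omega>) + (\<Sum>k<N. exp (lin m c (?g k \<omega>))) / real N + exp (X3 \<omega>) + exp (X4 \<omega>)) / 4" by simp
            then have "exp ((\<kappa> - v) / 4) * exp ((v - \<kappa>) / 4) \<le> Y \<omega>"
              unfolding Y_def zero by (simp add: mult_left_mono del: mult_le_cancel_left_pos)
            then show ?thesis using True by (simp flip: exp_add add: diff_divide_distrib)
          next
            case False
            then show ?thesis using nn zero by (simp add: Y_def)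
          qed
        qed
      qed
      have "{\<omega> \<in> space M. v \<le> \<theta> * grid_sum (bond_current 0) s T N \<omega>} \<in> sets M"
        using ym[of N] by measurable
      then have "prob {\<omega> \<in> space M. v \<le> \<theta> * grid_sum (bond_current 0) s T N \<omega>} \<le> expectation Y"
        by (rule prob_le_expectation[OF iY _ pw])
      also have "\<dots> = (expectation (\<lambda>\<omega>. exp (compensated Bad s (T / real N) N \<omega>)) - 1) + exp ((\<kappa> - v) / 4) *
          ((expectation (\<lambda>\<omega>. exp (X1 N \<omega>)) + (\<Sum>k<N. expectation (\<lambda>\<omega>. exp (lin m c (?g k \<omega>)))) / real N
            + expectation (\<lambda>\<omega>. exp (X3 \<omega>)) + expectation (\<lambda>\<omega>. exp (X4 \<omega>))) / 4)"
        unfolding Y_def using iB i1 i2 i34 by (simp add: prob_space)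
      also have "\<dots> \<le> (exp (T * \<epsilon>) - 1) + exp ((\<kappa> - v) / 4) * ((exp (T * \<epsilon>) + exp A + exp B + exp B) / 4)"
      proof (intro add_mono diff_mono mult_left_mono divide_right_mono)
        show "expectation (\<lambda>\<omega>. exp (X1 N \<omega>)) \<le> exp (T * \<epsilon>)" using elim(1) by (simp add: X1_def)
        have "(\<Sum>k<N. expectation (\<lambda>\<omega>. exp (lin m c (?g k \<omega>)))) \<le> (\<Sum>k<N. exp A)"
        proof (rule sum_mono)
          fix k
          have "expectation (\<lambda>\<omega>. exp (lin m c (?g k \<omega>))) \<le> exp ((\<Sum>z\<in>{0..m+1}. (c z)\<^sup>2) / 8)"
            using s T by (intro expectation_exp_lin) simp
          also have "\<dots> \<le> exp A" using A by (simp add: c_def)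
          finally show "expectation (\<lambda>\<omega>. exp (lin m c (?g k \<omega>))) \<le> exp A" .
        qed
        then show "(\<Sum>k<N. expectation (\<lambda>\<omega>. exp (lin m c (?g k \<omega>)))) / real N \<le> exp A"
          using elim(3) by (simp add: divide_le_eq mult.commute)
        have "expectation (\<lambda>\<omega>. exp (X3 \<omega>)) \<le> exp ((\<Sum>z\<in>{0..m+1}. (\<theta> * f z)\<^sup>2) / 8)"
          unfolding X3_def using s T by (intro expectation_exp_lin) simp
        also have "\<dots> \<le> exp B" using B by simp
        finally show "expectation (\<lambda>\<omega>. exp (X3 \<omega>)) \<le> exp B" .
        have "expectation (\<lambda>\<omega>. exp (X4 \<omega>)) \<le> exp ((\<Sum>z\<in>{0..m+1}. (- \<theta> * f z)\<^sup>2) / 8)"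
          unfolding X4_def using s T by (intro expectation_exp_lin) simp
        also have "\<dots> \<le> exp B" using B by simp
        finally show "expectation (\<lambda>\<omega>. exp (X4 \<omega>)) \<le> exp B" .
      qed (use elim(2) in auto)
      finally show ?case by (simp only: mult_2 add.assoc)
    qed
  qed
  have "((\<lambda>\<epsilon>. (exp (T * \<epsilon>) - 1) + exp ((\<kappa> - v) / 4) * ((exp (T * \<epsilon>) + exp A + 2 * exp B) / 4)) \<longlongrightarrow>
      (exp (T * 0) - 1) + exp ((\<kappa> - v) / 4) * ((exp (T * 0) + exp A + 2 * exp B) / 4)) (at_right 0)"
    by (intro tendsto_intros) simp
  then have "prob {\<omega> \<in> space M. v \<le> \<theta> * J \<omega>} \<le>
      (exp (T * 0) - 1) + exp ((\<kappa> - v) / 4) * ((exp (T * 0) + exp A + 2 * exp B) / 4)"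
  proof (rule tendsto_lowerbound)
    show "\<forall>\<^sub>F \<epsilon> in at_right 0. prob {\<omega> \<in> space M. v \<le> \<theta> * J \<omega>} \<le>
        (exp (T * \<epsilon>) - 1) + exp ((\<kappa> - v) / 4) * ((exp (T * \<epsilon>) + exp A + 2 * exp B) / 4)"
      using eventually_at_right_less[of "0::real"] by eventually_elim (rule eps)
  qed simp
  then show ?thesis by (simp add: J_def)
qed

end

section \<open>Triangular weights and their discrete potential\<close>

definition tent :: "nat \<Rightarrow> int \<Rightarrow> real" where
  "tent n y = max 0 (real n - \<bar>real_of_int y - real n\<bar>) / (real n)\<^sup>2"

text \<open>The discrete antiderivative of the weight minus a unit mass at bond 0. It vanishes
  beyond the support of the weight when the total mass is 1.\<close>

definition tent_potential :: "nat \<Rightarrow> int \<Rightarrow> real" where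
  "tent_potential n z = (if z \<le> 0 then 0 else (\<Sum>y\<in>{0..<z}. tent n y) - 1)"

lemma tent_nonneg: "0 \<le> tent n y"
  by (simp add: tent_def)

lemma tent_eq_0: "y \<notin> {0..2 * int n} \<Longrightarrow> tent n y = 0"
  by (auto simp: tent_def)

lemma tent_le: "tent n y \<le> 1 / real n"
proof -
  have "tent n y \<le> real n / (real n)\<^sup>2"
    unfolding tent_def by (intro divide_right_mono) auto
  then show ?thesis by (cases "n = 0") (simp_all add: power2_eq_square)
qed

text \<open>The slope of a triangle of height \<open>1 / n\<close> and half-width \<open>n\<close>.
  Over about \<open>2 * n\<close> sites the squares add up to order \<open>n powr (-3)\<close>, as
  the drift bound needs.\<close>

lemma abs_tent_diff_le: "\<bar>tent n z - tent n (z - 1)\<bar> \<le> 1 / (real n)\<^sup>2"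
proof -
  have "\<bar>max 0 (real n - \<bar>real_of_int z - real n\<bar>) - max 0 (real n - \<bar>real_of_int (z - 1) - real n\<bar>)\<bar> \<le> 1"
    by (simp add: max_def abs_if)
  then have "\<bar>max 0 (real n - \<bar>real_of_int z - real n\<bar>) - max 0 (real n - \<bar>real_of_int (z - 1) - real n\<bar>)\<bar> / (real n)\<^sup>2
      \<le> 1 / (real n)\<^sup>2"
    by (intro divide_right_mono) simp_all
  then show ?thesis
    unfolding tent_def diff_divide_distrib[symmetric] by simp
qed

text \<open>Raising \<open>n\<close> by one adds 1 at each of \<open>2 * n + 1\<close> sites and two
  end points of value 0, the step from one square to the next.\<close>

lemma sum_tent_centered: "(\<Sum>y\<in>{- int n..int n}. real n - \<bar>real_of_int y\<bar>) = (real n)\<^sup>2"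
proof (induction n)
  case (Suc n)
  have "{- int (Suc n)..int (Suc n)} = insert (- int (Suc n)) (insert (int (Suc n)) {- int n..int n})"
    by auto
  then have "(\<Sum>y\<in>{- int (Suc n)..int (Suc n)}. real (Suc n) - \<bar>real_of_int y\<bar>) =
      (\<Sum>y\<in>{- int n..int n}. real (Suc n) - \<bar>real_of_int y\<bar>)"
    by simp
  also have "\<dots> = (\<Sum>y\<in>{- int n..int n}. (real n - \<bar>real_of_int y\<bar>) + 1)"
    by (intro sum.cong) auto
  also have "\<dots> = (real n)\<^sup>2 + (2 * real n + 1)"
    unfolding sum.distrib Suc by simp
  finally show ?case by (simp add: power2_eq_square algebra_simps)
qed simp

lemma sum_tent:
  assumes "n > 0"
  shows "(\<Sum>y\<in>{0..2 * int n}. tent n y) = 1"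
proof -
  have "(\<Sum>y\<in>{0..2 * int n}. tent n y) = (\<Sum>y\<in>{- int n..int n}. (real n - \<bar>real_of_int y\<bar>) / (real n)\<^sup>2)"
    by (rule sum.reindex_bij_witness[of _ "\<lambda>y. y + int n" "\<lambda>y. y - int n"]) (auto simp: tent_def)
  then show ?thesis
    using assms by (simp add: sum_divide_distrib[symmetric] sum_tent_centered)
qed

lemma sum_tent_square:
  assumes "n > 0"
  shows "(\<Sum>y\<in>{0..2 * int n}. (tent n y)\<^sup>2) \<le> 1 / real n"
proof -
  have "(\<Sum>y\<in>{0..2 * int n}. (tent n y)\<^sup>2) \<le> (\<Sum>y\<in>{0..2 * int n}. 1 / real n * tent n y)"
    unfolding power2_eq_square by (intro sum_mono mult_right_mono tent_le tent_nonneg)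
  also have "\<dots> = 1 / real n"
    by (simp only: sum_distrib_left[symmetric] sum_tent[OF assms])
  finally show ?thesis .
qed

lemma tent_potential_diff: "tent_potential n (y + 1) - tent_potential n y = tent n y - of_bool (y = 0)"
proof -
  consider "y < 0" | "y = 0" | "0 < y" by linarith
  then show ?thesis
  proof cases
    case 1
    then show ?thesis using tent_eq_0[of y n] by (simp add: tent_potential_def)
  next
    case 2
    have "{0..<1::int} = {0}" by auto
    then show ?thesis using 2 by (simp add: tent_potential_def)
  next
    case 3
    then have "{0..<y + 1} = insert y {0..<y}" by auto
    then show ?thesis using 3 by (simp add: tent_potential_def)
  qed
qed

lemma tent_potential_eq_0:
  assumes "n > 0" "z \<notin> {1..2 * int n}"
  shows "tent_potential n z = 0"
proof (cases "z \<le> 0")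
  case False
  then have z: "2 * int n < z" using assms(2) by auto
  have "(\<Sum>y\<in>{0..<z}. tent n y) = (\<Sum>y\<in>{0..2 * int n}. tent n y)"
    by (rule sum.mono_neutral_right) (use z tent_eq_0 in auto)
  then show ?thesis using False sum_tent[OF assms(1)] by (simp add: tent_potential_def)
qed (simp add: tent_potential_def)

lemma abs_tent_potential_le:
  assumes "n > 0"
  shows "\<bar>tent_potential n z\<bar> \<le> 1"
proof (cases "z \<in> {1..2 * int n}")
  case True
  have "(\<Sum>y\<in>{0..<z}. tent n y) \<le> (\<Sum>y\<in>{0..2 * int n}. tent n y)"
    by (rule sum_mono2) (use True tent_nonneg in auto)
  then have "(\<Sum>y\<in>{0..<z}. tent n y) \<le> 1" by (simp add: sum_tent[OF assms])
  moreover have "0 \<le> (\<Sum>y\<in>{0..<z}. tent n y)" by (intro sum_nonneg tent_nonneg)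
  ultimately show ?thesis by (auto simp: tent_potential_def)
qed (simp add: tent_potential_eq_0[OF assms])

context stationary_ssep
begin

text \<open>The choice \<open>n \<approx> sqrt T\<close> balances the fluctuation \<open>sqrt n\<close> of the weighted mass, the standard deviation
  \<open>sqrt (T / n)\<close> of the martingale and the size \<open>T * n powr (-3/2)\<close> of the drift: all are of order \<open>T powr (1/4)\<close>.\<close>

lemma current_tail_one_sided:
  assumes s: "0 \<le> s" and T: "1 \<le> T" and \<theta>: "\<theta>\<^sup>2 = 1 / sqrt T"
  shows "prob {\<omega> \<in> space M. v \<le> \<theta> * (current (\<lambda>t. \<eta> t \<omega>) (s + T) - current (\<lambda>t. \<eta> t \<omega>) s)} \<le> 8 * exp (- v / 4)"
proof -
  define q where "q = sqrt T"
  have q: "1 \<le> q" "T = q\<^sup>2" "\<theta>\<^sup>2 = 1 / q" using T \<theta> by (simp_all add: q_def)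
  \<comment> \<open>Rounding \<open>q\<close> up keeps \<open>n\<close> within a factor 2 of it, as
    \<open>1 \<le> q\<close>.\<close>
  define n where "n = nat \<lceil>q\<rceil>"
  have n: "q \<le> real n" "real n \<le> 2 * q" "n > 0"
    using q(1) unfolding n_def by linarith+
  let ?m = "2 * int n" and ?a = "tent n" and ?f = "tent_potential n"
  have \<theta>1: "\<bar>\<theta>\<bar> \<le> 1"
  proof -
    have "\<theta>\<^sup>2 \<le> 1" using q by simp
    then show ?thesis by (simp add: abs_square_le_1)
  qed
  have \<theta>a: "\<bar>\<theta> * ?a y\<bar> \<le> 1" for y
  proof -
    have "1 / real n \<le> 1" using n(3) by simp
    then have "?a y \<le> 1" using tent_le[of n y] by linarith
    then show ?thesis using mult_mono[OF \<theta>1, of "?a y" 1] tent_nonneg[of n y] by (simp add: abs_mult)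
  qed
  have \<kappa>: "T * (\<theta>\<^sup>2 * (\<Sum>y\<in>{0..?m}. (?a y)\<^sup>2) / 2) \<le> 1"
  proof -
    have "T * (\<theta>\<^sup>2 * (\<Sum>y\<in>{0..?m}. (?a y)\<^sup>2) / 2) = q / 2 * (\<Sum>y\<in>{0..?m}. (?a y)\<^sup>2)"
      using q by (simp add: power2_eq_square)
    also have "\<dots> \<le> q / 2 * (1 / real n)"
      using q by (intro mult_left_mono sum_tent_square n) simp
    also have "\<dots> \<le> 1" using n q by (simp add: divide_le_eq)
    finally show ?thesis .
  qed
  have count: "real (card {0..?m + 1}) \<le> 4 * real n"
    using n by simp
  have A: "(\<Sum>z\<in>{0..?m + 1}. (T * (\<theta> / 2 * (?a z - ?a (z - 1))))\<^sup>2) / 8 \<le> 1"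
  proof -
    have "(T * (\<theta> / 2 * (?a z - ?a (z - 1))))\<^sup>2 \<le> q ^ 3 / 4 * (1 / (real n) ^ 4)" for z
    proof -
      have "q ^ 4 = q ^ 3 * q" by (simp add: eval_nat_numeral)
      then have T\<theta>: "T\<^sup>2 * \<theta>\<^sup>2 = q ^ 3" using q by simp
      have "(?a z - ?a (z - 1))\<^sup>2 \<le> (1 / (real n)\<^sup>2)\<^sup>2"
        using abs_tent_diff_le[of n z] by (intro abs_le_square_iff[THEN iffD1]) simp
      then have sq: "(?a z - ?a (z - 1))\<^sup>2 \<le> 1 / (real n) ^ 4" by (simp add: power_divide)
      have "(T * (\<theta> / 2 * (?a z - ?a (z - 1))))\<^sup>2 = T\<^sup>2 * \<theta>\<^sup>2 / 4 * (?a z - ?a (z - 1))\<^sup>2"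
        by (simp add: power_mult_distrib power_divide)
      also have "\<dots> = q ^ 3 / 4 * (?a z - ?a (z - 1))\<^sup>2" by (simp only: T\<theta>)
      also have "\<dots> \<le> q ^ 3 / 4 * (1 / (real n) ^ 4)"
        using q(1) by (intro mult_left_mono sq) simp
      finally show ?thesis .
    qed
    then have "(\<Sum>z\<in>{0..?m + 1}. (T * (\<theta> / 2 * (?a z - ?a (z - 1))))\<^sup>2) \<le>
        real (card {0..?m + 1}) * (q ^ 3 / 4 * (1 / (real n) ^ 4))"
      by (intro sum_bounded_above)
    also have "\<dots> \<le> 4 * real n * (q ^ 3 / 4 * (1 / (real n) ^ 4))"
      using q by (intro mult_right_mono count) simp
    also have "\<dots> = q ^ 3 / (real n) ^ 3"
      using n by (simp add: eval_nat_numeral)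
    also have "\<dots> \<le> 1"
      using n q by (simp add: power_mono)
    finally show ?thesis by simp
  qed
  have B: "(\<Sum>z\<in>{0..?m + 1}. (\<theta> * ?f z)\<^sup>2) / 8 \<le> 1"
  proof -
    have "(\<theta> * ?f z)\<^sup>2 \<le> 1 / q" for z
    proof -
      have "(?f z)\<^sup>2 \<le> 1"
        using abs_tent_potential_le[OF n(3), of z] by (simp add: abs_square_le_1)
      then show ?thesis
        using q mult_left_mono[of "(?f z)\<^sup>2" 1 "1 / q"] by (simp add: power_mult_distrib)
    qed
    then have "(\<Sum>z\<in>{0..?m + 1}. (\<theta> * ?f z)\<^sup>2) \<le> real (card {0..?m + 1}) * (1 / q)"
      by (intro sum_bounded_above)
    also have "\<dots> \<le> 4 * real n * (1 / q)"
      using q by (intro mult_right_mono count) simp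
    also have "\<dots> \<le> 8" using n q by (simp add: divide_le_eq)
    finally show ?thesis by simp
  qed
  have "prob {\<omega> \<in> space M. v \<le> \<theta> * (current (\<lambda>t. \<eta> t \<omega>) (s + T) - current (\<lambda>t. \<eta> t \<omega>) s)} \<le>
      exp ((1 - v) / 4) * ((1 + exp 1 + 2 * exp 1) / 4)"
    by (rule current_tail_weights[OF _ tent_eq_0 tent_potential_eq_0[OF n(3)] tent_potential_diff \<theta>a s _ \<kappa> A B])
       (use T in simp_all)
  also have "\<dots> = exp (- v / 4) * (exp (1 / 4) * ((1 + exp 1 + 2 * exp 1) / 4))"
  proof -
    have "exp ((1 - v) / 4) = exp (- v / 4) * exp (1 / 4)"
      by (simp add: diff_divide_distrib flip: exp_add)
    then show ?thesis by (simp only: mult.assoc)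
  qed
  \<comment> \<open>Both exponentials are bounded by 3, which gives the constant
    \<open>3 * 10 / 4\<close>, below 8.\<close>
  also have "\<dots> \<le> exp (- v / 4) * (3 * ((1 + 3 + 2 * 3) / 4))"
  proof (intro mult_left_mono mult_mono divide_right_mono add_mono exp_le order_refl)
    have "exp (1 / 4) \<le> exp (1::real)" by simp
    then show "exp (1 / 4 :: real) \<le> 3" using exp_le by linarith
  qed simp_all
  also have "\<dots> \<le> 8 * exp (- v / 4)" by simp
  finally show ?thesis .
qed

text \<open>The one-sided bound fixes only the square of \<open>\<theta>\<close>, so both signs of
  \<open>T powr (- (1/4))\<close> are admissible and the two bounds add up to the factor 16.\<close>

lemma current_tail:
  assumes s: "0 \<le> s" and T: "1 \<le> T"
  shows "prob {\<omega> \<in> space M. u \<le> \<bar>current (\<lambda>t. \<eta> t \<omega>) (s + T) - current (\<lambda>t. \<eta> t \<omega>) s\<bar>} \<le>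
    16 * exp (- (u / (4 * T powr (1/4))))"
proof -
  define \<theta> where "\<theta> = T powr (- (1/4))"
  let ?J = "\<lambda>\<omega>. current (\<lambda>t. \<eta> t \<omega>) (s + T) - current (\<lambda>t. \<eta> t \<omega>) s"
  have "\<theta>\<^sup>2 = T powr (- (1/2))"
    using T by (simp add: \<theta>_def power2_eq_square flip: powr_add)
  then have \<theta>: "\<theta>\<^sup>2 = 1 / sqrt T"
    using T by (simp add: powr_minus_divide powr_half_sqrt)
  have \<theta>0: "\<theta> > 0" using T by (simp add: \<theta>_def)
  have Jm: "?J \<in> borel_measurable M"
    using s T by (intro borel_measurable_current_diff) auto
  let ?A = "\<lambda>c. {\<omega> \<in> space M. \<theta> * u \<le> c * ?J \<omega>}"
  have A: "?A c \<in> sets M" for c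
    using Jm by measurable
  have "{\<omega> \<in> space M. u \<le> \<bar>?J \<omega>\<bar>} \<subseteq> ?A \<theta> \<union> ?A (- \<theta>)"
  proof
    fix \<omega> assume "\<omega> \<in> {\<omega> \<in> space M. u \<le> \<bar>?J \<omega>\<bar>}"
    then have \<omega>: "\<omega> \<in> space M" "\<theta> * u \<le> \<theta> * \<bar>?J \<omega>\<bar>"
      using \<theta>0 by (auto intro: mult_left_mono)
    have "\<theta> * \<bar>j\<bar> = \<theta> * j \<or> \<theta> * \<bar>j\<bar> = - \<theta> * j" for j
      by (cases "j \<ge> 0") simp_all
    from this[of "?J \<omega>"] have "\<theta> * u \<le> \<theta> * ?J \<omega> \<or> \<theta> * u \<le> - \<theta> * ?J \<omega>"
      using \<omega>(2) by (elim disjE) (simp_all only: simp_thms)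
    then show "\<omega> \<in> ?A \<theta> \<union> ?A (- \<theta>)" using \<omega>(1) by blast
  qed
  then have "prob {\<omega> \<in> space M. u \<le> \<bar>?J \<omega>\<bar>} \<le> prob (?A \<theta> \<union> ?A (- \<theta>))"
    by (rule finite_measure_mono) (intro sets.Un A)
  also have "\<dots> \<le> prob (?A \<theta>) + prob (?A (- \<theta>))"
    by (rule measure_Un_le[OF A A])
  also have "\<dots> \<le> 8 * exp (- (\<theta> * u) / 4) + 8 * exp (- (\<theta> * u) / 4)"
    by (intro add_mono current_tail_one_sided[OF s T]) (use \<theta> in auto)
  also have "\<theta> * u = u / T powr (1/4)"
    by (simp add: \<theta>_def powr_minus_divide)
  finally show ?thesis by (simp add: mult.commute)
qed

end

section \<open>Compact sets of Hoelder functions\<close>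

text \<open>Concavity in the form \<open>z \<le> z powr \<gamma>\<close> on the unit interval,
  applied to the fractions \<open>x / (x + y)\<close> and \<open>y / (x + y)\<close>.\<close>

lemma powr_add_le:
  fixes x y \<gamma> :: real
  assumes "0 \<le> x" "0 \<le> y" "0 < \<gamma>" "\<gamma> \<le> 1"
  shows "(x + y) powr \<gamma> \<le> x powr \<gamma> + y powr \<gamma>"
proof (cases "x + y = 0")
  case False
  then have s: "x + y > 0" using assms by simp
  have *: "z * (x + y) powr \<gamma> \<le> (z * (x + y)) powr \<gamma>" if "0 \<le> z" "z \<le> 1" for z
  proof -
    have "z powr 1 \<le> z powr \<gamma>" using that assms powr_mono'[of \<gamma> 1 z] by (cases "z = 0") simp_all
    then have "z * (x + y) powr \<gamma> \<le> z powr \<gamma> * (x + y) powr \<gamma>"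
      using that by (intro mult_right_mono) auto
    then show ?thesis using that s by (simp add: powr_mult)
  qed
  have "(x + y) powr \<gamma> = x / (x + y) * (x + y) powr \<gamma> + y / (x + y) * (x + y) powr \<gamma>"
    using s by (simp add: distrib_right[symmetric] add_divide_distrib[symmetric])
  also have "\<dots> \<le> (x / (x + y) * (x + y)) powr \<gamma> + (y / (x + y) * (x + y)) powr \<gamma>"
    using assms s by (intro add_mono *) auto
  also have "\<dots> = x powr \<gamma> + y powr \<gamma>"
    using s by simp
  finally show ?thesis .
next
  case True
  then have "x = 0" "y = 0" using assms by auto
  then show ?thesis by simp
qed

text \<open>McShane's extension: \<open>\<bar>s - t\<bar> powr \<gamma>\<close> satisfies the
  triangle inequality, so the lower envelope of the cones over the data is Hoelder with the same
  constant. Finiteness of \<open>A\<close> makes the infimum a minimum.\<close>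

lemma hoelder_extension:
  fixes x :: "real \<Rightarrow> real"
  assumes A: "finite A" "A \<noteq> {}" and C: "0 \<le> C" and \<gamma>: "0 < \<gamma>" "\<gamma> \<le> 1"
    and x: "\<And>a b. a \<in> A \<Longrightarrow> b \<in> A \<Longrightarrow> \<bar>x a - x b\<bar> \<le> C * \<bar>a - b\<bar> powr \<gamma>"
  obtains f where "\<And>a. a \<in> A \<Longrightarrow> f a = x a" "\<And>s t. \<bar>f s - f t\<bar> \<le> C * \<bar>s - t\<bar> powr \<gamma>"
proof -
  define f where "f t = Min ((\<lambda>a. x a + C * \<bar>t - a\<bar> powr \<gamma>) ` A)" for t
  have le: "f t \<le> x a + C * \<bar>t - a\<bar> powr \<gamma>" if "a \<in> A" for a t
    unfolding f_def using A that by (intro Min_le) auto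
  have att: "\<exists>a\<in>A. f t = x a + C * \<bar>t - a\<bar> powr \<gamma>" for t
  proof -
    have "f t \<in> (\<lambda>a. x a + C * \<bar>t - a\<bar> powr \<gamma>) ` A"
      unfolding f_def using A by (intro Min_in) auto
    then show ?thesis by blast
  qed
  have one: "f s \<le> f t + C * \<bar>s - t\<bar> powr \<gamma>" for s t
  proof -
    obtain a where a: "a \<in> A" "f t = x a + C * \<bar>t - a\<bar> powr \<gamma>" using att by blast
    have "\<bar>s - a\<bar> powr \<gamma> \<le> (\<bar>s - t\<bar> + \<bar>t - a\<bar>) powr \<gamma>"
      using \<gamma> by (intro powr_mono2) auto
    also have "\<dots> \<le> \<bar>s - t\<bar> powr \<gamma> + \<bar>t - a\<bar> powr \<gamma>"
      using \<gamma> by (intro powr_add_le) auto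
    finally have "C * \<bar>s - a\<bar> powr \<gamma> \<le> C * (\<bar>s - t\<bar> powr \<gamma> + \<bar>t - a\<bar> powr \<gamma>)"
      using C by (intro mult_left_mono)
    then show ?thesis using le[OF a(1), of s] a(2) by (simp add: distrib_left)
  qed
  show thesis
  proof (rule that)
    fix a assume a: "a \<in> A"
    obtain b where b: "b \<in> A" "f a = x b + C * \<bar>a - b\<bar> powr \<gamma>" using att by blast
    have "x a \<le> f a" using x[OF a b(1)] b(2) by simp
    moreover have "f a \<le> x a" using le[OF a, of a] by simp
    ultimately show "f a = x a" by simp
  next
    fix s t
    show "\<bar>f s - f t\<bar> \<le> C * \<bar>s - t\<bar> powr \<gamma>"
      using one[of s t] one[of t s] by (simp add: abs_minus_commute abs_le_iff)
  qed
qed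

lemma dist_D01_uniform_le:
  assumes "f \<in> cadlag01" "g \<in> cadlag01" "\<And>t. t \<in> {0..1} \<Longrightarrow> \<bar>f t - g t\<bar> \<le> a"
  shows "mdist D01_uniform f g \<le> a"
proof -
  have sp: "h \<in> Met_TC.fspace {0..1}" if "h \<in> cadlag01" for h
    using that mspace_D01_uniform by (auto simp: D01_uniform_def)
  have "Met_TC.fdist {0..1} f g \<le> a"
    using assms(3) by (subst Met_TC.funspace_mdist_le[OF sp[OF assms(1)] sp[OF assms(2)]]) (auto simp: dist_real_def)
  then show ?thesis by (simp add: D01_uniform_def)
qed

text \<open>Fixing the value at 0 bounds all members by \<open>C\<close> when \<open>C\<close> is
  nonnegative, as equicontinuity alone would not.\<close>

definition hoelder_ball :: "real \<Rightarrow> (real \<Rightarrow> real) set" where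
  "hoelder_ball C = {f \<in> extensional {0..1}. f 0 = 0 \<and>
     (\<forall>s\<in>{0..1}. \<forall>t\<in>{0..1}. \<bar>f s - f t\<bar> \<le> C * \<bar>s - t\<bar> powr (1/8))}"

lemma hoelder_ballD:
  assumes "f \<in> hoelder_ball C"
  shows "f 0 = 0" "s \<in> {0..1} \<Longrightarrow> t \<in> {0..1} \<Longrightarrow> \<bar>f s - f t\<bar> \<le> C * \<bar>s - t\<bar> powr (1/8)"
  using assms unfolding hoelder_ball_def by blast+

lemma tendsto_hoelder_modulus: "((\<lambda>t. C * \<bar>s - t\<bar> powr (1/8)) \<longlongrightarrow> (0::real)) (at s within S)"
proof -
  have "((\<lambda>t. C * \<bar>s - t\<bar> powr (1/8)) \<longlongrightarrow> C * \<bar>s - s\<bar> powr (1/8)) (at s within S)"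
    by (intro tendsto_intros tendsto_powr2) auto
  then show ?thesis by simp
qed

lemma hoelder_imp_continuous_on:
  fixes f :: "real \<Rightarrow> real"
  assumes "\<And>s t. s \<in> S \<Longrightarrow> t \<in> S \<Longrightarrow> \<bar>f s - f t\<bar> \<le> C * \<bar>s - t\<bar> powr (1/8)"
  shows "continuous_on S f"
  unfolding continuous_on_def
proof
  fix s assume s: "s \<in> S"
  show "(f \<longlongrightarrow> f s) (at s within S)"
  proof (rule LIM_zero_cancel, rule tendsto_0_le[OF tendsto_hoelder_modulus[of C s S], of _ 1])
    show "\<forall>\<^sub>F t in at s within S. norm (f t - f s) \<le> norm (C * \<bar>s - t\<bar> powr (1/8)) * 1"
      unfolding eventually_at_filter
    proof (intro always_eventually allI impI)
      fix t assume "t \<in> S"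
      from assms[OF this s] show "norm (f t - f s) \<le> norm (C * \<bar>s - t\<bar> powr (1/8)) * 1"
        by (simp add: abs_minus_commute)
    qed
  qed
qed

lemma continuous_imp_cadlag01:
  assumes "f \<in> extensional {0..1}" "continuous_on {0..1} f"
  shows "f \<in> cadlag01"
proof -
  have lim: "(f \<longlongrightarrow> f t) (at t within {0..1})" if "t \<in> {0..1}" for t
    using assms(2) that by (simp add: continuous_on_def)
  have "(f \<longlongrightarrow> f t) (at_right t)" if "t \<in> {0..<1}" for t
  proof -
    have "at t within {t..1} \<le> at t within {0..1}"
      using that by (intro at_le) auto
    then have "(f \<longlongrightarrow> f t) (at t within {t..1})"
      using lim[of t] that by (auto intro: tendsto_mono)
    then show ?thesis
      using that by (simp add: at_within_Icc_at_right)
  qed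
  moreover have "(f \<longlongrightarrow> f t) (at_left t)" if "t \<in> {0<..1}" for t
  proof -
    have "at t within {0..t} \<le> at t within {0..1}"
      using that by (intro at_le) auto
    then have "(f \<longlongrightarrow> f t) (at t within {0..t})"
      using lim[of t] that by (auto intro: tendsto_mono)
    then show ?thesis
      using that by (simp add: at_within_Icc_at_left)
  qed
  ultimately show ?thesis
    using assms(1) unfolding cadlag01_def by blast
qed

lemma hoelder_ball_continuous: "f \<in> hoelder_ball C \<Longrightarrow> continuous_on {0..1} f"
  by (rule hoelder_imp_continuous_on[of _ _ C]) (auto simp: hoelder_ball_def)

lemma hoelder_ball_subset: "hoelder_ball C \<subseteq> cadlag01"
  using continuous_imp_cadlag01 hoelder_ball_continuous by (auto simp: hoelder_ball_def)

text \<open>Arzela-Ascoli: the Hoelder bound passes to limits, and uniform convergence on the unit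
  interval is convergence in the metric.\<close>

lemma compactin_hoelder_ball:
  assumes C: "0 \<le> C"
  shows "compactin (mtopology_of D01_uniform) (hoelder_ball C)"
proof -
  interpret D: Metric_space cadlag01 "mdist D01_uniform"
    using Metric_space_mspace_mdist[of D01_uniform] unfolding mspace_D01_uniform .
  have "compactin D.mtopology (hoelder_ball C)"
    unfolding D.compactin_sequentially
  proof (intro conjI allI impI)
    fix \<sigma> :: "nat \<Rightarrow> real \<Rightarrow> real" assume "range \<sigma> \<subseteq> hoelder_ball C"
    then have \<sigma>: "\<sigma> n \<in> hoelder_ball C" for n by blast
    have bound: "norm (\<sigma> n t) \<le> C" if "t \<in> {0..1}" for n t
    proof -
      have "\<bar>\<sigma> n t - \<sigma> n 0\<bar> \<le> C * \<bar>t - 0\<bar> powr (1/8)" "\<sigma> n 0 = 0"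
        using hoelder_ballD(2)[OF \<sigma> that, of 0] hoelder_ballD(1)[OF \<sigma>] by simp_all
      moreover have "C * \<bar>t - 0\<bar> powr (1/8) \<le> C * 1"
        using that C by (intro mult_left_mono powr_le1) auto
      ultimately show ?thesis by simp
    qed
    have equi: "\<exists>d. 0 < d \<and> (\<forall>n t. t \<in> {0..1} \<and> norm (s - t) < d \<longrightarrow> norm (\<sigma> n s - \<sigma> n t) < e)"
      if s: "s \<in> {0..1}" and e: "0 < e" for s e
    proof -
      have "\<forall>\<^sub>F t in at s. C * \<bar>s - t\<bar> powr (1/8) < e"
        using tendsto_hoelder_modulus e by (rule order_tendstoD)
      then obtain d where d: "d > 0" "\<And>t. t \<noteq> s \<Longrightarrow> dist t s < d \<Longrightarrow> C * \<bar>s - t\<bar> powr (1/8) < e"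
        unfolding eventually_at by auto
      have "norm (\<sigma> n s - \<sigma> n t) < e" if t: "t \<in> {0..1}" "norm (s - t) < d" for n t
      proof (cases "t = s")
        case False
        have "\<bar>\<sigma> n s - \<sigma> n t\<bar> \<le> C * \<bar>s - t\<bar> powr (1/8)"
          using \<sigma>[of n] s t(1) unfolding hoelder_ball_def by blast
        then show ?thesis using d(2)[OF False] t(2) by (simp add: dist_real_def abs_minus_commute)
      qed (use e in simp)
      then show ?thesis using d(1) by blast
    qed
    obtain g k where g: "strict_mono (k :: nat \<Rightarrow> nat)"
        "\<And>e. 0 < e \<Longrightarrow> \<exists>N. \<forall>n t. n \<ge> N \<and> t \<in> {0..1} \<longrightarrow> norm (\<sigma> (k n) t - g t) < e"
      by (rule Arzela_Ascoli[of "{0..1::real}" \<sigma> C]) (use bound equi in \<open>blast+\<close>)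
    \<comment> \<open>Members of the space are extensional, so the limit has to be cut off outside
      the unit interval.\<close>
    define l where "l = restrict g {0..1}"
    have lim: "(\<lambda>n. \<sigma> (k n) t) \<longlonglongrightarrow> l t" if t: "t \<in> {0..1}" for t
    proof (rule LIMSEQ_I)
      fix e :: real assume "0 < e"
      from g(2)[OF this] show "\<exists>N. \<forall>n\<ge>N. norm (\<sigma> (k n) t - l t) < e"
        using t unfolding l_def by (simp only: restrict_apply' if_True) blast
    qed
    have l: "l \<in> hoelder_ball C"
      unfolding hoelder_ball_def
    proof (intro CollectI conjI ballI)
      show "l \<in> extensional {0..1}" by (simp add: l_def)
      have "\<sigma> (k n) 0 = 0" for n using \<sigma>[of "k n"] unfolding hoelder_ball_def by blast
      then show "l 0 = 0" using lim[of 0] by (simp add: LIMSEQ_const_iff)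
      fix s t :: real assume st: "s \<in> {0..1}" "t \<in> {0..1}"
      have "(\<lambda>n. \<bar>\<sigma> (k n) s - \<sigma> (k n) t\<bar>) \<longlonglongrightarrow> \<bar>l s - l t\<bar>"
        by (intro tendsto_intros lim st)
      moreover have "\<bar>\<sigma> (k n) s - \<sigma> (k n) t\<bar> \<le> C * \<bar>s - t\<bar> powr (1/8)" for n
        using \<sigma>[of "k n"] st unfolding hoelder_ball_def by blast
      ultimately show "\<bar>l s - l t\<bar> \<le> C * \<bar>s - t\<bar> powr (1/8)"
        by (intro LIMSEQ_le_const2) auto
    qed
    have "limitin D.mtopology (\<sigma> \<circ> k) l sequentially"
      unfolding D.limit_metric_sequentially
    proof (intro conjI allI impI)
      show "l \<in> cadlag01" using l hoelder_ball_subset by blast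
      fix e :: real assume e: "0 < e"
      then obtain N where N: "\<forall>n t. n \<ge> N \<and> t \<in> {0..1} \<longrightarrow> norm (\<sigma> (k n) t - g t) < e / 2"
        using g(2)[of "e / 2"] by auto
      show "\<exists>N. \<forall>n\<ge>N. (\<sigma> \<circ> k) n \<in> cadlag01 \<and> mdist D01_uniform ((\<sigma> \<circ> k) n) l < e"
      proof (intro exI[of _ N] allI impI conjI)
        fix n assume n: "N \<le> n"
        show "(\<sigma> \<circ> k) n \<in> cadlag01" using \<sigma>[of "k n"] hoelder_ball_subset by auto
        have "mdist D01_uniform ((\<sigma> \<circ> k) n) l \<le> e / 2"
        proof (rule dist_D01_uniform_le)
          show "(\<sigma> \<circ> k) n \<in> cadlag01" "l \<in> cadlag01"
            using \<sigma>[of "k n"] l hoelder_ball_subset by auto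
          fix t :: real assume t: "t \<in> {0..1}"
          then have "norm (\<sigma> (k n) t - g t) < e / 2" using N n by blast
          then show "\<bar>(\<sigma> \<circ> k) n t - l t\<bar> \<le> e / 2" using t by (simp add: l_def)
        qed
        then show "mdist D01_uniform ((\<sigma> \<circ> k) n) l < e" using e by simp
      qed
    qed
    then show "\<exists>l r. l \<in> hoelder_ball C \<and> strict_mono r \<and> limitin D.mtopology (\<sigma> \<circ> r) l sequentially"
      using l g(1) by blast
  qed (rule hoelder_ball_subset)
  then show ?thesis
    unfolding mtopology_of_def mspace_D01_uniform .
qed

section \<open>Chaining\<close>

abbreviation dyadic_ratio :: real ("\<beta>") where
  "\<beta> \<equiv> 2 powr (- (1/8))"

text \<open>Two chains of ancestors of geometric length \<open>\<beta> / (1 - \<beta>)\<close>, one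
  step between adjacent ancestors, and \<open>2 powr (1/8)\<close> for replacing a distance by the
  next power of two.\<close>

definition chaining_const :: real where
  "chaining_const = (2 * (\<beta> / (1 - \<beta>)) + 1) * 2 powr (1/8)"

lemma dyadic_ratio: "0 < \<beta>" "\<beta> < 1"
proof -
  have "\<beta> < 2 powr 0" by (rule powr_less_mono) simp_all
  then show "\<beta> < 1" by simp
qed simp

lemma chaining_const_pos: "0 < chaining_const"
proof -
  have "0 < \<beta> / (1 - \<beta>)" using dyadic_ratio by simp
  then show ?thesis unfolding chaining_const_def by (intro mult_pos_pos) simp_all
qed

lemma dyadic_ratio_power: "\<beta> ^ m = (1 / 2 ^ m) powr (1/8)"
proof -
  have "\<beta> ^ m = 2 powr (- (1/8) * real m)"
    by (simp add: powr_realpow[symmetric] powr_powr)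
  also have "\<dots> = (2 powr (- real m)) powr (1/8)"
    by (simp add: powr_powr)
  also have "2 powr (- real m) = 1 / 2 ^ m"
    by (simp add: powr_minus_divide powr_realpow)
  finally show ?thesis .
qed

text \<open>Climbs the binary tree level by level; division by \<open>2 ^ m\<close> forgets
  \<open>m\<close> binary digits. The induction closes because
  \<open>\<beta> / (1 - \<beta>)\<close> is the fixed point of the map from \<open>z\<close> to
  \<open>(z + 1) * \<beta>\<close>.\<close>

lemma dyadic_ancestor:
  fixes x :: "real \<Rightarrow> real"
  assumes c: "0 \<le> c"
    and inc: "\<And>j i. j \<le> n \<Longrightarrow> i < 2 ^ j \<Longrightarrow> \<bar>x (real (Suc i) / 2 ^ j) - x (real i / 2 ^ j)\<bar> \<le> c * \<beta> ^ j"
    and k: "k \<le> 2 ^ n" and m: "m \<le> n"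
  shows "\<bar>x (real k / 2 ^ n) - x (real (k div 2 ^ m) / 2 ^ (n - m))\<bar> \<le> c * (\<beta> / (1 - \<beta>)) * \<beta> ^ (n - m)"
  using m
proof (induction m)
  case 0
  then show ?case using c dyadic_ratio by simp
next
  case (Suc m)
  define L where "L = n - Suc m"
  have L: "n - m = Suc L" "Suc L \<le> n" "n - Suc m = L" using Suc.prems by (auto simp: L_def)
  define p where "p = k div 2 ^ m"
  have p: "k div 2 ^ Suc m = p div 2"
    by (simp only: p_def power_Suc2 div_mult2_eq)
  have "p \<le> 2 ^ n div 2 ^ m" unfolding p_def by (rule div_le_mono[OF k])
  also have "(2 ^ n div 2 ^ m :: nat) = 2 ^ Suc L"
    using Suc.prems by (simp add: L(1)[symmetric] power_diff)
  finally have pL: "p \<le> 2 ^ Suc L" .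
  have same: "real (p div 2) / 2 ^ L = real (2 * (p div 2)) / 2 ^ Suc L" by simp
  \<comment> \<open>A point with even \<open>p\<close> already lies on the coarser level; one with
    odd \<open>p\<close> is the right neighbour of its parent.\<close>
  have step: "\<bar>x (real p / 2 ^ Suc L) - x (real (p div 2) / 2 ^ L)\<bar> \<le> c * \<beta> ^ Suc L"
  proof (cases "even p")
    case True
    then have "2 * (p div 2) = p" by simp
    then show ?thesis unfolding same using c dyadic_ratio by simp
  next
    case False
    then have "p = Suc (2 * (p div 2))" by presburger
    moreover from this have "2 * (p div 2) < 2 ^ Suc L" using pL by linarith
    ultimately show ?thesis unfolding same using inc[OF L(2), of "2 * (p div 2)"] by metis
  qed
  have "\<bar>x (real k / 2 ^ n) - x (real p / 2 ^ Suc L)\<bar> \<le> c * (\<beta> / (1 - \<beta>)) * \<beta> ^ Suc L"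
    using Suc.IH Suc.prems L(1) by (simp add: p_def)
  with step have "\<bar>x (real k / 2 ^ n) - x (real (p div 2) / 2 ^ L)\<bar> \<le>
      c * (\<beta> / (1 - \<beta>)) * \<beta> ^ Suc L + c * \<beta> ^ Suc L"
    by linarith
  also have "\<dots> = c * ((\<beta> / (1 - \<beta>) + 1) * \<beta>) * \<beta> ^ L"
    by (simp add: algebra_simps)
  also have "(\<beta> / (1 - \<beta>) + 1) * \<beta> = \<beta> / (1 - \<beta>)"
    using dyadic_ratio by (simp add: add_divide_eq_iff divide_add_eq_iff)
  finally show ?case by (simp only: L(3) p)
qed

lemma dyadic_chaining:
  fixes x :: "real \<Rightarrow> real"
  assumes c: "0 \<le> c"
    and inc: "\<And>j i. j \<le> n \<Longrightarrow> i < 2 ^ j \<Longrightarrow> \<bar>x (real (Suc i) / 2 ^ j) - x (real i / 2 ^ j)\<bar> \<le> c * \<beta> ^ j"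
    and k: "k \<le> 2 ^ n" and l: "l < k"
  shows "\<bar>x (real k / 2 ^ n) - x (real l / 2 ^ n)\<bar> \<le> c * chaining_const * \<bar>real k / 2 ^ n - real l / 2 ^ n\<bar> powr (1/8)"
proof -
  \<comment> \<open>At this level the ancestors of the two points coincide or are adjacent.
    Minimality keeps \<open>2 ^ m\<close> within a factor 2 of the distance.\<close>
  define m where "m = (LEAST m. k - l \<le> 2 ^ m)"
  have "k - l \<le> 2 ^ n" using k by simp
  then have m: "k - l \<le> 2 ^ m" "m \<le> n"
    unfolding m_def by (rule LeastI, rule Least_le)
  have m2: "2 ^ m \<le> 2 * (k - l)"
  proof (cases m)
    case (Suc m')
    then have "\<not> k - l \<le> 2 ^ m'" using not_less_Least[of m' "\<lambda>m. k - l \<le> 2 ^ m"] by (simp add: m_def)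
    then show ?thesis using Suc by simp
  qed (use l in simp)
  define p q where "p = k div 2 ^ m" and "q = l div 2 ^ m"
  have "p \<le> (l + 2 ^ m) div 2 ^ m" unfolding p_def using m(1) by (intro div_le_mono) simp
  then have "p \<le> Suc q" by (simp add: q_def)
  moreover have "q \<le> p" unfolding p_def q_def using l by (intro div_le_mono) simp
  ultimately consider "p = q" | "p = Suc q" by linarith
  then have pq: "\<bar>x (real p / 2 ^ (n - m)) - x (real q / 2 ^ (n - m))\<bar> \<le> c * \<beta> ^ (n - m)"
  proof cases
    case 1
    then show ?thesis using c dyadic_ratio by simp
  next
    case 2
    have "p \<le> 2 ^ n div 2 ^ m" unfolding p_def by (rule div_le_mono[OF k])
    also have "(2 ^ n div 2 ^ m :: nat) = 2 ^ (n - m)" using m(2) by (simp add: power_diff)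
    finally have "q < 2 ^ (n - m)" using 2 by simp
    then show ?thesis unfolding 2 by (intro inc) simp_all
  qed
  have K: "\<bar>x (real k / 2 ^ n) - x (real p / 2 ^ (n - m))\<bar> \<le> c * (\<beta> / (1 - \<beta>)) * \<beta> ^ (n - m)"
    unfolding p_def by (rule dyadic_ancestor[OF c inc k m(2)])
  have Lq: "\<bar>x (real l / 2 ^ n) - x (real q / 2 ^ (n - m))\<bar> \<le> c * (\<beta> / (1 - \<beta>)) * \<beta> ^ (n - m)"
    unfolding q_def by (rule dyadic_ancestor[OF c inc _ m(2)]) (use k l in simp_all)
  have "\<bar>x (real k / 2 ^ n) - x (real l / 2 ^ n)\<bar> \<le>
      c * (\<beta> / (1 - \<beta>)) * \<beta> ^ (n - m) + c * \<beta> ^ (n - m) + c * (\<beta> / (1 - \<beta>)) * \<beta> ^ (n - m)"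
    using K pq Lq by linarith
  also have "\<dots> = c * (2 * (\<beta> / (1 - \<beta>)) + 1) * \<beta> ^ (n - m)"
    by (simp add: algebra_simps)
  also have "\<dots> \<le> c * (2 * (\<beta> / (1 - \<beta>)) + 1) * (2 powr (1/8) * \<bar>real k / 2 ^ n - real l / 2 ^ n\<bar> powr (1/8))"
  proof (rule mult_left_mono)
    have "(1::real) / 2 ^ (n - m) = 2 ^ m / 2 ^ n"
      using m(2) by (simp add: power_diff)
    also have "\<dots> \<le> 2 * (real k - real l) / 2 ^ n"
    proof (rule divide_right_mono)
      have "real (2 ^ m) \<le> real (2 * (k - l))" using m2 by (simp only: of_nat_le_iff)
      then show "(2::real) ^ m \<le> 2 * (real k - real l)" using l by simp
    qed simp
    also have "\<dots> = 2 * \<bar>real k / 2 ^ n - real l / 2 ^ n\<bar>"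
      using l by (simp add: diff_divide_distrib[symmetric])
    finally have "(1 / 2 ^ (n - m)) powr (1/8) \<le> (2 * \<bar>real k / 2 ^ n - real l / 2 ^ n\<bar>) powr (1/8)"
      by (intro powr_mono2) simp_all
    then show "\<beta> ^ (n - m) \<le> 2 powr (1/8) * \<bar>real k / 2 ^ n - real l / 2 ^ n\<bar> powr (1/8)"
      by (simp only: dyadic_ratio_power powr_mult)
    have "0 \<le> \<beta> / (1 - \<beta>)" using dyadic_ratio by simp
    then show "0 \<le> c * (2 * (\<beta> / (1 - \<beta>)) + 1)" using c by (intro mult_nonneg_nonneg) linarith+
  qed
  finally show ?thesis by (simp only: chaining_const_def mult.assoc)
qed

section \<open>Regularity of the path of the current\<close>

lemma jump_counts_locally_constant:
  assumes \<xi>: "cadlag_path \<xi>" and t: "0 \<le> t"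
  obtains d where "d > 0" "\<And>u. t \<le> u \<Longrightarrow> u < t + d \<Longrightarrow> jump_count \<xi> x y u = jump_count \<xi> x y t"
    "\<And>u v. 0 \<le> u \<Longrightarrow> t - d < u \<Longrightarrow> u \<le> v \<Longrightarrow> v < t \<Longrightarrow> jump_count \<xi> x y u = jump_count \<xi> x y v"
proof -
  \<comment> \<open>The finitely many jump times up to \<open>t + 1\<close> leave a gap around
    \<open>t\<close> free of others. To the left of \<open>t\<close> only times strictly below
    \<open>t\<close> are compared, since \<open>t\<close> may be a jump time itself.\<close>
  let ?F = "{s. 0 < s \<and> s \<le> t + 1 \<and> jump_time \<xi> x y s}"
  have "finite ?F" by (rule finite_jump_times[OF \<xi> order_refl])
  then obtain e where e: "e > 0" "\<And>s. s \<in> ?F \<Longrightarrow> s \<noteq> t \<Longrightarrow> e \<le> dist t s"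
    using finite_set_avoid[of ?F t] by blast
  have eq: "jump_count \<xi> x y u = jump_count \<xi> x y v"
    if uv: "0 \<le> u" "u \<le> v" "v \<le> t + 1" and no: "\<And>s. u < s \<Longrightarrow> s \<le> v \<Longrightarrow> s \<noteq> t \<and> \<bar>t - s\<bar> < e" for u v
  proof -
    have "\<not> jump_time \<xi> x y s" if "u < s" "s \<le> v" for s
      using e(2)[of s] no[OF that] that uv by (auto simp: dist_real_def)
    then have "{s. u < s \<and> s \<le> v \<and> jump_time \<xi> x y s} = {}" by blast
    then show ?thesis using jump_count_add[OF \<xi> uv(1,2), of x y] by (simp only: card.empty)
  qed
  show thesis
  proof (rule that[of "min e 1"])
    show "min e 1 > 0" using e(1) by simp
    fix u assume u: "t \<le> u" "u < t + min e 1"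
    show "jump_count \<xi> x y u = jump_count \<xi> x y t"
      by (rule eq[symmetric]) (use u t in auto)
  next
    fix u v assume "0 \<le> u" "t - min e 1 < u" "u \<le> v" "v < t"
    then show "jump_count \<xi> x y u = jump_count \<xi> x y v"
      by (intro eq) auto
  qed
qed

lemma scaled_current_cadlag01:
  assumes \<xi>: "cadlag_path \<xi>" and r: "0 < r"
  shows "(\<lambda>t\<in>{0..1}. c * current \<xi> (r * t)) \<in> cadlag01" (is "?f \<in> _")
proof -
  have loc: "\<exists>d>0. (\<forall>u. t \<le> u \<and> u < t + d \<longrightarrow> current \<xi> u = current \<xi> t) \<and>
      (\<forall>u v. 0 \<le> u \<and> t - d < u \<and> u \<le> v \<and> v < t \<longrightarrow> current \<xi> u = current \<xi> v)" if t: "0 \<le> t" for t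
  proof -
    obtain d1 where d1: "d1 > 0" "\<And>u. t \<le> u \<Longrightarrow> u < t + d1 \<Longrightarrow> jump_count \<xi> 0 1 u = jump_count \<xi> 0 1 t"
      "\<And>u v. 0 \<le> u \<Longrightarrow> t - d1 < u \<Longrightarrow> u \<le> v \<Longrightarrow> v < t \<Longrightarrow> jump_count \<xi> 0 1 u = jump_count \<xi> 0 1 v"
      using jump_counts_locally_constant[OF \<xi> t, of 0 1] by blast
    obtain d2 where d2: "d2 > 0" "\<And>u. t \<le> u \<Longrightarrow> u < t + d2 \<Longrightarrow> jump_count \<xi> 1 0 u = jump_count \<xi> 1 0 t"
      "\<And>u v. 0 \<le> u \<Longrightarrow> t - d2 < u \<Longrightarrow> u \<le> v \<Longrightarrow> v < t \<Longrightarrow> jump_count \<xi> 1 0 u = jump_count \<xi> 1 0 v"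
      using jump_counts_locally_constant[OF \<xi> t, of 1 0] by blast
    show ?thesis
    proof (intro exI[of _ "min d1 d2"] conjI allI impI)
      fix u assume "t \<le> u \<and> u < t + min d1 d2"
      then have u: "t \<le> u" "u < t + d1" "u < t + d2" by auto
      have "jump_count \<xi> 0 1 u = jump_count \<xi> 0 1 t" "jump_count \<xi> 1 0 u = jump_count \<xi> 1 0 t"
        by (rule d1(2)[OF u(1,2)], rule d2(2)[OF u(1,3)])
      then show "current \<xi> u = current \<xi> t" by (simp only: current_def)
    next
      fix u v assume "0 \<le> u \<and> t - min d1 d2 < u \<and> u \<le> v \<and> v < t"
      then have uv: "0 \<le> u" "t - d1 < u" "t - d2 < u" "u \<le> v" "v < t" by auto
      have "jump_count \<xi> 0 1 u = jump_count \<xi> 0 1 v" "jump_count \<xi> 1 0 u = jump_count \<xi> 1 0 v"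
        by (rule d1(3)[OF uv(1,2,4,5)], rule d2(3)[OF uv(1,3,4,5)])
      then show "current \<xi> u = current \<xi> v" by (simp only: current_def)
    qed (use d1(1) d2(1) in simp)
  qed
  have "(?f \<longlongrightarrow> ?f t) (at_right t)" if t: "t \<in> {0..<1}" for t
  proof -
    obtain d where d: "d > 0" "\<And>u. r * t \<le> u \<Longrightarrow> u < r * t + d \<Longrightarrow> current \<xi> u = current \<xi> (r * t)"
      using loc[of "r * t"] t r by auto
    have "\<forall>\<^sub>F u in at_right t. u < min 1 (t + d / r)"
      using t d(1) r by (intro eventually_at_right_field[THEN iffD2]) (auto intro!: exI[of _ "min 1 (t + d / r)"])
    moreover have "\<forall>\<^sub>F u in at_right t. t < u"
      by (simp add: eventually_at_filter)
    ultimately have "\<forall>\<^sub>F u in at_right t. ?f u = ?f t"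
    proof eventually_elim
      case (elim u)
      then have "r * u < r * (t + d / r)" using r by (intro mult_strict_left_mono) auto
      then have "r * u < r * t + d" using r by (simp add: distrib_left)
      moreover have "r * t \<le> r * u" using elim r by simp
      ultimately have "current \<xi> (r * u) = current \<xi> (r * t)" by (intro d(2))
      then show ?case using elim t by simp
    qed
    then show ?thesis by (rule tendsto_eventually)
  qed
  moreover have "\<exists>l. (?f \<longlongrightarrow> l) (at_left t)" if t: "t \<in> {0<..1}" for t
  proof -
    have "0 \<le> r * t" using t r by simp
    from loc[OF this] obtain d where d: "d > 0"
      "\<And>u v. 0 \<le> u \<Longrightarrow> r * t - d < u \<Longrightarrow> u \<le> v \<Longrightarrow> v < r * t \<Longrightarrow> current \<xi> u = current \<xi> v"
      by blast
    define w where "w = max 0 (t - d / (2 * r))"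
    have w: "0 \<le> w" "w < t" "r * t - d < r * w"
    proof -
      have "0 < d / (2 * r)" using d(1) r by simp
      then show "0 \<le> w" "w < t" using t by (auto simp: w_def)
      have "r * (t - d / (2 * r)) \<le> r * w" using r by (intro mult_left_mono) (auto simp: w_def)
      then have "r * t - d / 2 \<le> r * w" using r by (simp add: right_diff_distrib)
      then show "r * t - d < r * w" using d(1) by simp
    qed
    have "\<forall>\<^sub>F u in at_left t. w < u"
      using w(2) by (intro eventually_at_left_field[THEN iffD2]) auto
    moreover have "\<forall>\<^sub>F u in at_left t. u < t"
      by (simp add: eventually_at_filter)
    ultimately have "\<forall>\<^sub>F u in at_left t. ?f u = ?f w"
    proof eventually_elim
      case (elim u)
      have "current \<xi> (r * w) = current \<xi> (r * u)"
        using elim r w by (intro d(2)) auto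
      then show ?case using elim t w(1) by simp
    qed
    then have "(?f \<longlongrightarrow> ?f w) (at_left t)" by (rule tendsto_eventually)
    then show ?thesis by blast
  qed
  ultimately show ?thesis by (auto simp: cadlag01_def)
qed

lemma current_0: "current \<xi> 0 = 0"
proof -
  have "{s. 0 < s \<and> s \<le> 0 \<and> jump_time \<xi> x y s} = {}" for x y by auto
  then show ?thesis by (simp only: current_def jump_count_def card.empty)
qed

lemma current_diff_le_activity:
  assumes "cadlag_path \<xi>" "0 \<le> u" "u \<le> v"
  shows "\<bar>current \<xi> v - current \<xi> u\<bar> \<le> activity \<xi> v - activity \<xi> u"
  using jump_count_mono[OF assms, of 0 1] jump_count_mono[OF assms, of 1 0]
  by (simp add: current_def activity_def)

lemma activity_mono:
  assumes "cadlag_path \<xi>" "0 \<le> u" "u \<le> v"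
  shows "activity \<xi> u \<le> activity \<xi> v"
  using current_diff_le_activity[OF assms] by linarith

text \<open>Deterministic, for one path. Its dyadic values are Hoelder by chaining and extend to a
  function in the ball; between dyadic points the path moves by at most the activity of the cell and
  the function by its modulus. The ball depends on \<open>c\<close> only, so it can be fixed before
  \<open>\<delta>\<close> and \<open>r\<close>, as tightness demands.\<close>

lemma scaled_current_in_enlargement:
  assumes \<xi>: "cadlag_path \<xi>" and r: "0 < r" and c: "0 \<le> c"
    and inc: "\<And>j i. j \<le> n \<Longrightarrow> i < 2 ^ j \<Longrightarrow>
      \<bar>current \<xi> (r * (real (Suc i) / 2 ^ j)) - current \<xi> (r * (real i / 2 ^ j))\<bar> \<le> c * \<beta> ^ j * r powr (1/4)"
    and act: "\<And>i. i < 2 ^ n \<Longrightarrow>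
      activity \<xi> (r * (real (Suc i) / 2 ^ n)) - activity \<xi> (r * (real i / 2 ^ n)) \<le> \<delta>' * r powr (1/4)"
    and \<delta>: "\<delta>' + c * chaining_const * (1 / 2 ^ n) powr (1/8) < \<delta>"
  shows "(\<lambda>t\<in>{0..1}. r powr (-1/4) * current \<xi> (r * t)) \<in>
    enlargement D01_uniform (hoelder_ball (c * chaining_const)) \<delta>" (is "?f \<in> _")
proof -
  define x where "x t = r powr (-1/4) * current \<xi> (r * t)" for t
  let ?C = "c * chaining_const" and ?A = "(\<lambda>k. real k / 2 ^ n) ` {..2 ^ n}"
  have C: "0 \<le> ?C" using c chaining_const_pos by simp
  have scale: "r powr (-1/4) * r powr (1/4) = 1" using r by (simp flip: powr_add)
  have x_inc: "\<bar>x (real (Suc i) / 2 ^ j) - x (real i / 2 ^ j)\<bar> \<le> c * \<beta> ^ j" if "j \<le> n" "i < 2 ^ j" for j i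
  proof -
    have "\<bar>x (real (Suc i) / 2 ^ j) - x (real i / 2 ^ j)\<bar> =
        r powr (-1/4) * \<bar>current \<xi> (r * (real (Suc i) / 2 ^ j)) - current \<xi> (r * (real i / 2 ^ j))\<bar>"
      unfolding x_def right_diff_distrib[symmetric] abs_mult by simp
    also have "\<dots> \<le> r powr (-1/4) * (c * \<beta> ^ j * r powr (1/4))"
      by (intro mult_left_mono inc that) simp
    also have "\<dots> = r powr (-1/4) * r powr (1/4) * (c * \<beta> ^ j)" by (simp only: ac_simps)
    also have "\<dots> = c * \<beta> ^ j" by (simp only: scale mult_1)
    finally show ?thesis .
  qed
  have chain: "\<bar>x (real k / 2 ^ n) - x (real l / 2 ^ n)\<bar> \<le> ?C * \<bar>real k / 2 ^ n - real l / 2 ^ n\<bar> powr (1/8)"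
    if "k \<le> 2 ^ n" "l < k" for k l
    by (rule dyadic_chaining[OF c _ that]) (rule x_inc)
  have hoelder: "\<bar>x a - x b\<bar> \<le> ?C * \<bar>a - b\<bar> powr (1/8)" if ab: "a \<in> ?A" "b \<in> ?A" for a b
  proof -
    obtain k where k: "k \<le> 2 ^ n" "a = real k / 2 ^ n" using ab(1) by blast
    obtain l where l: "l \<le> 2 ^ n" "b = real l / 2 ^ n" using ab(2) by blast
    note kl = k(1) l(1) k(2) l(2)
    consider "k < l" | "k = l" | "l < k" by linarith
    then show ?thesis
    proof cases
      case 1
      from chain[OF kl(2) 1] show ?thesis by (simp only: kl(3,4) abs_minus_commute)
    next
      case 2
      then show ?thesis by (simp add: kl)
    next
      case 3
      from chain[OF kl(1) 3] show ?thesis by (simp only: kl(3,4))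
    qed
  qed
  obtain f :: "real \<Rightarrow> real" where f: "\<And>a. a \<in> ?A \<Longrightarrow> f a = x a" "\<And>s t. \<bar>f s - f t\<bar> \<le> ?C * \<bar>s - t\<bar> powr (1/8)"
  proof (rule hoelder_extension[of ?A ?C "1/8" x])
    show "finite ?A" "?A \<noteq> {}" by simp_all
    show "0 \<le> ?C" by (rule C)
    show "0 < (1/8 :: real)" "1/8 \<le> (1::real)" by simp_all
    show "\<bar>x a - x b\<bar> \<le> ?C * \<bar>a - b\<bar> powr (1/8)" if "a \<in> ?A" "b \<in> ?A" for a b
      by (rule hoelder[OF that])
  qed (rule that)
  define g where "g = restrict f {0..1}"
  have "0 \<in> ?A" by (intro image_eqI[of _ _ 0]) auto
  then have "f 0 = 0" using f(1)[of 0] by (simp add: x_def current_0)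
  then have g: "g \<in> hoelder_ball ?C"
    using f(2) by (simp add: hoelder_ball_def g_def)
  have fc: "?f \<in> cadlag01" by (rule scaled_current_cadlag01[OF \<xi> r])
  have gc: "g \<in> cadlag01" using g hoelder_ball_subset by blast
  have "mdist D01_uniform g ?f \<le> \<delta>' + ?C * (1 / 2 ^ n) powr (1/8)"
  proof (rule dist_D01_uniform_le[OF gc fc])
    fix t :: real assume t: "t \<in> {0..1}"
    \<comment> \<open>The floor of \<open>t * 2 ^ n\<close> is the index of the cell, except that
      \<open>t = 1\<close> is put into the last cell.\<close>
    obtain i where i: "i < 2 ^ n" "real i / 2 ^ n \<le> t" "t \<le> real (Suc i) / 2 ^ n"
    proof (cases "t = 1")
      case True
      have "(0::nat) < 2 ^ n" by simp
      then have "real (Suc (2 ^ n - 1)) = 2 ^ n" by simp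
      moreover have "real (2 ^ n - 1) \<le> 2 ^ n" by simp
      ultimately show thesis using True by (intro that[of "2 ^ n - 1"]) (simp_all only:, simp_all)
    next
      case False
      define i where "i = nat \<lfloor>t * 2 ^ n\<rfloor>"
      have i: "real i \<le> t * 2 ^ n" "t * 2 ^ n \<le> real (Suc i)"
        using t unfolding i_def by (simp_all add: of_nat_nat) linarith
      have "t * 2 ^ n < 1 * 2 ^ n" using False t by (intro mult_strict_right_mono) auto
      then have "real i < real (2 ^ n)" unfolding of_nat_power of_nat_numeral using i(1) by linarith
      then have "i < 2 ^ n" by (simp only: of_nat_less_iff)
      then show thesis using i by (intro that[of i]) (simp_all add: divide_le_eq le_divide_eq)
    qed
    let ?s = "real i / 2 ^ n"
    have s0: "0 \<le> r * ?s" "0 \<le> r * t" using r t by simp_all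
    have st: "r * ?s \<le> r * t" by (rule mult_left_mono[OF i(2)]) (use r in simp)
    have ts: "r * t \<le> r * (real (Suc i) / 2 ^ n)" by (rule mult_left_mono[OF i(3)]) (use r in simp)
    have "\<bar>current \<xi> (r * t) - current \<xi> (r * ?s)\<bar> \<le> activity \<xi> (r * t) - activity \<xi> (r * ?s)"
      by (rule current_diff_le_activity[OF \<xi> s0(1) st])
    also have "\<dots> \<le> activity \<xi> (r * (real (Suc i) / 2 ^ n)) - activity \<xi> (r * ?s)"
      by (rule diff_right_mono[OF activity_mono[OF \<xi> s0(2) ts]])
    also have "\<dots> \<le> \<delta>' * r powr (1/4)" by (rule act[OF i(1)])
    finally have "r powr (-1/4) * \<bar>current \<xi> (r * t) - current \<xi> (r * ?s)\<bar> \<le> r powr (-1/4) * (\<delta>' * r powr (1/4))"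
      by (rule mult_left_mono) simp
    also have "\<dots> = r powr (-1/4) * r powr (1/4) * \<delta>'" by (simp only: ac_simps)
    also have "\<dots> = \<delta>'" by (simp only: scale mult_1)
    finally have "\<bar>x t - x ?s\<bar> \<le> \<delta>'"
      unfolding x_def right_diff_distrib[symmetric] abs_mult by simp
    moreover have "f ?s = x ?s" using i(1) by (intro f(1)) auto
    moreover have "\<bar>f t - f ?s\<bar> \<le> ?C * (1 / 2 ^ n) powr (1/8)"
    proof -
      have "real (Suc i) / 2 ^ n = ?s + 1 / 2 ^ n" by (simp add: add_divide_distrib)
      then have "\<bar>t - ?s\<bar> \<le> 1 / 2 ^ n" using i(2,3) by linarith
      then have "?C * \<bar>t - ?s\<bar> powr (1/8) \<le> ?C * (1 / 2 ^ n) powr (1/8)"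
        using C by (intro mult_left_mono powr_mono2) auto
      then show ?thesis using f(2)[of t ?s] by linarith
    qed
    ultimately have "\<bar>f t - x t\<bar> \<le> \<delta>' + ?C * (1 / 2 ^ n) powr (1/8)" by linarith
    then show "\<bar>g t - ?f t\<bar> \<le> \<delta>' + ?C * (1 / 2 ^ n) powr (1/8)"
      using t by (simp add: g_def x_def)
  qed
  then have "mdist D01_uniform g ?f < \<delta>" using \<delta> by linarith
  then have "?f \<in> mball_of D01_uniform g \<delta>"
    using fc gc by (simp only: in_mball_of mspace_D01_uniform)
  then show ?thesis using g unfolding enlargement_def by blast
qed

section \<open>Tightness\<close>

lemma power_div_fact_le_exp:
  fixes y :: real
  assumes "0 \<le> y"
  shows "y ^ n / fact n \<le> exp y"
proof -
  obtain t where t: "exp y = (\<Sum>m<Suc n. y ^ m / fact m) + exp t / fact (Suc n) * y ^ Suc n"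
    using Maclaurin_exp_le[of y "Suc n"] by blast
  have "y ^ n / fact n \<le> (\<Sum>m<Suc n. y ^ m / fact m)"
    using member_le_sum[of n "{..<Suc n}" "\<lambda>m. y ^ m / fact m"] assms by simp
  moreover have "0 \<le> exp t / fact (Suc n) * y ^ Suc n" using assms by simp
  ultimately show ?thesis using t by linarith
qed

lemma exp_minus_le_fact_div_power:
  fixes y :: real
  assumes "0 < y"
  shows "exp (- y) \<le> fact n / y ^ n"
proof -
  have "y ^ n / fact n \<le> exp y" using assms by (intro power_div_fact_le_exp) simp
  then have "y ^ n \<le> exp y * fact n" by (simp add: divide_le_eq)
  then have "exp (- y) * y ^ n \<le> exp (- y) * (exp y * fact n)" by (intro mult_left_mono) simp_all
  also have "\<dots> = fact n" by (simp add: exp_minus)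
  finally show ?thesis using assms by (simp add: le_divide_eq)
qed

text \<open>Fixes the depth of the chaining: the finest cells have length \<open>r / 2 ^ n\<close>
  at least 1, as the tail bound of the current requires, and below 2, so that their activity is
  small.\<close>

lemma exists_dyadic_scale:
  fixes r :: real
  assumes "1 \<le> r"
  obtains n where "2 ^ n \<le> r" "r < 2 ^ Suc n"
proof -
  define k where "k = nat \<lfloor>r\<rfloor>"
  have k: "1 \<le> k" "real k \<le> r" "r < real (Suc k)"
    using assms unfolding k_def by linarith+
  obtain n where n: "2 ^ n \<le> k" "k < 2 ^ (n + 1)" using ex_power_ivl1[of 2 k] k(1) by auto
  have "real (2 ^ n) \<le> real k" using n(1) by (simp only: of_nat_le_iff)
  then have lo: "2 ^ n \<le> r" using k(2) unfolding of_nat_power of_nat_numeral by linarith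
  have "Suc k \<le> 2 ^ Suc n" using n(2) by simp
  then have "real (Suc k) \<le> real (2 ^ Suc n)" by (simp only: of_nat_le_iff)
  then have "r < 2 ^ Suc n" using k(3) unfolding of_nat_power of_nat_numeral by linarith
  with lo show thesis by (rule that)
qed

lemma sum_half_powers_le: "(\<Sum>j\<le>n. (1/2::real) ^ j) \<le> 2"
proof -
  have "(\<Sum>j\<le>n. (1/2::real) ^ j) = 2 - (1/2) ^ n"
    by (induction n) simp_all
  then show ?thesis by simp
qed

text \<open>With this value as \<open>c\<close>, the 4 ensures \<open>4 / c \<le> 1\<close>, and the
  other term makes the total probability of large increments, at most
  \<open>128 * fact 16 / c\<close>, at most \<open>\<epsilon> / 2\<close>.\<close>

definition hoelder_const :: "real \<Rightarrow> real" where
  "hoelder_const \<epsilon> = 4 + 256 * fact 16 / \<epsilon>"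

context stationary_ssep
begin

text \<open>At level \<open>j\<close> the increments have standard deviation \<open>\<beta> ^ (2 * j) * r powr (1/4)\<close>, so exceeding
  \<open>c * \<beta> ^ j * r powr (1/4)\<close> costs \<open>exp (- c * \<beta> powr (- j) / 4)\<close>, which beats the number \<open>2 ^ j\<close> of cells.\<close>

lemma increment_tail:
  assumes r: "0 < r" and j: "2 ^ j \<le> r" and c: "0 < c"
  shows "prob {\<omega> \<in> space M. c * \<beta> ^ j * r powr (1/4) \<le>
      \<bar>current (\<lambda>t. \<eta> t \<omega>) (r * (real (Suc i) / 2 ^ j)) - current (\<lambda>t. \<eta> t \<omega>) (r * (real i / 2 ^ j))\<bar>} \<le>
    16 * fact 16 * (4 / c) ^ 16 * (1/4) ^ j"
proof -
  define T where "T = r / 2 ^ j"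
  have T: "1 \<le> T" "r * (real (Suc i) / 2 ^ j) = r * (real i / 2 ^ j) + T"
    using j by (simp_all add: T_def le_divide_eq add_divide_distrib distrib_left)
  \<comment> \<open>The shorter time increment gains \<open>2 powr (j / 4)\<close>; half of this
    exponent pays for the factor \<open>\<beta> ^ j\<close>, the other half remains.\<close>
  have e: "c * \<beta> ^ j * r powr (1/4) / (4 * T powr (1/4)) = c / 4 * (2 powr (1/8)) ^ j"
  proof -
    have b: "\<beta> ^ j = 2 powr (- (real j / 8))" "(2 powr (1/8)) ^ j = 2 powr (real j / 8)"
      by (simp_all add: powr_realpow[symmetric] powr_powr)
    have "T powr (1/4) = r powr (1/4) / 2 powr (real j / 4)"
      using r by (simp add: T_def powr_divide powr_realpow[symmetric] powr_powr)
    then have "c * \<beta> ^ j * r powr (1/4) / (4 * T powr (1/4)) = c / 4 * (\<beta> ^ j * 2 powr (real j / 4))"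
      using r by simp
    also have "\<beta> ^ j * 2 powr (real j / 4) = 2 powr (real j / 8)"
      unfolding b by (simp flip: powr_add)
    finally show ?thesis by (simp only: b)
  qed
  have y: "0 < c / 4 * (2 powr (1/8)) ^ j" using c by simp
  \<comment> \<open>The sixteenth power turns \<open>2 powr (1/8)\<close> into 4. Against the
    \<open>2 ^ j\<close> cells of the level this leaves the summable
    \<open>(1/2) ^ j\<close>.\<close>
  have p16: "((2 powr (1/8)) ^ j) ^ 16 = (4::real) ^ j"
  proof -
    have "(2 powr (1/8)) ^ 16 = (2 powr (1/8)) powr real 16"
      by (rule powr_realpow[symmetric]) simp
    also have "\<dots> = 4" by (simp add: powr_powr)
    finally show ?thesis by (metis mult.commute power_mult)
  qed
  have "prob {\<omega> \<in> space M. c * \<beta> ^ j * r powr (1/4) \<le>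
      \<bar>current (\<lambda>t. \<eta> t \<omega>) (r * (real (Suc i) / 2 ^ j)) - current (\<lambda>t. \<eta> t \<omega>) (r * (real i / 2 ^ j))\<bar>} \<le>
      16 * exp (- (c * \<beta> ^ j * r powr (1/4) / (4 * T powr (1/4))))"
    unfolding T(2) by (rule current_tail) (use r T(1) in simp_all)
  also have "\<dots> \<le> 16 * (fact 16 / (c / 4 * (2 powr (1/8)) ^ j) ^ 16)"
    unfolding e by (intro mult_left_mono exp_minus_le_fact_div_power y) simp
  also have "\<dots> = 16 * fact 16 * (4 / c) ^ 16 * (1/4) ^ j"
    unfolding power_mult_distrib p16
  proof -
    have "16 * (f / (a * b)) = 16 * f * (1 / a) * (1 / b)" for f a b :: real by simp
    moreover have "(4 / c) ^ 16 = 1 / (c / 4) ^ 16" "(1 / 4 :: real) ^ j = 1 / 4 ^ j"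
      by (simp_all only: power_divide power_one divide_divide_eq_right mult_1)
    ultimately show "16 * (fact 16 / ((c / 4) ^ 16 * 4 ^ j)) = 16 * fact 16 * (4 / c) ^ 16 * (1 / 4) ^ j"
      by (simp only:)
  qed
  finally show ?thesis .
qed

lemma inner_prob_ge:
  assumes "A \<in> sets M" "A \<subseteq> B"
  shows "prob A \<le> inner_prob M B"
  unfolding inner_prob_def
  by (rule cSUP_upper) (use assms in \<open>auto intro!: bdd_aboveI2[of _ _ 1]\<close>)

text \<open>Union bound over two kinds of exceptional events: a large increment of the current at
  some dyadic level, and much activity in some finest cell. Each kind gets
  \<open>\<epsilon> / 2\<close>, and their complement is a measurable set inside the event in
  question.\<close>

lemma inner_prob_enlargement:
  assumes r: "1 \<le> r" and \<epsilon>: "0 < \<epsilon>" and \<delta>': "0 < \<delta>'"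
    and \<delta>: "\<delta>' + hoelder_const \<epsilon> * chaining_const * (2 / r) powr (1/8) < \<delta>"
    and small: "r * exp (4 - \<delta>' * r powr (1/4)) \<le> \<epsilon> / 2"
  shows "1 - \<epsilon> \<le> inner_prob M {\<omega> \<in> space M. (\<lambda>t\<in>{0..1}. r powr (-1/4) * current (\<lambda>s. \<eta> s \<omega>) (r * t)) \<in>
    enlargement D01_uniform (hoelder_ball (hoelder_const \<epsilon> * chaining_const)) \<delta>}" (is "_ \<le> inner_prob M ?B")
proof -
  obtain n where n: "2 ^ n \<le> r" "r < 2 ^ Suc n" using exists_dyadic_scale[OF r] by blast
  have r0: "0 < r" using r by simp
  define c where "c = hoelder_const \<epsilon>"
  have c: "4 \<le> c" "c \<ge> 256 * fact 16 / \<epsilon>" using \<epsilon> by (simp_all add: c_def hoelder_const_def)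
  define J where "J u \<omega> = current (\<lambda>t. \<eta> t \<omega>) u" for u \<omega>
  define V where "V u \<omega> = activity (\<lambda>t. \<eta> t \<omega>) u" for u \<omega>
  define E where "E j i = {\<omega> \<in> space M. c * \<beta> ^ j * r powr (1/4) \<le>
      \<bar>J (r * (real (Suc i) / 2 ^ j)) \<omega> - J (r * (real i / 2 ^ j)) \<omega>\<bar>}" for j i :: nat
  define F where "F i = {\<omega> \<in> space M. \<delta>' * r powr (1/4) \<le>
      V (r * (real (Suc i) / 2 ^ n)) \<omega> - V (r * (real i / 2 ^ n)) \<omega>}" for i :: nat
  have split: "r * (real (Suc i) / 2 ^ j) = r * (real i / 2 ^ j) + r / 2 ^ j" for i j :: nat
    by (simp add: add_divide_distrib distrib_left)
  have E: "E j i \<in> sets M" for j i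
  proof -
    have "(\<lambda>\<omega>. J (r * (real (Suc i) / 2 ^ j)) \<omega> - J (r * (real i / 2 ^ j)) \<omega>) \<in> borel_measurable M"
      unfolding J_def split using r0 by (intro borel_measurable_current_diff) simp_all
    then show ?thesis unfolding E_def by measurable
  qed
  have F: "F i \<in> sets M" for i
  proof -
    have "(\<lambda>\<omega>. V (r * (real (Suc i) / 2 ^ n)) \<omega> - V (r * (real i / 2 ^ n)) \<omega>) \<in> borel_measurable M"
      unfolding V_def split using r0 by (intro borel_measurable_activity_diff) simp_all
    then show ?thesis unfolding F_def by measurable
  qed
  define EE where "EE = (\<Union>j\<le>n. \<Union>i<2 ^ j. E j i)"
  define FF where "FF = (\<Union>i<2 ^ n. F i)"
  have EEm: "EE \<in> sets M" unfolding EE_def by (intro sets.finite_UN E) simp_all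
  have FFm: "FF \<in> sets M" unfolding FF_def by (intro sets.finite_UN F) simp_all
  let ?q = "16 * fact 16 * (4 / c) ^ 16 :: real"
  have "prob EE \<le> (\<Sum>j\<le>n. prob (\<Union>i<2 ^ j. E j i))"
    unfolding EE_def by (rule finite_measure_subadditive_finite) (auto intro: E)
  also have "\<dots> \<le> (\<Sum>j\<le>n. ?q * (1/2) ^ j)"
  proof (rule sum_mono)
    fix j assume "j \<in> {..n}"
    then have "(2::real) ^ j \<le> 2 ^ n" by (intro power_increasing) simp_all
    then have j: "2 ^ j \<le> r" using n(1) by linarith
    have "prob (\<Union>i<2 ^ j. E j i) \<le> (\<Sum>i<2 ^ j. prob (E j i))"
      by (rule finite_measure_subadditive_finite) (auto intro: E)
    also have "\<dots> \<le> (\<Sum>i<(2::nat) ^ j. ?q * (1/4) ^ j)"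
      unfolding E_def J_def using c(1) by (intro sum_mono increment_tail r0 j) simp
    also have "\<dots> = ?q * (2 ^ j * (1/4) ^ j)" by simp
    also have "(2::real) ^ j * (1/4) ^ j = (1/2) ^ j"
      by (simp flip: power_mult_distrib)
    finally show "prob (\<Union>i<2 ^ j. E j i) \<le> ?q * (1/2) ^ j" .
  qed
  also have "\<dots> = ?q * (\<Sum>j\<le>n. (1/2) ^ j)" by (rule sum_distrib_left[symmetric])
  also have "\<dots> \<le> ?q * 2"
    using c by (intro mult_left_mono sum_half_powers_le) simp
  also have "\<dots> \<le> \<epsilon> / 2"
  proof -
    \<comment> \<open>One of the sixteen factors is enough to make the bound small; the others are
      at most 1.\<close>
    have "(4 / c) ^ 16 \<le> (4 / c) ^ 1" using c(1) by (intro power_decreasing) simp_all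
    then have "?q * 2 \<le> 16 * fact 16 * (4 / c) * 2"
      by (intro mult_right_mono mult_left_mono) simp_all
    also have "\<dots> = 128 * fact 16 / c" by simp
    also have "\<dots> \<le> 128 * fact 16 / (256 * fact 16 / \<epsilon>)"
      using c \<epsilon> by (intro divide_left_mono) simp_all
    also have "\<dots> = \<epsilon> / 2" by simp
    finally show ?thesis .
  qed
  finally have pE: "prob EE \<le> \<epsilon> / 2" .
  have "prob FF \<le> (\<Sum>i<2 ^ n. prob (F i))"
    unfolding FF_def by (rule finite_measure_subadditive_finite) (auto intro: F)
  also have "\<dots> \<le> (\<Sum>i<(2::nat) ^ n. exp (4 - \<delta>' * r powr (1/4)))"
  proof (rule sum_mono)
    fix i
    \<comment> \<open>Finest cells are at most 2 long, whence the 4 in the exponent of the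
      hypothesis \<open>small\<close>.\<close>
    have "r / 2 ^ n \<le> 2" using n(2) by (simp add: divide_le_eq)
    have "prob (F i) \<le> exp (2 * (r / 2 ^ n) - \<delta>' * r powr (1/4))"
      unfolding F_def V_def split using r0 by (intro activity_tail) simp_all
    also have "\<dots> \<le> exp (4 - \<delta>' * r powr (1/4))" using \<open>r / 2 ^ n \<le> 2\<close> by simp
    finally show "prob (F i) \<le> exp (4 - \<delta>' * r powr (1/4))" .
  qed
  also have "\<dots> = 2 ^ n * exp (4 - \<delta>' * r powr (1/4))" by simp
  also have "\<dots> \<le> r * exp (4 - \<delta>' * r powr (1/4))" using n(1) by (intro mult_right_mono) simp_all
  finally have pF: "prob FF \<le> \<epsilon> / 2" using small by linarith
  let ?A = "space M - (EE \<union> FF)"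
  have sub: "?A \<subseteq> ?B"
  proof
    fix \<omega> assume \<omega>: "\<omega> \<in> ?A"
    then have sp: "\<omega> \<in> space M" by blast
    have nE: "\<omega> \<notin> E j i" if "j \<le> n" "i < 2 ^ j" for j i
      using \<omega> that unfolding EE_def by blast
    have nF: "\<omega> \<notin> F i" if "i < 2 ^ n" for i
      using \<omega> that unfolding FF_def by blast
    have "(\<lambda>t\<in>{0..1}. r powr (-1/4) * current (\<lambda>s. \<eta> s \<omega>) (r * t)) \<in>
        enlargement D01_uniform (hoelder_ball (c * chaining_const)) \<delta>"
    proof (rule scaled_current_in_enlargement[OF cadlag_process[OF sp] r0, of c n \<delta>'])
      show "0 \<le> c" using c(1) by simp
      show "\<bar>current (\<lambda>s. \<eta> s \<omega>) (r * (real (Suc i) / 2 ^ j)) - current (\<lambda>s. \<eta> s \<omega>) (r * (real i / 2 ^ j))\<bar>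
          \<le> c * \<beta> ^ j * r powr (1/4)" if "j \<le> n" "i < 2 ^ j" for j i
        using nE[OF that] sp unfolding E_def J_def mem_Collect_eq by linarith
      show "activity (\<lambda>s. \<eta> s \<omega>) (r * (real (Suc i) / 2 ^ n)) - activity (\<lambda>s. \<eta> s \<omega>) (r * (real i / 2 ^ n))
          \<le> \<delta>' * r powr (1/4)" if "i < 2 ^ n" for i
        using nF[OF that] sp unfolding F_def V_def mem_Collect_eq by linarith
      have "1 / 2 ^ n \<le> 2 / r" using n(2) r0 by (simp add: divide_le_eq le_divide_eq)
      then have "(1 / 2 ^ n) powr (1/8) \<le> (2 / r) powr (1/8)" by (intro powr_mono2) simp_all
      then have "c * chaining_const * (1 / 2 ^ n) powr (1/8) \<le> c * chaining_const * (2 / r) powr (1/8)"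
        using c(1) chaining_const_pos by (intro mult_left_mono) simp_all
      then show "\<delta>' + c * chaining_const * (1 / 2 ^ n) powr (1/8) < \<delta>"
        using \<delta> unfolding c_def by linarith
    qed
    then show "\<omega> \<in> ?B" using sp by (simp only: c_def mem_Collect_eq)
  qed
  have "prob ?A = 1 - prob (EE \<union> FF)"
    by (rule prob_compl) (intro sets.Un EEm FFm)
  moreover have "prob (EE \<union> FF) \<le> prob EE + prob FF"
    by (rule measure_Un_le[OF EEm FFm])
  ultimately have "1 - \<epsilon> \<le> prob ?A" using pE pF by linarith
  also have "\<dots> \<le> inner_prob M ?B"
    by (rule inner_prob_ge[OF _ sub]) (intro sets.Diff sets.top sets.Un EEm FFm)
  finally show ?thesis .
qed

lemma asymptotically_tight_current:
  "asymptotically_tight M D01_uniform (\<lambda>r \<omega>. \<lambda>t\<in>{0..1}. r powr (-1/4) * current (\<lambda>s. \<eta> s \<omega>) (r * t))"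
  unfolding asymptotically_tight_def
proof (intro allI impI)
  fix \<epsilon> :: real assume \<epsilon>: "0 < \<epsilon>"
  let ?C = "hoelder_const \<epsilon> * chaining_const"
  have C: "0 < ?C" using \<epsilon> chaining_const_pos by (simp add: hoelder_const_def add_pos_pos)
  show "\<exists>K. compactin (mtopology_of D01_uniform) K \<and>
        (\<forall>\<delta>>0. Liminf at_top (\<lambda>r. ereal (inner_prob M {\<omega> \<in> space M.
          (\<lambda>t\<in>{0..1}. r powr (-1/4) * current (\<lambda>s. \<eta> s \<omega>) (r * t)) \<in> enlargement D01_uniform K \<delta>}))
        \<ge> ereal (1 - \<epsilon>))"
  proof (intro exI[of _ "hoelder_ball ?C"] conjI allI impI)
    show "compactin (mtopology_of D01_uniform) (hoelder_ball ?C)"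
      using C by (intro compactin_hoelder_ball) simp
    fix \<delta> :: real assume \<delta>: "0 < \<delta>"
    \<comment> \<open>The ball was chosen from \<open>\<epsilon>\<close> alone. Half of
      \<open>\<delta>\<close> is reserved for the activity of a cell, the other half for the Hoelder
      modulus at the finest mesh, which vanishes as \<open>r\<close> grows.\<close>
    have lim1: "((\<lambda>r. \<delta> / 2 + ?C * (2 / r) powr (1/8)) \<longlongrightarrow> \<delta> / 2) at_top"
      by real_asymp
    have ev1: "\<forall>\<^sub>F r in at_top. \<delta> / 2 + ?C * (2 / r) powr (1/8) < \<delta>"
      by (rule order_tendstoD(2)[OF lim1]) (use \<delta> in simp)
    have lim2: "((\<lambda>r::real. r * exp (4 - \<delta> / 2 * r powr (1/4))) \<longlongrightarrow> 0) at_top"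
      using \<delta> by real_asymp
    have ev2: "\<forall>\<^sub>F r in at_top. r * exp (4 - \<delta> / 2 * r powr (1/4)) < \<epsilon> / 2"
      by (rule order_tendstoD(2)[OF lim2]) (use \<epsilon> in simp)
    have "\<forall>\<^sub>F r in at_top. ereal (1 - \<epsilon>) \<le> ereal (inner_prob M {\<omega> \<in> space M.
          (\<lambda>t\<in>{0..1}. r powr (-1/4) * current (\<lambda>s. \<eta> s \<omega>) (r * t)) \<in> enlargement D01_uniform (hoelder_ball ?C) \<delta>})"
      using ev1 ev2 eventually_ge_at_top[of "1::real"]
    proof eventually_elim
      case (elim r)
      show ?case
        unfolding ereal_less_eq(3)
        by (rule inner_prob_enlargement[of r \<epsilon> "\<delta> / 2" \<delta>]) (use elim \<epsilon> \<delta> in simp_all)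
    qed
    then show "ereal (1 - \<epsilon>) \<le> Liminf at_top (\<lambda>r. ereal (inner_prob M {\<omega> \<in> space M.
          (\<lambda>t\<in>{0..1}. r powr (-1/4) * current (\<lambda>s. \<eta> s \<omega>) (r * t)) \<in> enlargement D01_uniform (hoelder_ball ?C) \<delta>}))"
      by (rule Liminf_bounded)
  qed
qed

end

theorem theorem3p1:
  fixes \<rho> :: real and M :: "'a measure" and \<eta> :: "real \<Rightarrow> 'a \<Rightarrow> config"
  assumes "0 < \<rho>" and "\<rho> < 1"
    and "ssep M \<eta>"
    and "distr M (bernoulli_product \<rho>) (\<eta> 0) = bernoulli_product \<rho>"
  shows "asymptotically_tight M D01_uniform
           (\<lambda>r \<omega>. \<lambda>t\<in>{0..1}. r powr (-1/4) * current (\<lambda>s. \<eta> s \<omega>) (r * t))"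
proof -
  from \<open>ssep M \<eta>\<close> obtain S where "ssep_semigroup S" "markov_process M S \<eta>"
    unfolding ssep_def by blast
  then interpret stationary_ssep M \<eta> S \<rho>
    using assms(1,2,4) by unfold_locales
  show ?thesis by (rule asymptotically_tight_current)
qed

end
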